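(* Let $M$ be a weight and, for $j=0,1,2$, let $A_j$ be either $B^{M,s_j}_{p_j,q_j}(\mathbb R^n)$ or $F^{M,s_j}_{p_j,q_j}(\mathbb R^n)$ (with $s_j\in\mathbb R$, $p_j,q_j\in\,]0,\infty]$, and $p_j<\infty$ in the $F$-case). Suppose that $\pi(\cdot,\cdot)\colon A_0\oplus A_1\to A_2$ is bounded. Then, for every open set $\Omega\subset\mathbb R^n$, $$\pi_\Omega(\cdot,\cdot)\colon A_0(\overline\Omega)\oplus A_1(\overline\Omega)\to A_2(\overline\Omega)$$ is bounded. Moreover, for every open set $\Omega\subset\mathbb R^n$, if $f\in r_\Omega\big(L_{p,\mathrm{loc}}(\mathbb R^n)\cap\mathcal S'(\mathbb R^n)\big)$ and $g\in r_\Omega\big(L_{q,\mathrm{loc}}(\mathbb R^n)\cap\mathcal S'(\mathbb R^n)\big)$ with $0\le\frac1r=\frac1p+\frac1q\le1$, then $\pi_\Omega(f,g)$ is defined and $\pi_\Omega(f,g)=f(x)\cdot g(x)\in L_{r,\mathrm{loc}}(\Omega)$.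
   Context: Anisotropic spaces. A weight is $M=(m_1,\dots,m_n)$ with $m_j\ge1$ and $\min_j m_j=1$; $|M|=m_1+\dots+m_n$. For $t>0$, $t^{M}x=(t^{m_1}x_1,\dots,t^{m_n}x_n)$ and $2^{-kM}x=(2^{-k})^{M}x$. Put $[0]=0$ and, for $x\ne0$, let $[x]$ be the unique $t>0$ with $\sum_i (x_i/t^{m_i})^2=1$. $\mathcal F u(\xi)=\int e^{-ix\cdot\xi}u(x)\,dx$. Fix $\Psi\in C^\infty(\mathbb R)$ with $\Psi(t)=1$ for $0\le t\le\frac{11}{10}$ and $\Psi(t)=0$ for $t\ge\frac{13}{10}$; set $\Psi_j(\xi)=\Psi(2^{-j}[\xi])$ for $j\ge0$, $\Psi_j=0$ for $j<0$, and $\Phi_j=\Psi_j-\Psi_{j-1}$. For $s\in\mathbb R$, $p,q\in\,]0,\infty]$, $B^{M,s}_{p,q}(\mathbb R^n)$ is the space of $u\in\mathcal S'(\mathbb R^n)$ with finite quasi-norm $\big\|\{2^{sj}\|\mathcal F^{-1}(\Phi_j\mathcal Fu)\|_{L_p}\}_{j\ge0}\big\|_{\ell_q}$; for $p<\infty$, $F^{M,s}_{p,q}(\mathbb R^n)$ is the space of $u\in\mathcal S'(\mathbb R^n)$ with finite quasi-norm $\big\|\,\|\{2^{sj}\mathcal F^{-1}(\Phi_j\mathcal Fu)(\cdot)\}_{j\ge0}\|_{\ell_q}\big\|_{L_p}$. Spaces over $\Omega$. $r_\Omega\colon\mathcal D'(\mathbb R^n)\to\mathcal D'(\Omega)$ is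 restriction; $A_j(\overline\Omega)=r_\Omega A_j$ with the infimum quasi-norm $\|u\|_{A_j(\overline\Omega)}=\inf\{\|w\|_{A_j}: w\in A_j,\ r_\Omega w=u\}$. Products. For $\psi\in C_0^\infty(\mathbb R^n)$ equal to $1$ in a neighbourhood of $0$, let $\psi_k(\xi)=\psi(2^{-kM}\xi)$. For $u,v\in\mathcal S'(\mathbb R^n)$, $\pi_\psi(u,v)=\lim_{k\to\infty}\mathcal F^{-1}(\psi_k\mathcal Fu)\cdot\mathcal F^{-1}(\psi_k\mathcal Fv)$ when the limit exists in $\mathcal D'(\mathbb R^n)$; $\pi(u,v):=\pi_\psi(u,v)$ when $\pi_\psi(u,v)$ exists for all such $\psi$ and is independent of $\psi$. For $u,v\in\mathcal D'(\Omega)$, $\pi_\Omega(u,v)$ is defined when there exist $u',v'\in\mathcal S'(\mathbb R^n)$ with $r_\Omega u'=u$, $r_\Omega v'=v$ such that for every such $\psi$ the sequence $r_\Omega\big(\mathcal F^{-1}(\psi_k\mathcal Fu')\cdot\mathcal F^{-1}(\psi_k\mathcal Fv')\big)$ converges in $\mathcal D'(\Omega)$ with a $\psi$-independent limit; then $\pi_\Omega(u,v)$ is this limit (existence and value of the limit do not depend on the choice of $u',v'$). Boundedness of a bilinear operator $\pi\colon A_0\oplus A_1\to A_2$ means that $\pi(u,v)$ is defined for all $(u,v)\in A_0\times A_1$ and $\|\pi(u,v)\|_{A_2}\le c\|u\|_{A_0}\|v\|_{A_1}$ for some $c<\infty$; similarly for $\pi_\Omega$. *)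

theory Defs
  imports "HOL-Analysis.Analysis" "HOL-Probability.Essential_Supremum"
begin

section \<open>Smooth functions, test functions and Schwartz functions\<close>

definition dir_deriv :: "'a::euclidean_space \<Rightarrow> ('a \<Rightarrow> complex) \<Rightarrow> 'a \<Rightarrow> complex" where
  "dir_deriv b f x = frechet_derivative f (at x) b"

text \<open>A multi-index is encoded as a list of standard basis vectors; its length is the order of
  the derivative. (For smooth functions the order of the entries is immaterial.)\<close>

definition iter_deriv :: "'a::euclidean_space list \<Rightarrow> ('a \<Rightarrow> complex) \<Rightarrow> 'a \<Rightarrow> complex" where
  "iter_deriv bs f = foldr dir_deriv bs f"

definition smooth :: "('a::euclidean_space \<Rightarrow> complex) \<Rightarrow> bool" where
  "smooth f \<longleftrightarrow> (\<forall>bs\<in>lists Basis. \<forall>x. iter_deriv bs f differentiable (at x))"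

definition test_functions :: "(real^'n) set \<Rightarrow> (real^'n \<Rightarrow> complex) set" where
  "test_functions \<Omega> =
     {\<phi>. smooth \<phi> \<and> compact (closure {x. \<phi> x \<noteq> 0}) \<and> closure {x. \<phi> x \<noteq> 0} \<subseteq> \<Omega>}"

definition schwartz :: "(real^'n \<Rightarrow> complex) set" where
  "schwartz = {\<phi>. smooth \<phi> \<and>
     (\<forall>bs\<in>lists Basis. \<forall>N::nat. \<exists>C. \<forall>x. (1 + norm x) ^ N * norm (iter_deriv bs \<phi> x) \<le> C)}"


section \<open>Distributions\<close>

text \<open>A distribution is a functional on all complex-valued functions which vanishes outside the
  relevant space of test functions, so that HOL equality of functionals is equality of
  distributions. Continuity is expressed by the usual seminorm estimates.\<close>

definition test_seminorm :: "nat \<Rightarrow> (real^'n \<Rightarrow> complex) \<Rightarrow> real" where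
  "test_seminorm N \<phi> =
     (SUP (bs, x) \<in> {bs \<in> lists Basis. length bs \<le> N} \<times> UNIV. norm (iter_deriv bs \<phi> x))"

definition schwartz_seminorm :: "nat \<Rightarrow> (real^'n \<Rightarrow> complex) \<Rightarrow> real" where
  "schwartz_seminorm N \<phi> =
     (SUP (bs, x) \<in> {bs \<in> lists Basis. length bs \<le> N} \<times> UNIV.
        (1 + norm x) ^ N * norm (iter_deriv bs \<phi> x))"

definition linear_functional_on ::
  "(real^'n \<Rightarrow> complex) set \<Rightarrow> ((real^'n \<Rightarrow> complex) \<Rightarrow> complex) \<Rightarrow> bool" where
  "linear_functional_on X T \<longleftrightarrow>
     (\<forall>\<phi>\<in>X. \<forall>\<theta>\<in>X. T (\<lambda>x. \<phi> x + \<theta> x) = T \<phi> + T \<theta>) \<and>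
     (\<forall>c. \<forall>\<phi>\<in>X. T (\<lambda>x. c * \<phi> x) = c * T \<phi>) \<and>
     (\<forall>\<phi>. \<phi> \<notin> X \<longrightarrow> T \<phi> = 0)"

definition distributions :: "(real^'n) set \<Rightarrow> ((real^'n \<Rightarrow> complex) \<Rightarrow> complex) set" where
  "distributions \<Omega> = {T. linear_functional_on (test_functions \<Omega>) T \<and>
     (\<forall>K. compact K \<and> K \<subseteq> \<Omega> \<longrightarrow>
        (\<exists>C N. \<forall>\<phi>\<in>test_functions \<Omega>. closure {x. \<phi> x \<noteq> 0} \<subseteq> K \<longrightarrow>
           norm (T \<phi>) \<le> C * test_seminorm N \<phi>))}"

definition tempered :: "((real^'n \<Rightarrow> complex) \<Rightarrow> complex) set" where
  "tempered = {u. linear_functional_on schwartz u \<and>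
     (\<exists>C N. \<forall>\<phi>\<in>schwartz. norm (u \<phi>) \<le> C * schwartz_seminorm N \<phi>)}"

text \<open>The restriction \<open>r\<^sub>\<Omega>\<close>. With \<open>\<Omega> = UNIV\<close>, applied to a tempered distribution, it is the
  embedding of the tempered distributions into the distributions on the whole space.\<close>

definition restr ::
  "(real^'n) set \<Rightarrow> ((real^'n \<Rightarrow> complex) \<Rightarrow> complex) \<Rightarrow> (real^'n \<Rightarrow> complex) \<Rightarrow> complex" where
  "restr \<Omega> T = (\<lambda>\<phi>. if \<phi> \<in> test_functions \<Omega> then T \<phi> else 0)"

definition regular_dist ::
  "(real^'n) set \<Rightarrow> (real^'n \<Rightarrow> complex) \<Rightarrow> (real^'n \<Rightarrow> complex) \<Rightarrow> complex" where
  "regular_dist \<Omega> f =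
     (\<lambda>\<phi>. if \<phi> \<in> test_functions \<Omega> then (LINT x:\<Omega>|lebesgue. f x * \<phi> x) else 0)"

text \<open>The continuous function with which a distribution is identified, if there is one.\<close>

definition fun_of_dist :: "((real^'n \<Rightarrow> complex) \<Rightarrow> complex) \<Rightarrow> real^'n \<Rightarrow> complex" where
  "fun_of_dist T = (THE f. continuous_on UNIV f \<and> regular_dist UNIV f = restr UNIV T)"


section \<open>The Fourier transformation\<close>

definition fourier :: "(real^'n \<Rightarrow> complex) \<Rightarrow> real^'n \<Rightarrow> complex" where
  "fourier \<phi> \<xi> = (LINT x|lborel. exp (- \<i> * complex_of_real (x \<bullet> \<xi>)) * \<phi> x)"

definition inv_fourier :: "(real^'n \<Rightarrow> complex) \<Rightarrow> real^'n \<Rightarrow> complex" where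
  "inv_fourier \<phi> x = complex_of_real (1 / (2 * pi) ^ CARD('n)) *
     (LINT \<xi>|lborel. exp (\<i> * complex_of_real (x \<bullet> \<xi>)) * \<phi> \<xi>)"

definition fourier_dist ::
  "((real^'n \<Rightarrow> complex) \<Rightarrow> complex) \<Rightarrow> (real^'n \<Rightarrow> complex) \<Rightarrow> complex" where
  "fourier_dist u = (\<lambda>\<phi>. if \<phi> \<in> schwartz then u (fourier \<phi>) else 0)"

definition inv_fourier_dist ::
  "((real^'n \<Rightarrow> complex) \<Rightarrow> complex) \<Rightarrow> (real^'n \<Rightarrow> complex) \<Rightarrow> complex" where
  "inv_fourier_dist u = (\<lambda>\<phi>. if \<phi> \<in> schwartz then u (inv_fourier \<phi>) else 0)"

definition mult_dist ::
  "(real^'n \<Rightarrow> complex) \<Rightarrow> ((real^'n \<Rightarrow> complex) \<Rightarrow> complex) \<Rightarrow> (real^'n \<Rightarrow> complex) \<Rightarrow> complex" where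
  "mult_dist \<sigma> u = (\<lambda>\<phi>. if \<phi> \<in> schwartz then u (\<lambda>x. \<sigma> x * \<phi> x) else 0)"

text \<open>The function \<open>\<F>\<^sup>-\<^sup>1(\<sigma> \<F>u)\<close>. It is only used for smooth, compactly supported \<open>\<sigma>\<close> and tempered
  \<open>u\<close>, when this distribution is given by a smooth function.\<close>

definition fourier_multiplier ::
  "(real^'n \<Rightarrow> complex) \<Rightarrow> ((real^'n \<Rightarrow> complex) \<Rightarrow> complex) \<Rightarrow> real^'n \<Rightarrow> complex" where
  "fourier_multiplier \<sigma> u = fun_of_dist (inv_fourier_dist (mult_dist \<sigma> (fourier_dist u)))"


section \<open>Quasi-norms of Lebesgue type\<close>

text \<open>Meant for exponents \<open>a > 0\<close>.\<close>

definition ennreal_powr :: "ennreal \<Rightarrow> real \<Rightarrow> ennreal" where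
  "ennreal_powr x a = (if x = \<infinity> then \<infinity> else ennreal (enn2real x powr a))"

text \<open>For \<open>0 < p \<le> \<infinity>\<close>; the sequence quasi-norms are the case of the counting measure.\<close>

definition Lp_norm :: "'a measure \<Rightarrow> ennreal \<Rightarrow> ('a \<Rightarrow> ennreal) \<Rightarrow> ennreal" where
  "Lp_norm \<mu> p f =
     (if p = \<infinity> then esssup \<mu> f
      else ennreal_powr (\<integral>\<^sup>+ x. ennreal_powr (f x) (enn2real p) \<partial>\<mu>) (1 / enn2real p))"

abbreviation lq_norm :: "ennreal \<Rightarrow> (nat \<Rightarrow> ennreal) \<Rightarrow> ennreal" where
  "lq_norm \<equiv> Lp_norm (count_space UNIV)"

definition Lp_loc :: "(real^'n) set \<Rightarrow> ennreal \<Rightarrow> (real^'n \<Rightarrow> complex) set" where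
  "Lp_loc \<Omega> p = {f. f \<in> borel_measurable (lebesgue_on \<Omega>) \<and>
     (\<forall>K. compact K \<and> K \<subseteq> \<Omega> \<longrightarrow> Lp_norm (lebesgue_on K) p (\<lambda>x. ennreal (norm (f x))) < \<infinity>)}"

text \<open>The intersection of \<open>L\<^sub>p\<^sub>,\<^sub>l\<^sub>o\<^sub>c(\<real>\<^sup>n)\<close> with the tempered distributions, meant for \<open>p \<ge> 1\<close>.
  Only pairings with compactly supported functions are given by the integral.\<close>

definition tempered_Lp_loc :: "ennreal \<Rightarrow> ((real^'n \<Rightarrow> complex) \<Rightarrow> complex) set" where
  "tempered_Lp_loc p = {u \<in> tempered. \<exists>f\<in>Lp_loc UNIV p. restr UNIV u = regular_dist UNIV f}"


section \<open>Anisotropic Besov and Lizorkin-Triebel spaces\<close>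

definition weight :: "real^'n \<Rightarrow> bool" where
  "weight M \<longleftrightarrow> (\<forall>i. M $ i \<ge> 1) \<and> Min (range (\<lambda>i. M $ i)) = 1"

definition aniso_dilation :: "real^'n \<Rightarrow> real \<Rightarrow> real^'n \<Rightarrow> real^'n" where
  "aniso_dilation M t x = (\<chi> i. t powr (M $ i) * x $ i)"

definition aniso_length :: "real^'n \<Rightarrow> real^'n \<Rightarrow> real" where
  "aniso_length M x =
     (if x = 0 then 0 else (THE t. t > 0 \<and> (\<Sum>i\<in>UNIV. (x $ i / t powr (M $ i))\<^sup>2) = 1))"

definition LP_generator :: "(real \<Rightarrow> complex) \<Rightarrow> bool" where
  "LP_generator \<Psi> \<longleftrightarrow> smooth \<Psi> \<and> (\<forall>t. 0 \<le> t \<and> t \<le> 11/10 \<longrightarrow> \<Psi> t = 1) \<and> (\<forall>t\<ge>13/10. \<Psi> t = 0)"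

definition LP_low :: "real^'n \<Rightarrow> (real \<Rightarrow> complex) \<Rightarrow> int \<Rightarrow> real^'n \<Rightarrow> complex" where
  "LP_low M \<Psi> j \<xi> = (if j < 0 then 0 else \<Psi> (2 powr (- real_of_int j) * aniso_length M \<xi>))"

definition LP_part :: "real^'n \<Rightarrow> (real \<Rightarrow> complex) \<Rightarrow> nat \<Rightarrow> real^'n \<Rightarrow> complex" where
  "LP_part M \<Psi> j \<xi> = LP_low M \<Psi> (int j) \<xi> - LP_low M \<Psi> (int j - 1) \<xi>"

definition besov_norm :: "real^'n \<Rightarrow> (real \<Rightarrow> complex) \<Rightarrow> real \<Rightarrow> ennreal \<Rightarrow> ennreal \<Rightarrow>
    ((real^'n \<Rightarrow> complex) \<Rightarrow> complex) \<Rightarrow> ennreal" where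
  "besov_norm M \<Psi> s p q u =
     lq_norm q (\<lambda>j. ennreal (2 powr (s * real j)) *
       Lp_norm lborel p (\<lambda>x. ennreal (norm (fourier_multiplier (LP_part M \<Psi> j) u x))))"

definition lizorkin_triebel_norm :: "real^'n \<Rightarrow> (real \<Rightarrow> complex) \<Rightarrow> real \<Rightarrow> ennreal \<Rightarrow> ennreal \<Rightarrow>
    ((real^'n \<Rightarrow> complex) \<Rightarrow> complex) \<Rightarrow> ennreal" where
  "lizorkin_triebel_norm M \<Psi> s p q u =
     Lp_norm lborel p (\<lambda>x. lq_norm q (\<lambda>j. ennreal (2 powr (s * real j)) *
       ennreal (norm (fourier_multiplier (LP_part M \<Psi> j) u x))))"

datatype space_index = Besov real ennreal ennreal | Lizorkin_Triebel real ennreal ennreal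

fun admissible :: "space_index \<Rightarrow> bool" where
  "admissible (Besov s p q) \<longleftrightarrow> 0 < p \<and> 0 < q"
| "admissible (Lizorkin_Triebel s p q) \<longleftrightarrow> 0 < p \<and> p < \<infinity> \<and> 0 < q"

fun space_norm :: "real^'n \<Rightarrow> (real \<Rightarrow> complex) \<Rightarrow> space_index \<Rightarrow>
    ((real^'n \<Rightarrow> complex) \<Rightarrow> complex) \<Rightarrow> ennreal" where
  "space_norm M \<Psi> (Besov s p q) u = besov_norm M \<Psi> s p q u"
| "space_norm M \<Psi> (Lizorkin_Triebel s p q) u = lizorkin_triebel_norm M \<Psi> s p q u"

definition aniso_space :: "real^'n \<Rightarrow> (real \<Rightarrow> complex) \<Rightarrow> space_index \<Rightarrow>
    ((real^'n \<Rightarrow> complex) \<Rightarrow> complex) set" where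
  "aniso_space M \<Psi> A = {u \<in> tempered. space_norm M \<Psi> A u < \<infinity>}"

definition aniso_space_on :: "real^'n \<Rightarrow> (real \<Rightarrow> complex) \<Rightarrow> space_index \<Rightarrow> (real^'n) set \<Rightarrow>
    ((real^'n \<Rightarrow> complex) \<Rightarrow> complex) set" where
  "aniso_space_on M \<Psi> A \<Omega> = restr \<Omega> ` aniso_space M \<Psi> A"

definition space_norm_on :: "real^'n \<Rightarrow> (real \<Rightarrow> complex) \<Rightarrow> space_index \<Rightarrow> (real^'n) set \<Rightarrow>
    ((real^'n \<Rightarrow> complex) \<Rightarrow> complex) \<Rightarrow> ennreal" where
  "space_norm_on M \<Psi> A \<Omega> u = Inf {space_norm M \<Psi> A w | w. w \<in> aniso_space M \<Psi> A \<and> restr \<Omega> w = u}"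


section \<open>Products\<close>

definition cutoffs :: "(real^'n \<Rightarrow> complex) set" where
  "cutoffs = {\<psi> \<in> test_functions UNIV. \<forall>\<^sub>F \<xi> in nhds 0. \<psi> \<xi> = 1}"

definition low_freq :: "real^'n \<Rightarrow> (real^'n \<Rightarrow> complex) \<Rightarrow> nat \<Rightarrow>
    ((real^'n \<Rightarrow> complex) \<Rightarrow> complex) \<Rightarrow> real^'n \<Rightarrow> complex" where
  "low_freq M \<psi> k u = fourier_multiplier (\<lambda>\<xi>. \<psi> (aniso_dilation M (2 powr (- real k)) \<xi>)) u"

definition tendsto_dist :: "(real^'n) set \<Rightarrow> (nat \<Rightarrow> (real^'n \<Rightarrow> complex) \<Rightarrow> complex) \<Rightarrow>
    ((real^'n \<Rightarrow> complex) \<Rightarrow> complex) \<Rightarrow> bool" where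
  "tendsto_dist \<Omega> T w \<longleftrightarrow> w \<in> distributions \<Omega> \<and> (\<forall>\<phi>\<in>test_functions \<Omega>. (\<lambda>k. T k \<phi>) \<longlonglongrightarrow> w \<phi>)"

text \<open>\<open>w\<close> is, for every cut-off function, the limit in the distributions on \<open>\<Omega>\<close> of the restricted
  products of regularisations of the tempered distributions \<open>u\<close> and \<open>v\<close>.\<close>

definition product_limit :: "real^'n \<Rightarrow> (real^'n) set \<Rightarrow> ((real^'n \<Rightarrow> complex) \<Rightarrow> complex) \<Rightarrow>
    ((real^'n \<Rightarrow> complex) \<Rightarrow> complex) \<Rightarrow> ((real^'n \<Rightarrow> complex) \<Rightarrow> complex) \<Rightarrow> bool" where
  "product_limit M \<Omega> u v w \<longleftrightarrow> u \<in> tempered \<and> v \<in> tempered \<and>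
     (\<forall>\<psi>\<in>cutoffs. tendsto_dist \<Omega>
        (\<lambda>k. restr \<Omega> (regular_dist UNIV (\<lambda>x. low_freq M \<psi> k u x * low_freq M \<psi> k v x))) w)"

definition pi_defined :: "real^'n \<Rightarrow> ((real^'n \<Rightarrow> complex) \<Rightarrow> complex) \<Rightarrow>
    ((real^'n \<Rightarrow> complex) \<Rightarrow> complex) \<Rightarrow> bool" where
  "pi_defined M u v \<longleftrightarrow> (\<exists>w. product_limit M UNIV u v w)"

definition pi_product :: "real^'n \<Rightarrow> ((real^'n \<Rightarrow> complex) \<Rightarrow> complex) \<Rightarrow>
    ((real^'n \<Rightarrow> complex) \<Rightarrow> complex) \<Rightarrow> (real^'n \<Rightarrow> complex) \<Rightarrow> complex" where
  "pi_product M u v = (THE w. product_limit M UNIV u v w)"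

definition product_limit_on :: "real^'n \<Rightarrow> (real^'n) set \<Rightarrow> ((real^'n \<Rightarrow> complex) \<Rightarrow> complex) \<Rightarrow>
    ((real^'n \<Rightarrow> complex) \<Rightarrow> complex) \<Rightarrow> ((real^'n \<Rightarrow> complex) \<Rightarrow> complex) \<Rightarrow> bool" where
  "product_limit_on M \<Omega> u v w \<longleftrightarrow>
     (\<exists>u'\<in>tempered. \<exists>v'\<in>tempered. restr \<Omega> u' = u \<and> restr \<Omega> v' = v \<and> product_limit M \<Omega> u' v' w)"

definition pi_on_defined :: "real^'n \<Rightarrow> (real^'n) set \<Rightarrow> ((real^'n \<Rightarrow> complex) \<Rightarrow> complex) \<Rightarrow>
    ((real^'n \<Rightarrow> complex) \<Rightarrow> complex) \<Rightarrow> bool" where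
  "pi_on_defined M \<Omega> u v \<longleftrightarrow> (\<exists>w. product_limit_on M \<Omega> u v w)"

text \<open>The description is proper because the limit does not depend on the choice of the tempered
  extensions of \<open>u\<close> and \<open>v\<close>.\<close>

definition pi_on :: "real^'n \<Rightarrow> (real^'n) set \<Rightarrow> ((real^'n \<Rightarrow> complex) \<Rightarrow> complex) \<Rightarrow>
    ((real^'n \<Rightarrow> complex) \<Rightarrow> complex) \<Rightarrow> (real^'n \<Rightarrow> complex) \<Rightarrow> complex" where
  "pi_on M \<Omega> u v = (THE w. product_limit_on M \<Omega> u v w)"

text \<open>The product lies a priori only in the distributions on the whole space; its quasi-norm is that
  of its (unique) tempered extension \<open>w\<close>.\<close>

definition pi_bounded :: "real^'n \<Rightarrow> (real \<Rightarrow> complex) \<Rightarrow>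
    space_index \<Rightarrow> space_index \<Rightarrow> space_index \<Rightarrow> bool" where
  "pi_bounded M \<Psi> A0 A1 A2 \<longleftrightarrow>
     (\<exists>c::real. \<forall>u\<in>aniso_space M \<Psi> A0. \<forall>v\<in>aniso_space M \<Psi> A1.
        pi_defined M u v \<and>
        (\<exists>w\<in>aniso_space M \<Psi> A2. restr UNIV w = pi_product M u v \<and>
           space_norm M \<Psi> A2 w \<le> ennreal c * space_norm M \<Psi> A0 u * space_norm M \<Psi> A1 v))"

definition pi_on_bounded :: "real^'n \<Rightarrow> (real \<Rightarrow> complex) \<Rightarrow> (real^'n) set \<Rightarrow>
    space_index \<Rightarrow> space_index \<Rightarrow> space_index \<Rightarrow> bool" where
  "pi_on_bounded M \<Psi> \<Omega> A0 A1 A2 \<longleftrightarrow>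
     (\<exists>c::real. \<forall>u\<in>aniso_space_on M \<Psi> A0 \<Omega>. \<forall>v\<in>aniso_space_on M \<Psi> A1 \<Omega>.
        pi_on_defined M \<Omega> u v \<and>
        pi_on M \<Omega> u v \<in> aniso_space_on M \<Psi> A2 \<Omega> \<and>
        space_norm_on M \<Psi> A2 \<Omega> (pi_on M \<Omega> u v) \<le>
          ennreal c * space_norm_on M \<Psi> A0 \<Omega> u * space_norm_on M \<Psi> A1 \<Omega> v)"

end

theory Submission
  imports Defs "HOL-Probability.Probability"
begin

text \<open>The low frequency part of a tempered distribution \<open>u\<close> is the smooth function
  \<open>x \<mapsto> u (\<eta>\<^sub>k (x - \<cdot>))\<close>, where \<open>\<eta>\<^sub>k\<close> are the anisotropic dilates of a fixed Schwartz function. On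
  compact sets it grows at most like a power of \<open>2\<^sup>k\<close>, and where \<open>u\<close> vanishes it decays faster than any
  power of \<open>2\<^sup>-\<^sup>k\<close>. Hence changing \<open>u\<close> or \<open>v\<close> off \<open>\<Omega>\<close> does not change the limit of the products on
  \<open>\<Omega>\<close>, so \<open>\<pi>\<^sub>\<Omega>\<close> is the restriction of \<open>\<pi>\<close> applied to arbitrary extensions, and boundedness follows
  by taking the infimum over the extensions.

  By the same locality, locally integrable \<open>f\<close> and \<open>g\<close> may be cut off to compact sets. Then the product
  of their low frequency parts is an average of products of translates of \<open>f\<close> and \<open>g\<close>, and
  Hoelder's inequality with continuity of translation in \<open>L\<^sub>p\<close>, \<open>p < \<infinity>\<close>, gives the limit \<open>f g\<close>.\<close>

section \<open>Smooth functions\<close>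

text \<open>Low frequency parts are defined through a definite description of a continuous function,
  so the formula u (\<eta>_k (x - .)) must itself be derived: this takes an interchange of u with an
  integral and the uniqueness of continuous representatives. Locality is a contest of two rates. A
  fixed u and a fixed compact set give one growth exponent A, whereas the decay off the support of u
  has any order; order A + 1 therefore wins against the other factor. For exponents (p, q) only one
  factor is approximated by continuous functions, because translation is not continuous in
  L_\<infinity>; on bounded sets the approximated factor can always be given a finite exponent, even
  for p = q = \<infinity>. The limit carries the constant \<psi> 0 * \<psi> 0 = 1, the squared mass
  of the kernel. Smooth bumps are all built from \<Psi>, which is why \<open>LP_generator\<close>
  accompanies even elementary facts on test functions. A distribution determines its representing
  function only almost everywhere, so the pointwise product is compared for arbitrary
  representatives by du Bois-Reymond's lemma.\<close>

lemma iter_deriv_Nil [simp]: "iter_deriv [] f = f"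
  by (simp add: iter_deriv_def)

lemma iter_deriv_Cons: "iter_deriv (b # bs) f = dir_deriv b (iter_deriv bs f)"
  by (simp add: iter_deriv_def)

lemma iter_deriv_append: "iter_deriv (bs @ cs) f = iter_deriv bs (iter_deriv cs f)"
  by (simp add: iter_deriv_def)

lemma dir_deriv_eqI: "(f has_derivative f') (at x) \<Longrightarrow> dir_deriv b f x = f' b"
  unfolding dir_deriv_def using frechet_derivative_at by metis

text \<open>Smoothness to finite order, introduced for induction: with the function left arbitrary,
  one order is spent on each differentiation, and the derivative of a product or a composite is
  again a combination of functions of the remaining order.\<close>

definition differentiable_upto :: "nat \<Rightarrow> ('a::euclidean_space \<Rightarrow> complex) \<Rightarrow> bool" where
  "differentiable_upto n f \<longleftrightarrow>
     (\<forall>bs\<in>lists Basis. length bs \<le> n \<longrightarrow> (\<forall>x. iter_deriv bs f differentiable (at x)))"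

lemma differentiable_upto_0: "differentiable_upto 0 f \<longleftrightarrow> (\<forall>x. f differentiable (at x))"
  by (force simp: differentiable_upto_def)

text \<open>\<open>iter_deriv\<close> folds from the right, so the last entry of the list is
  differentiated first; splitting it off puts the derivative on \<open>f\<close> itself, as the
  induction on the order requires.\<close>

lemma differentiable_upto_Suc:
  "differentiable_upto (Suc n) f \<longleftrightarrow>
     (\<forall>x. f differentiable (at x)) \<and> (\<forall>b\<in>Basis. differentiable_upto n (dir_deriv b f))"
  (is "?L \<longleftrightarrow> ?R")
proof
  assume L: ?L
  have "iter_deriv bs (dir_deriv b f) differentiable (at x)"
    if "b \<in> Basis" "bs \<in> lists Basis" "length bs \<le> n" for b bs x
    using L[unfolded differentiable_upto_def, rule_format, of "bs @ [b]" x] that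
    by (simp add: iter_deriv_append iter_deriv_Cons)
  moreover have "f differentiable (at x)" for x
    using L[unfolded differentiable_upto_def, rule_format, of "[]" x] by simp
  ultimately show ?R by (auto simp: differentiable_upto_def)
next
  assume R: ?R
  have "iter_deriv bs f differentiable (at x)"
    if "bs \<in> lists Basis" "length bs \<le> Suc n" for bs x
  proof (cases bs rule: rev_cases)
    case Nil
    then show ?thesis using R by simp
  next
    case (snoc cs b)
    then show ?thesis using R that
      by (simp add: iter_deriv_append iter_deriv_Cons differentiable_upto_def)
  qed
  then show ?L by (simp add: differentiable_upto_def)
qed

lemma differentiable_upto_SucD: "differentiable_upto (Suc n) f \<Longrightarrow> differentiable_upto n f"
  by (simp add: differentiable_upto_def)

lemma smooth_iff_upto: "smooth f \<longleftrightarrow> (\<forall>n. differentiable_upto n f)"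
  by (auto simp: smooth_def differentiable_upto_def)

lemma smooth_differentiable: "smooth f \<Longrightarrow> f differentiable (at x)"
  unfolding smooth_def by (metis iter_deriv_Nil lists.Nil)

lemma smooth_has_derivative: "smooth f \<Longrightarrow> (f has_derivative frechet_derivative f (at x)) (at x)"
  using smooth_differentiable frechet_derivative_works by blast

lemma smooth_continuous_on: "smooth f \<Longrightarrow> continuous_on S f"
  by (meson smooth_differentiable differentiable_imp_continuous_on differentiable_at_imp_differentiable_on)

lemma smooth_borel: "smooth f \<Longrightarrow> f \<in> borel_measurable borel"
  by (intro borel_measurable_continuous_onI smooth_continuous_on)

lemma smooth_iter_deriv: "smooth f \<Longrightarrow> bs \<in> lists Basis \<Longrightarrow> smooth (iter_deriv bs f)"
  by (simp add: smooth_def flip: iter_deriv_append)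

lemma smooth_dir_deriv: "smooth f \<Longrightarrow> b \<in> Basis \<Longrightarrow> smooth (dir_deriv b f)"
  using smooth_iter_deriv[of f "[b]"] by (simp add: iter_deriv_Cons)

lemma smoothI:
  assumes "\<And>x. f differentiable (at x)" "\<And>b. b \<in> Basis \<Longrightarrow> smooth (dir_deriv b f)"
  shows "smooth f"
  unfolding smooth_iff_upto
proof
  fix n show "differentiable_upto n f"
    using assms by (cases n) (auto simp: differentiable_upto_0 differentiable_upto_Suc smooth_iff_upto)
qed

lemma dir_deriv_const [simp]: "dir_deriv b (\<lambda>x. c) = (\<lambda>x. 0)"
  by (simp add: dir_deriv_def fun_eq_iff)

lemma iter_deriv_zero [simp]: "iter_deriv bs (\<lambda>x. 0) = (\<lambda>x. 0)"
  by (induction bs) (simp_all add: iter_deriv_Cons)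

lemma smooth_zero: "smooth (\<lambda>x. 0)"
  by (simp add: smooth_def)

lemma smooth_const: "smooth (\<lambda>x. c)"
  by (rule smoothI) (simp_all add: smooth_zero)

lemma dir_deriv_add:
  assumes "\<And>x. f differentiable (at x)" "\<And>x. g differentiable (at x)"
  shows "dir_deriv b (\<lambda>x. f x + g x) = (\<lambda>x. dir_deriv b f x + dir_deriv b g x)"
proof
  fix x
  show "dir_deriv b (\<lambda>x. f x + g x) x = dir_deriv b f x + dir_deriv b g x"
    by (subst dir_deriv_eqI[OF has_derivative_add[OF assms(1,2)[THEN frechet_derivative_works[THEN iffD1]]]])
       (simp add: dir_deriv_def)
qed

lemma dir_deriv_mult:
  assumes "\<And>x. f differentiable (at x)" "\<And>x. g differentiable (at x)"
  shows "dir_deriv b (\<lambda>x. f x * g x) = (\<lambda>x. dir_deriv b f x * g x + f x * dir_deriv b g x)"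
proof
  fix x
  show "dir_deriv b (\<lambda>x. f x * g x) x = dir_deriv b f x * g x + f x * dir_deriv b g x"
    by (subst dir_deriv_eqI[OF has_derivative_mult[OF assms(1,2)[THEN frechet_derivative_works[THEN iffD1]]]])
       (simp add: dir_deriv_def)
qed

lemma differentiable_upto_add:
  "differentiable_upto n f \<Longrightarrow> differentiable_upto n g \<Longrightarrow> differentiable_upto n (\<lambda>x. f x + g x)"
proof (induction n arbitrary: f g)
  case (Suc n)
  then show ?case by (simp add: differentiable_upto_Suc dir_deriv_add)
qed (simp add: differentiable_upto_0)

lemma differentiable_upto_mult:
  "differentiable_upto n f \<Longrightarrow> differentiable_upto n g \<Longrightarrow> differentiable_upto n (\<lambda>x. f x * g x)"
proof (induction n arbitrary: f g)
  case (Suc n)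
  note fg = Suc.prems[THEN differentiable_upto_SucD]
  have "differentiable_upto n (\<lambda>x. dir_deriv b f x * g x + f x * dir_deriv b g x)" if "b \<in> Basis" for b
    using Suc.prems fg that
    by (intro differentiable_upto_add Suc.IH) (simp_all add: differentiable_upto_Suc)
  then show ?case using Suc.prems by (simp add: differentiable_upto_Suc dir_deriv_mult)
qed (simp add: differentiable_upto_0)

lemma smooth_add: "smooth f \<Longrightarrow> smooth g \<Longrightarrow> smooth (\<lambda>x. f x + g x)"
  by (simp add: smooth_iff_upto differentiable_upto_add)

lemma smooth_mult: "smooth f \<Longrightarrow> smooth g \<Longrightarrow> smooth (\<lambda>x. f x * g x)"
  by (simp add: smooth_iff_upto differentiable_upto_mult)

lemma smooth_sum: "(\<And>i. i \<in> I \<Longrightarrow> smooth (f i)) \<Longrightarrow> smooth (\<lambda>x. \<Sum>i\<in>I. f i x)"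
  by (induction I rule: infinite_finite_induct) (auto intro: smooth_add smooth_zero)

lemma iter_deriv_add:
  assumes "smooth f" "smooth g" "bs \<in> lists Basis"
  shows "iter_deriv bs (\<lambda>x. f x + g x) = (\<lambda>x. iter_deriv bs f x + iter_deriv bs g x)"
  using assms(3)
proof (induction bs)
  case (Cons b bs)
  then show ?case
    by (simp add: iter_deriv_Cons dir_deriv_add assms(1,2) smooth_differentiable smooth_iter_deriv)
qed simp

lemma iter_deriv_cmult:
  assumes "smooth f" "bs \<in> lists Basis"
  shows "iter_deriv bs (\<lambda>x. c * f x) = (\<lambda>x. c * iter_deriv bs f x)"
  using assms(2)
proof (induction bs)
  case (Cons b bs)
  then show ?case
    by (simp add: iter_deriv_Cons dir_deriv_mult assms(1) smooth_differentiable smooth_iter_deriv)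
qed simp

lemma smooth_cmult: "smooth f \<Longrightarrow> smooth (\<lambda>x. c * f x)"
  by (intro smooth_mult smooth_const)

lemma smooth_diff: "smooth f \<Longrightarrow> smooth g \<Longrightarrow> smooth (\<lambda>x. f x - g x)"
  using smooth_add[OF _ smooth_cmult[of g "-1"], of f] by simp

lemma iter_deriv_diff:
  assumes "smooth f" "smooth g" "bs \<in> lists Basis"
  shows "iter_deriv bs (\<lambda>x. f x - g x) = (\<lambda>x. iter_deriv bs f x - iter_deriv bs g x)"
  using iter_deriv_add[OF assms(1) smooth_cmult[OF assms(2), of "-1"] assms(3)]
    iter_deriv_cmult[OF assms(2,3), of "-1"] by simp

lemma iter_deriv_sum:
  assumes "\<And>i. i \<in> I \<Longrightarrow> smooth (f i)" "bs \<in> lists Basis"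
  shows "iter_deriv bs (\<lambda>x. \<Sum>i\<in>I. f i x) = (\<lambda>x. \<Sum>i\<in>I. iter_deriv bs (f i) x)"
  using assms(1)
proof (induction I rule: infinite_finite_induct)
  case (insert i I)
  then show ?case using assms(2) by (simp add: iter_deriv_add smooth_sum)
qed simp_all

lemma smooth_inner: "smooth (\<lambda>x. complex_of_real (x \<bullet> b))"
proof (rule smoothI)
  have der: "((\<lambda>x. complex_of_real (x \<bullet> b)) has_derivative (\<lambda>h. complex_of_real (h \<bullet> b))) (at x)" for x
    by (intro derivative_eq_intros bounded_linear.has_derivative[OF bounded_linear_of_real]) auto
  then show "(\<lambda>x. complex_of_real (x \<bullet> b)) differentiable (at x)" for x
    using differentiable_def by blast
  show "smooth (dir_deriv c (\<lambda>x. complex_of_real (x \<bullet> b)))" for c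
  proof -
    have "dir_deriv c (\<lambda>x. complex_of_real (x \<bullet> b)) = (\<lambda>x. complex_of_real (c \<bullet> b))"
      using dir_deriv_eqI[OF der] by auto
    then show ?thesis by (simp add: smooth_const)
  qed
qed

text \<open>Conjugation is real linear and so commutes with every directional derivative. It serves
  to turn a complex valued bump \<beta> into the nonnegative test function
  \<open>cnj (\<beta> x) * \<beta> x\<close>.\<close>

lemma smooth_cnj:
  assumes "smooth f" shows "smooth (\<lambda>x. cnj (f x))"
proof -
  have der: "((\<lambda>x. cnj (f x)) has_derivative (\<lambda>h. cnj (frechet_derivative f (at x) h))) (at x)"
    if "f differentiable (at x)" for f :: "'a \<Rightarrow> complex" and x
    using that by (intro bounded_linear.has_derivative[OF bounded_linear_cnj]) (simp add: frechet_derivative_works)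
  then have dif: "(\<lambda>x. cnj (f x)) differentiable (at x)"
    if "f differentiable (at x)" for f :: "'a \<Rightarrow> complex" and x
    using that unfolding differentiable_def by blast
  have d: "dir_deriv b (\<lambda>x. cnj (f x)) = (\<lambda>x. cnj (dir_deriv b f x))"
    if "\<And>x. f differentiable (at x)" for f :: "'a \<Rightarrow> complex" and b
    using dir_deriv_eqI[OF der[OF that]] by (auto simp: dir_deriv_def)
  have "differentiable_upto n f \<Longrightarrow> differentiable_upto n (\<lambda>x. cnj (f x))" for n and f :: "'a \<Rightarrow> complex"
  proof (induction n arbitrary: f)
    case 0
    then show ?case using dif[of f] by (simp add: differentiable_upto_0)
  next
    case (Suc n)
    then show ?case using dif[of f] d[of f] by (simp add: differentiable_upto_Suc)
  qed
  then show ?thesis using assms by (simp add: smooth_iff_upto)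
qed

text \<open>Chain rule for a real inner function. \<open>smooth\<close> speaks of complex valued
  functions only, so the inner map enters as \<open>complex_of_real (q x)\<close> and its real
  derivative is recovered from the complex one.\<close>

lemma smooth_compose_real:
  fixes q :: "'a::euclidean_space \<Rightarrow> real" and \<Psi> :: "real \<Rightarrow> complex"
  assumes "smooth \<Psi>" "smooth (\<lambda>x. complex_of_real (q x))"
  shows "smooth (\<lambda>x. \<Psi> (q x))"
proof -
  have qd: "(q has_derivative (\<lambda>h. Re (frechet_derivative (\<lambda>x. complex_of_real (q x)) (at x) h))) (at x)" for x
    using bounded_linear.has_derivative[OF bounded_linear_Re smooth_has_derivative[OF assms(2), of x]] by simp
  \<comment> \<open>The imaginary part of the map is constantly 0; by uniqueness of derivatives its
    derivative is 0, so the complex derivative is real and may be multiplied with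
    \<open>dir_deriv 1 \<Psi>\<close>.\<close>
  have im: "frechet_derivative (\<lambda>x. complex_of_real (q x)) (at x) h \<in> \<real>" for x h
    using has_derivative_unique[OF bounded_linear.has_derivative[OF bounded_linear_Im smooth_has_derivative[OF assms(2), of x]], of "\<lambda>x. 0"]
    by (auto simp: complex_is_Real_iff fun_eq_iff)
  have lin: "frechet_derivative \<Psi> (at t) r = of_real r * dir_deriv 1 \<Psi> t"
    if "\<Psi> differentiable (at t)" for \<Psi> :: "real \<Rightarrow> complex" and t r
    using linear_scale[OF linear_frechet_derivative[OF that], of r 1]
    by (simp add: dir_deriv_def scaleR_conv_of_real)
  have der: "((\<lambda>x. \<Psi> (q x)) has_derivative
      (\<lambda>h. frechet_derivative (\<lambda>x. complex_of_real (q x)) (at x) h * dir_deriv 1 \<Psi> (q x))) (at x)"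
    if "\<And>t. \<Psi> differentiable (at t)" for \<Psi> :: "real \<Rightarrow> complex" and x
  proof -
    have "((\<lambda>x. \<Psi> (q x)) has_derivative
      (\<lambda>h. frechet_derivative \<Psi> (at (q x)) (Re (frechet_derivative (\<lambda>x. complex_of_real (q x)) (at x) h)))) (at x)"
      using has_derivative_compose[OF qd that[unfolded frechet_derivative_works]] .
    then show ?thesis by (simp add: lin[OF that] of_real_Re[OF im])
  qed
  then have dif: "(\<lambda>x. \<Psi> (q x)) differentiable (at x)"
    if "\<And>t. \<Psi> differentiable (at t)" for \<Psi> :: "real \<Rightarrow> complex" and x
    using that unfolding differentiable_def by blast
  have d: "dir_deriv b (\<lambda>x. \<Psi> (q x)) =
      (\<lambda>x. dir_deriv b (\<lambda>x. complex_of_real (q x)) x * dir_deriv 1 \<Psi> (q x))"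
    if "\<And>t. \<Psi> differentiable (at t)" for \<Psi> :: "real \<Rightarrow> complex" and b
    using dir_deriv_eqI[OF der[OF that]] by (auto simp: dir_deriv_def)
  have "differentiable_upto n \<Psi> \<Longrightarrow> differentiable_upto n (\<lambda>x. \<Psi> (q x))" for n
  proof (induction n arbitrary: \<Psi>)
    case 0
    then show ?case using dif[of \<Psi>] by (simp add: differentiable_upto_0)
  next
    case (Suc n)
    have "differentiable_upto n (\<lambda>x. dir_deriv b (\<lambda>x. complex_of_real (q x)) x * dir_deriv 1 \<Psi> (q x))"
      if "b \<in> Basis" for b
      using Suc.prems that smooth_dir_deriv[OF assms(2) that]
      by (intro differentiable_upto_mult Suc.IH[of "dir_deriv 1 \<Psi>"]) (simp_all add: differentiable_upto_Suc smooth_iff_upto)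
    then show ?case using Suc.prems dif[of \<Psi>] d[of \<Psi>] by (simp add: differentiable_upto_Suc)
  qed
  then show ?thesis using assms(1) by (simp add: smooth_iff_upto)
qed

text \<open>Linear maps diagonal in the standard basis comprise reflection, homotheties and the
  anisotropic dilations. Under such a substitution a derivative along b stays a derivative along b,
  with the factor \<open>d b\<close>, so iterated derivatives along basis vectors are simply
  rescaled.\<close>

definition diagonal_map :: "('a::euclidean_space \<Rightarrow> real) \<Rightarrow> ('a \<Rightarrow> 'a) \<Rightarrow> bool" where
  "diagonal_map d D \<longleftrightarrow> linear D \<and> (\<forall>b\<in>Basis. D b = d b *\<^sub>R b)"

lemma diagonal_map_scaleR: "diagonal_map (\<lambda>_. c) (\<lambda>x. c *\<^sub>R x)"
  by (simp add: diagonal_map_def linear_iff algebra_simps)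

lemma iter_deriv_affine_aux:
  assumes D: "diagonal_map d D"
  shows "differentiable_upto n f \<Longrightarrow> differentiable_upto n (\<lambda>x. f (a + D x))"
    and "(\<And>x. f differentiable (at x)) \<Longrightarrow> b \<in> Basis \<Longrightarrow>
      dir_deriv b (\<lambda>x. f (a + D x)) = (\<lambda>x. of_real (d b) * dir_deriv b f (a + D x))"
proof -
  have "bounded_linear D"
    using D linear_conv_bounded_linear by (auto simp: diagonal_map_def)
  then have aff: "((\<lambda>x. a + D x) has_derivative D) (at x)" for x
    by (auto intro!: derivative_eq_intros bounded_linear_imp_has_derivative)
  have der: "((\<lambda>x. f (a + D x)) has_derivative (\<lambda>h. frechet_derivative f (at (a + D x)) (D h))) (at x)"
    if "\<And>x. f differentiable (at x)" for f :: "'a \<Rightarrow> complex" and x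
    using has_derivative_compose[OF aff that[unfolded frechet_derivative_works]] .
  then have dif: "(\<lambda>x. f (a + D x)) differentiable (at x)"
    if "\<And>x. f differentiable (at x)" for f :: "'a \<Rightarrow> complex" and x
    using that unfolding differentiable_def by blast
  have d: "dir_deriv b (\<lambda>x. f (a + D x)) = (\<lambda>x. of_real (d b) * dir_deriv b f (a + D x))"
    if f: "\<And>x. f differentiable (at x)" and b: "b \<in> Basis" for f :: "'a \<Rightarrow> complex" and b
  proof
    fix x
    show "dir_deriv b (\<lambda>x. f (a + D x)) x = of_real (d b) * dir_deriv b f (a + D x)"
      unfolding dir_deriv_eqI[OF der[OF f]] using D b linear_scale[OF linear_frechet_derivative[OF f]]
      by (simp add: dir_deriv_def diagonal_map_def scaleR_conv_of_real)
  qed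
  show "(\<And>x. f differentiable (at x)) \<Longrightarrow> b \<in> Basis \<Longrightarrow>
      dir_deriv b (\<lambda>x. f (a + D x)) = (\<lambda>x. of_real (d b) * dir_deriv b f (a + D x))"
    by (rule d)
  show "differentiable_upto n f \<Longrightarrow> differentiable_upto n (\<lambda>x. f (a + D x))"
  proof (induction n arbitrary: f)
    case 0
    then show ?case using dif[of f] by (simp add: differentiable_upto_0)
  next
    case (Suc n)
    have "differentiable_upto n (\<lambda>x. of_real (d b) * dir_deriv b f (a + D x))" if "b \<in> Basis" for b
      using Suc.prems that smooth_const[of "complex_of_real (d b)", unfolded smooth_iff_upto, rule_format, of n]
      by (intro differentiable_upto_mult Suc.IH[of "dir_deriv b f"]) (simp_all add: differentiable_upto_Suc)
    then show ?case using Suc.prems dif[of f] d[of f] by (simp add: differentiable_upto_Suc)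
  qed
qed

lemma smooth_affine: "diagonal_map d D \<Longrightarrow> smooth f \<Longrightarrow> smooth (\<lambda>x. f (a + D x))"
  by (simp add: smooth_iff_upto iter_deriv_affine_aux)

lemma iter_deriv_affine:
  assumes "diagonal_map d D" "smooth f" "bs \<in> lists Basis"
  shows "iter_deriv bs (\<lambda>x. f (a + D x)) = (\<lambda>x. of_real (\<Prod>b\<leftarrow>bs. d b) * iter_deriv bs f (a + D x))"
  using assms(3)
proof (induction bs)
  case (Cons b bs)
  have *: "smooth (\<lambda>x. iter_deriv bs f (a + D x))"
    using Cons by (intro smooth_affine[OF assms(1)] smooth_iter_deriv assms(2)) auto
  have "iter_deriv (b # bs) (\<lambda>x. f (a + D x)) =
      dir_deriv b (\<lambda>x. of_real (\<Prod>b\<leftarrow>bs. d b) * iter_deriv bs f (a + D x))"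
    using Cons by (simp add: iter_deriv_Cons)
  also have "\<dots> = (\<lambda>x. of_real (\<Prod>b\<leftarrow>bs. d b) * dir_deriv b (\<lambda>x. iter_deriv bs f (a + D x)) x)"
    by (subst dir_deriv_mult) (auto intro: smooth_differentiable *)
  also have "\<dots> = (\<lambda>x. of_real (\<Prod>b\<leftarrow>b # bs. d b) * iter_deriv (b # bs) f (a + D x))"
    using Cons assms(2)
    by (subst iter_deriv_affine_aux(2)[OF assms(1)])
       (auto intro!: smooth_differentiable smooth_iter_deriv simp: iter_deriv_Cons)
  finally show ?case .
qed simp

lemma diagonal_map_scale1: "diagonal_map (\<lambda>_. 1) (\<lambda>x. x)"
  by (simp add: diagonal_map_def linear_iff)

lemma diagonal_map_uminus: "diagonal_map (\<lambda>_. -1) (\<lambda>x. - x)"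
  using diagonal_map_scaleR[of "-1"] by simp

lemma norm_prod_list_minus_one: "norm (complex_of_real (\<Prod>b\<leftarrow>bs. - 1)) = 1"
  by (induction bs) (auto simp: norm_mult)

lemma smooth_reflect: "smooth f \<Longrightarrow> smooth (\<lambda>y. f (x - y))"
  using smooth_affine[OF diagonal_map_uminus, of f x] by simp

lemma norm_iter_deriv_reflect:
  "smooth f \<Longrightarrow> bs \<in> lists Basis \<Longrightarrow> norm (iter_deriv bs (\<lambda>y. f (x - y)) y) = norm (iter_deriv bs f (x - y))"
  using iter_deriv_affine[OF diagonal_map_uminus, of f bs x]
  using norm_prod_list_minus_one[of bs] by (simp add: norm_mult)

text \<open>A crude Leibniz rule: each differentiation of a product doubles the number of terms, and
  in every term each factor carries at most \<open>n\<close> derivatives. This gives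
  \<open>2 ^ length bs\<close> instead of binomial sums.\<close>

lemma iter_deriv_mult_bound:
  assumes "smooth f" "smooth g" "bs \<in> lists Basis" "length bs \<le> n"
    and "\<And>cs. cs \<in> lists Basis \<Longrightarrow> length cs \<le> n \<Longrightarrow> norm (iter_deriv cs f x) \<le> A"
    and "\<And>cs. cs \<in> lists Basis \<Longrightarrow> length cs \<le> n \<Longrightarrow> norm (iter_deriv cs g x) \<le> B"
  shows "norm (iter_deriv bs (\<lambda>x. f x * g x) x) \<le> 2 ^ length bs * (A * B)"
  using assms
proof (induction bs arbitrary: f g n rule: rev_induct)
  case Nil
  have "norm (f x) \<le> A" "norm (g x) \<le> B" using Nil(5)[of "[]"] Nil(6)[of "[]"] by auto
  then show ?case by (auto simp: norm_mult intro!: mult_mono elim: order_trans[rotated])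
next
  case (snoc b bs)
  obtain m where m: "n = Suc m" "length bs \<le> m" using snoc.prems(4) by (cases n) auto
  have b: "b \<in> Basis" "bs \<in> lists Basis" using snoc.prems(3) by auto
  have d: "norm (iter_deriv cs (dir_deriv b f) x) \<le> A" "norm (iter_deriv cs (dir_deriv b g) x) \<le> B"
    if "cs \<in> lists Basis" "length cs \<le> m" for cs
    using snoc.prems(5)[of "cs @ [b]"] snoc.prems(6)[of "cs @ [b]"] that b m(1)
    by (auto simp: iter_deriv_append iter_deriv_Cons)
  have "iter_deriv (bs @ [b]) (\<lambda>x. f x * g x) x =
      iter_deriv bs (\<lambda>x. dir_deriv b f x * g x) x + iter_deriv bs (\<lambda>x. f x * dir_deriv b g x) x"
    using snoc.prems b
    by (simp add: iter_deriv_append iter_deriv_Cons dir_deriv_mult iter_deriv_add smooth_differentiable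
        smooth_mult smooth_dir_deriv)
  also have "norm \<dots> \<le> 2 ^ length bs * (A * B) + 2 ^ length bs * (A * B)"
    using m b snoc.prems d
    by (intro norm_triangle_mono snoc.IH[where n = m]) (auto intro: smooth_dir_deriv)
  finally show ?case by (simp add: mult_ac)
qed

lemma iter_deriv_cong_open:
  assumes "open S" "\<And>x. x \<in> S \<Longrightarrow> f x = g x" "x \<in> S"
  shows "iter_deriv bs f x = iter_deriv bs g x"
  using assms(3)
proof (induction bs arbitrary: x)
  case (Cons b bs)
  have "(iter_deriv bs f has_derivative f') (at x) \<longleftrightarrow> (iter_deriv bs g has_derivative f') (at x)" for f'
    using has_derivative_transform_within_open[OF _ assms(1) Cons.prems] Cons.IH by metis
  then show ?case by (simp add: iter_deriv_Cons dir_deriv_def frechet_derivative_def)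
qed (use assms in simp)

lemma iter_deriv_zero_off_support:
  assumes "x \<notin> closure {x. f x \<noteq> 0}" shows "iter_deriv bs f x = 0"
proof -
  have "f y = 0" if "y \<in> - closure {x. f x \<noteq> 0}" for y
    using that closure_subset[of "{x. f x \<noteq> 0}"] by blast
  moreover have "open (- closure {x. f x \<noteq> 0})" "x \<in> - closure {x. f x \<noteq> 0}"
    using assms by (simp_all add: open_Compl)
  ultimately have "iter_deriv bs f x = iter_deriv bs (\<lambda>_. 0) x"
    using iter_deriv_cong_open[of "- closure {x. f x \<noteq> 0}" f "\<lambda>_. 0"] by blast
  then show ?thesis by simp
qed

section \<open>Test functions and Schwartz functions\<close>

lemma test_functionsI:
  assumes "smooth \<phi>" "compact K" "K \<subseteq> \<Omega>" "\<And>x. x \<notin> K \<Longrightarrow> \<phi> x = 0"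
  shows "\<phi> \<in> test_functions \<Omega>"
proof -
  have "closure {x. \<phi> x \<noteq> 0} \<subseteq> K"
    using assms by (intro closure_minimal compact_imp_closed) auto
  then show ?thesis
    using assms(1-3) compact_Int_closed[OF assms(2) closed_closure, of "{x. \<phi> x \<noteq> 0}"]
    by (auto simp: test_functions_def Int_absorb1 simp del: compact_closure)
qed

lemma test_functionsE:
  assumes "\<phi> \<in> test_functions \<Omega>"
  obtains K where "smooth \<phi>" "compact K" "K \<subseteq> \<Omega>"
    "\<And>x bs. x \<notin> K \<Longrightarrow> iter_deriv bs \<phi> x = 0" "\<And>x. x \<notin> K \<Longrightarrow> \<phi> x = 0"
proof -
  let ?K = "closure {x. \<phi> x \<noteq> 0}"
  have "\<phi> x = 0" if "x \<notin> ?K" for x using iter_deriv_zero_off_support[OF that, of "[]"] by simp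
  moreover have "smooth \<phi>" "compact ?K" "?K \<subseteq> \<Omega>" using assms by (simp_all add: test_functions_def)
  ultimately show ?thesis by (intro that[of ?K] iter_deriv_zero_off_support)
qed

lemma test_functions_mono: "\<Omega> \<subseteq> \<Omega>' \<Longrightarrow> test_functions \<Omega> \<subseteq> test_functions \<Omega>'"
  by (auto simp: test_functions_def)

lemma test_functions_UNIV: "\<phi> \<in> test_functions \<Omega> \<Longrightarrow> \<phi> \<in> test_functions UNIV"
  using test_functions_mono by blast

lemma test_functions_smooth: "\<phi> \<in> test_functions \<Omega> \<Longrightarrow> smooth \<phi>"
  by (simp add: test_functions_def)

lemma test_functions_mult:
  assumes "\<phi> \<in> test_functions \<Omega>" "smooth f" shows "(\<lambda>x. f x * \<phi> x) \<in> test_functions \<Omega>"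
proof -
  obtain K where K: "smooth \<phi>" "compact K" "K \<subseteq> \<Omega>" "\<And>x bs. x \<notin> K \<Longrightarrow> iter_deriv bs \<phi> x = 0" "\<And>x. x \<notin> K \<Longrightarrow> \<phi> x = 0"
    by (rule test_functionsE[OF assms(1)]) (rule that)
  show ?thesis
    by (rule test_functionsI[of _ K]) (use K in \<open>auto intro: smooth_mult assms(2)\<close>)
qed

lemma test_functions_diff:
  assumes "\<phi> \<in> test_functions \<Omega>" "\<theta> \<in> test_functions \<Omega>"
  shows "(\<lambda>x. \<phi> x - \<theta> x) \<in> test_functions \<Omega>"
proof -
  obtain K where K: "smooth \<phi>" "compact K" "K \<subseteq> \<Omega>" "\<And>x bs. x \<notin> K \<Longrightarrow> iter_deriv bs \<phi> x = 0" "\<And>x. x \<notin> K \<Longrightarrow> \<phi> x = 0"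
    by (rule test_functionsE[OF assms(1)]) (rule that)
  obtain L where L: "smooth \<theta>" "compact L" "L \<subseteq> \<Omega>" "\<And>x bs. x \<notin> L \<Longrightarrow> iter_deriv bs \<theta> x = 0" "\<And>x. x \<notin> L \<Longrightarrow> \<theta> x = 0"
    by (rule test_functionsE[OF assms(2)]) (rule that)
  show ?thesis
    by (rule test_functionsI[of _ "K \<union> L"]) (use K L in \<open>auto intro: smooth_diff\<close>)
qed

lemma test_functions_dir_deriv:
  assumes "\<phi> \<in> test_functions \<Omega>" "b \<in> Basis" shows "dir_deriv b \<phi> \<in> test_functions \<Omega>"
proof -
  obtain K where K: "smooth \<phi>" "compact K" "K \<subseteq> \<Omega>" "\<And>x bs. x \<notin> K \<Longrightarrow> iter_deriv bs \<phi> x = 0" "\<And>x. x \<notin> K \<Longrightarrow> \<phi> x = 0"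
    by (rule test_functionsE[OF assms(1)]) (rule that)
  show ?thesis
    by (rule test_functionsI[of _ K]) (use K(1-3) K(4)[of _ "[b]"] assms(2) in \<open>auto simp: iter_deriv_Cons smooth_dir_deriv\<close>)
qed

lemma compact_support_bounded:
  fixes f :: "'a::euclidean_space \<Rightarrow> 'b::real_normed_vector"
  assumes "continuous_on UNIV f" "compact K" "\<And>x. x \<notin> K \<Longrightarrow> f x = 0"
  obtains C where "C \<ge> 0" "\<And>x. norm (f x) \<le> C"
proof -
  have "bounded (f ` K)"
    using assms by (intro compact_imp_bounded compact_continuous_image) (auto intro: continuous_on_subset)
  then obtain C where "\<And>x. x \<in> K \<Longrightarrow> norm (f x) \<le> C" by (auto simp: bounded_iff)
  then have "norm (f x) \<le> max C 0" for x using assms(3)[of x] by (cases "x \<in> K") fastforce+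
  then show ?thesis using that[of "max C 0"] by auto
qed

lemma schwartzD:
  assumes "\<phi> \<in> schwartz" "bs \<in> lists Basis"
  obtains C where "C \<ge> 0" "\<And>x. (1 + norm x) ^ N * norm (iter_deriv bs \<phi> x) \<le> C"
proof -
  obtain C where C: "\<And>x. (1 + norm x) ^ N * norm (iter_deriv bs \<phi> x) \<le> C"
    using assms unfolding schwartz_def by blast
  have "0 \<le> C" by (rule order_trans[OF _ C[of 0]]) simp
  then show ?thesis using C that by blast
qed

lemma schwartz_smooth: "\<phi> \<in> schwartz \<Longrightarrow> smooth \<phi>"
  by (simp add: schwartz_def)

lemma schwartzI:
  assumes "smooth \<phi>"
    "\<And>bs N. bs \<in> lists Basis \<Longrightarrow> \<exists>C. \<forall>x. (1 + norm x) ^ N * norm (iter_deriv bs \<phi> x) \<le> C"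
  shows "\<phi> \<in> schwartz"
  using assms by (auto simp: schwartz_def)

lemma finite_multi_indices: "finite {bs \<in> lists (Basis :: 'a::euclidean_space set). length bs \<le> N}"
  using finite_lists_length_le[OF finite_Basis, of N] by (simp add: lists_eq_set)

text \<open>There are finitely many lists of length at most \<open>n\<close> over the basis, so the
  sum of the separate constants bounds all of them. The order \<open>n\<close> of the derivatives
  and the power \<open>N\<close> of the weight are kept independent.\<close>

lemma schwartz_uniform:
  assumes "\<phi> \<in> schwartz"
  obtains C where "C \<ge> 0"
    "\<And>bs x. bs \<in> lists Basis \<Longrightarrow> length bs \<le> n \<Longrightarrow> (1 + norm x) ^ N * norm (iter_deriv bs \<phi> x) \<le> C"
proof -
  let ?I = "{bs \<in> lists Basis. length bs \<le> n} :: (real^'a) list set"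
  have "\<exists>C. C \<ge> 0 \<and> (\<forall>x. (1 + norm x) ^ N * norm (iter_deriv bs \<phi> x) \<le> C)" if "bs \<in> ?I" for bs
    by (rule schwartzD[OF assms, of bs N]) (use that in auto)
  then have "\<forall>bs\<in>?I. \<exists>C. C \<ge> 0 \<and> (\<forall>x. (1 + norm x) ^ N * norm (iter_deriv bs \<phi> x) \<le> C)" by blast
  from bchoice[OF this] obtain c where
    c: "\<forall>bs\<in>?I. c bs \<ge> 0 \<and> (\<forall>x. (1 + norm x) ^ N * norm (iter_deriv bs \<phi> x) \<le> c bs)" by blast
  show ?thesis
  proof (rule that)
    show "0 \<le> sum c ?I" using c by (intro sum_nonneg) blast
    fix bs :: "(real^'a) list" and x :: "real^'a" assume bs: "bs \<in> lists Basis" "length bs \<le> n"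
    then have I: "bs \<in> ?I" by simp
    have "(1 + norm x) ^ N * norm (iter_deriv bs \<phi> x) \<le> c bs" using c I by blast
    also have "\<dots> \<le> sum c ?I" using I c finite_multi_indices by (intro member_le_sum) blast+
    finally show "(1 + norm x) ^ N * norm (iter_deriv bs \<phi> x) \<le> sum c ?I" .
  qed
qed

lemma test_functions_schwartz:
  assumes "\<phi> \<in> test_functions \<Omega>" shows "\<phi> \<in> schwartz"
proof -
  obtain K where K: "smooth \<phi>" "compact K" "K \<subseteq> \<Omega>" "\<And>x bs. x \<notin> K \<Longrightarrow> iter_deriv bs \<phi> x = 0" "\<And>x. x \<notin> K \<Longrightarrow> \<phi> x = 0"
    by (rule test_functionsE[OF assms]) (rule that)
  show ?thesis
  proof (rule schwartzI[OF K(1)])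
    fix bs :: "(real^'a) list" and N :: nat assume bs: "bs \<in> lists Basis"
    have "continuous_on UNIV (\<lambda>x. of_real ((1 + norm x) ^ N) * iter_deriv bs \<phi> x)"
      by (intro continuous_intros smooth_continuous_on smooth_iter_deriv K bs)
    then obtain C where "\<And>x. norm (of_real ((1 + norm x) ^ N) * iter_deriv bs \<phi> x) \<le> C"
      by (rule compact_support_bounded[OF _ K(2)]) (use K(4) in auto)
    then show "\<exists>C. \<forall>x. (1 + norm x) ^ N * norm (iter_deriv bs \<phi> x) \<le> C"
      by (auto simp: norm_mult norm_power simp del: of_real_power of_real_add)
  qed
qed

lemma schwartz_add:
  assumes "\<phi> \<in> schwartz" "\<theta> \<in> schwartz" shows "(\<lambda>x. \<phi> x + \<theta> x) \<in> schwartz"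
proof (rule schwartzI)
  show "smooth (\<lambda>x. \<phi> x + \<theta> x)" using assms by (intro smooth_add schwartz_smooth)
  fix bs :: "(real^'a) list" and N :: nat assume bs: "bs \<in> lists Basis"
  obtain C where C: "\<And>x. (1 + norm x) ^ N * norm (iter_deriv bs \<phi> x) \<le> C"
    using schwartzD[OF assms(1) bs] by metis
  obtain D where D: "\<And>x. (1 + norm x) ^ N * norm (iter_deriv bs \<theta> x) \<le> D"
    using schwartzD[OF assms(2) bs] by metis
  have "(1 + norm x) ^ N * norm (iter_deriv bs (\<lambda>x. \<phi> x + \<theta> x) x) \<le> C + D" for x
  proof -
    have "(1 + norm x) ^ N * norm (iter_deriv bs (\<lambda>x. \<phi> x + \<theta> x) x) \<le>
        (1 + norm x) ^ N * (norm (iter_deriv bs \<phi> x) + norm (iter_deriv bs \<theta> x))"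
      by (simp add: iter_deriv_add schwartz_smooth assms bs norm_triangle_ineq mult_left_mono)
    then show ?thesis using C[of x] D[of x] by (simp add: algebra_simps)
  qed
  then show "\<exists>C. \<forall>x. (1 + norm x) ^ N * norm (iter_deriv bs (\<lambda>x. \<phi> x + \<theta> x) x) \<le> C" by blast
qed

lemma schwartz_cmult:
  assumes "\<phi> \<in> schwartz" shows "(\<lambda>x. c * \<phi> x) \<in> schwartz"
proof (rule schwartzI)
  show "smooth (\<lambda>x. c * \<phi> x)" using assms by (intro smooth_cmult schwartz_smooth)
  fix bs :: "(real^'a) list" and N :: nat assume bs: "bs \<in> lists Basis"
  obtain C where C: "\<And>x. (1 + norm x) ^ N * norm (iter_deriv bs \<phi> x) \<le> C"
    using schwartzD[OF assms(1) bs] by metis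
  have "(1 + norm x) ^ N * norm (iter_deriv bs (\<lambda>x. c * \<phi> x) x) \<le> norm c * C" for x
    using mult_left_mono[OF C[of x], of "norm c"]
    by (simp add: iter_deriv_cmult schwartz_smooth assms bs norm_mult mult_ac)
  then show "\<exists>C. \<forall>x. (1 + norm x) ^ N * norm (iter_deriv bs (\<lambda>x. c * \<phi> x) x) \<le> C" by blast
qed

lemma schwartz_zero: "(\<lambda>x. 0) \<in> schwartz"
  by (auto simp: schwartz_def smooth_zero)

lemma schwartz_diff: "\<phi> \<in> schwartz \<Longrightarrow> \<theta> \<in> schwartz \<Longrightarrow> (\<lambda>x. \<phi> x - \<theta> x) \<in> schwartz"
  using schwartz_add[OF _ schwartz_cmult[of \<theta> "-1"], of \<phi>] by simp

lemma schwartz_sum: "(\<And>i. i \<in> I \<Longrightarrow> f i \<in> schwartz) \<Longrightarrow> (\<lambda>x. \<Sum>i\<in>I. f i x) \<in> schwartz"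
  by (induction I rule: infinite_finite_induct) (auto intro: schwartz_add schwartz_zero)

text \<open>An inequality of Peetre's type: it trades the weight at y for the weight at x - y at the
  price of the factor 1 + |x|. Hence the functions \<kappa> (x - .) have seminorms that are bounded
  locally uniformly in x.\<close>

lemma one_plus_norm_mult: "1 + norm y \<le> (1 + norm x) * (1 + norm (x - y))" for x y :: "'a::real_normed_vector"
proof -
  have "norm y \<le> norm x + norm (x - y)" using norm_triangle_sub[of y x] by (simp add: norm_minus_commute)
  moreover have "0 \<le> norm x * norm (x - y)" by simp
  ultimately show ?thesis unfolding distrib_left distrib_right by linarith
qed

lemma weighted_reflect_le:
  assumes "smooth \<kappa>" "bs \<in> lists Basis"
  shows "(1 + norm y) ^ N * norm (iter_deriv bs (\<lambda>y. \<kappa> (x - y)) y) \<le>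
    (1 + norm x) ^ N * ((1 + norm (x - y)) ^ N * norm (iter_deriv bs \<kappa> (x - y)))"
  unfolding norm_iter_deriv_reflect[OF assms] mult.assoc[symmetric] power_mult_distrib[symmetric]
  by (intro mult_right_mono power_mono one_plus_norm_mult) auto

lemma schwartz_reflect:
  assumes "\<kappa> \<in> schwartz" shows "(\<lambda>y. \<kappa> (x - y)) \<in> schwartz"
proof (rule schwartzI)
  show "smooth (\<lambda>y. \<kappa> (x - y))" using assms by (intro smooth_reflect schwartz_smooth)
  fix bs :: "(real^'a) list" and N :: nat assume bs: "bs \<in> lists Basis"
  obtain C where C: "\<And>x. (1 + norm x) ^ N * norm (iter_deriv bs \<kappa> x) \<le> C"
    using schwartzD[OF assms(1) bs] by metis
  have "(1 + norm y) ^ N * norm (iter_deriv bs (\<lambda>y. \<kappa> (x - y)) y) \<le> (1 + norm x) ^ N * C" for y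
    by (intro order_trans[OF weighted_reflect_le[OF schwartz_smooth[OF assms] bs]] mult_left_mono C) simp
  then show "\<exists>C. \<forall>y. (1 + norm y) ^ N * norm (iter_deriv bs (\<lambda>y. \<kappa> (x - y)) y) \<le> C" by blast
qed

text \<open>\<Psi> is applied to |x - a|^2 / r^2, a polynomial and hence smooth also at the centre.
  Up to distance r this is at most 1, below 11/10; from distance 2 r on it is at least 4, above
  13/10.\<close>

lemma bump_function:
  fixes a :: "real^'n"
  assumes "LP_generator \<Psi>" "r > 0"
  obtains \<beta> where "\<beta> \<in> test_functions UNIV" "\<And>x. dist a x \<le> r \<Longrightarrow> \<beta> x = 1" "\<And>x. dist a x \<ge> 2 * r \<Longrightarrow> \<beta> x = 0"
proof -
  define q where "q = (\<lambda>x::real^'n. (norm (x - a))\<^sup>2 / r\<^sup>2)"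
  have "complex_of_real (q x) = of_real (1 / r\<^sup>2) * (\<Sum>b\<in>Basis.
      (of_real (x \<bullet> b) - of_real (a \<bullet> b)) * (of_real (x \<bullet> b) - of_real (a \<bullet> b)))" for x
    unfolding q_def power2_norm_eq_inner
    by (subst euclidean_inner) (simp add: inner_diff_left)
  then have "smooth (\<lambda>x. complex_of_real (q x))"
    by (simp only:) (intro smooth_cmult smooth_sum smooth_mult smooth_diff smooth_inner smooth_const)
  then have sm: "smooth (\<lambda>x. \<Psi> (q x))"
    using assms(1) by (intro smooth_compose_real[of \<Psi> q]) (auto simp: LP_generator_def)
  have 1: "\<Psi> (q x) = 1" if "dist a x \<le> r" for x
  proof -
    have "(norm (x - a))\<^sup>2 \<le> r\<^sup>2" using that by (intro power_mono) (auto simp: dist_norm norm_minus_commute)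
    then have "q x \<le> 1" "0 \<le> q x" using assms(2) by (auto simp: q_def)
    then show ?thesis using assms(1) by (simp add: LP_generator_def)
  qed
  have 0: "\<Psi> (q x) = 0" if "dist a x \<ge> 2 * r" for x
  proof -
    have "(2 * r)\<^sup>2 \<le> (norm (x - a))\<^sup>2" using that assms(2) by (intro power_mono) (auto simp: dist_norm norm_minus_commute)
    then have "q x \<ge> 4" using assms(2) by (simp add: q_def le_divide_eq power_mult_distrib)
    then show ?thesis using assms(1) by (simp add: LP_generator_def)
  qed
  have "(\<lambda>x. \<Psi> (q x)) \<in> test_functions UNIV"
    by (rule test_functionsI[OF sm, of "cball a (2 * r)"]) (auto intro: 0)
  then show ?thesis using that 0 1 by blast
qed

section \<open>Lebesgue integrals\<close>

lemma integrable_compact_support: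
  fixes f :: "'a::euclidean_space \<Rightarrow> 'b::{banach, second_countable_topology}"
  assumes "continuous_on UNIV f" "compact K" "\<And>x. x \<notin> K \<Longrightarrow> f x = 0"
  shows "integrable lborel f"
proof -
  have "integrable lborel (\<lambda>x. indicator K x *\<^sub>R f x)"
    using assms by (intro borel_integrable_compact continuous_on_subset[OF assms(1)]) auto
  also have "(\<lambda>x. indicator K x *\<^sub>R f x) = f"
    using assms(3) by (auto simp: indicator_def fun_eq_iff)
  finally show ?thesis .
qed

lemma integrable_test: "\<phi> \<in> test_functions \<Omega> \<Longrightarrow> integrable lborel \<phi>"
  by (erule test_functionsE) (blast intro: integrable_compact_support smooth_continuous_on)

section \<open>Changes of variables by diagonal maps\<close>

lemma diagonal_map_measurable:
  fixes D :: "'a::euclidean_space \<Rightarrow> 'a"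
  assumes "diagonal_map d D" shows "D \<in> borel \<rightarrow>\<^sub>M borel"
  using assms by (intro borel_measurable_continuous_onI linear_continuous_on)
    (auto simp: diagonal_map_def linear_conv_bounded_linear)

lemma lborel_diagonal:
  fixes D :: "'a::euclidean_space \<Rightarrow> 'a"
  assumes "diagonal_map d D" "\<And>b. b \<in> Basis \<Longrightarrow> d b \<noteq> 0"
  shows "lborel = density (distr lborel borel (\<lambda>x. a + D x)) (\<lambda>_. ennreal (\<Prod>b\<in>Basis. \<bar>d b\<bar>))"
proof -
  have "D x = (\<Sum>b\<in>Basis. (d b * (x \<bullet> b)) *\<^sub>R b)" for x
  proof -
    have "D x = D (\<Sum>b\<in>Basis. (x \<bullet> b) *\<^sub>R b)" by (simp add: euclidean_representation)
    also have "\<dots> = (\<Sum>b\<in>Basis. (x \<bullet> b) *\<^sub>R D b)"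
      using assms(1) by (simp add: diagonal_map_def linear_sum linear_scale)
    finally show ?thesis using assms(1) by (simp add: diagonal_map_def mult.commute)
  qed
  then show ?thesis using lborel_affine_euclidean[of d a, OF assms(2)] by simp
qed

lemma integrable_diagonal_iff:
  fixes f :: "'a::euclidean_space \<Rightarrow> 'b::{banach, second_countable_topology}"
  assumes D: "diagonal_map d D" and d: "\<And>b. b \<in> Basis \<Longrightarrow> d b \<noteq> 0" and f: "f \<in> borel_measurable borel"
  shows "integrable lborel (\<lambda>x. f (a + D x)) \<longleftrightarrow> integrable lborel f"
proof -
  note [measurable] = diagonal_map_measurable[OF D] f
  have pos: "0 < (\<Prod>b\<in>Basis. \<bar>d b\<bar>)" using d by (intro prod_pos) auto
  have "integrable lborel f \<longleftrightarrow>
      integrable (density (distr lborel borel (\<lambda>x. a + D x)) (\<lambda>_. ennreal (\<Prod>b\<in>Basis. \<bar>d b\<bar>))) f"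
    using lborel_diagonal[OF D d, of a] by simp
  also have "\<dots> \<longleftrightarrow> integrable lborel (\<lambda>x. f (a + D x))"
  proof -
    let ?p = "\<Prod>b\<in>Basis. \<bar>d b\<bar>"
    have "integrable lborel (\<lambda>x. ?p *\<^sub>R f (a + D x)) \<Longrightarrow> integrable lborel (\<lambda>x. inverse ?p *\<^sub>R ?p *\<^sub>R f (a + D x))"
      by (rule integrable_scaleR_right)
    moreover have "inverse ?p * ?p = 1" using pos by (intro left_inverse) linarith
    ultimately have "integrable lborel (\<lambda>x. ?p *\<^sub>R f (a + D x)) \<longleftrightarrow> integrable lborel (\<lambda>x. f (a + D x))"
      by (auto simp only: scaleR_scaleR scaleR_one)
    then show ?thesis
      using pos by (subst integrable_density) (auto simp: integrable_distr_eq prod_nonneg)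
  qed
  finally show ?thesis by simp
qed

lemma integral_diagonal:
  fixes f :: "'a::euclidean_space \<Rightarrow> 'b::{banach, second_countable_topology}"
  assumes D: "diagonal_map d D" and d: "\<And>b. b \<in> Basis \<Longrightarrow> d b \<noteq> 0" and f: "f \<in> borel_measurable borel"
  shows "(LINT x|lborel. f x) = (\<Prod>b\<in>Basis. \<bar>d b\<bar>) *\<^sub>R (LINT x|lborel. f (a + D x))"
proof -
  note [measurable] = diagonal_map_measurable[OF D] f
  have "(LINT x|lborel. f x) =
      (LINT x|density (distr lborel borel (\<lambda>x. a + D x)) (\<lambda>_. ennreal (\<Prod>b\<in>Basis. \<bar>d b\<bar>)). f x)"
    using lborel_diagonal[OF D d, of a] by simp
  also have "\<dots> = (\<Prod>b\<in>Basis. \<bar>d b\<bar>) *\<^sub>R (LINT x|lborel. f (a + D x))"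
    by (subst integral_density) (auto simp: integral_distr prod_nonneg)
  finally show ?thesis .
qed

lemma nn_integral_diagonal:
  fixes f :: "'a::euclidean_space \<Rightarrow> ennreal"
  assumes D: "diagonal_map d D" and d: "\<And>b. b \<in> Basis \<Longrightarrow> d b \<noteq> 0" and f: "f \<in> borel_measurable borel"
  shows "(\<integral>\<^sup>+x. f x \<partial>lborel) = ennreal (\<Prod>b\<in>Basis. \<bar>d b\<bar>) * (\<integral>\<^sup>+x. f (a + D x) \<partial>lborel)"
proof -
  note [measurable] = diagonal_map_measurable[OF D] f
  have "(\<integral>\<^sup>+x. f x \<partial>lborel) =
      (\<integral>\<^sup>+x. f x \<partial>density (distr lborel borel (\<lambda>x. a + D x)) (\<lambda>_. ennreal (\<Prod>b\<in>Basis. \<bar>d b\<bar>)))"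
    using lborel_diagonal[OF D d, of a] by simp
  also have "\<dots> = ennreal (\<Prod>b\<in>Basis. \<bar>d b\<bar>) * (\<integral>\<^sup>+x. f (a + D x) \<partial>lborel)"
    by (subst nn_integral_density) (auto simp: nn_integral_distr nn_integral_cmult)
  finally show ?thesis .
qed

lemma
  fixes f :: "'a::euclidean_space \<Rightarrow> 'b::{banach, second_countable_topology}"
  assumes "f \<in> borel_measurable borel"
  shows integral_translate: "(LINT x|lborel. f (a + x)) = (LINT x|lborel. f x)"
    and integral_reflect: "(LINT x|lborel. f (a - x)) = (LINT x|lborel. f x)"
    and integrable_translate_iff: "integrable lborel (\<lambda>x. f (a + x)) \<longleftrightarrow> integrable lborel f"
    and integrable_reflect_iff: "integrable lborel (\<lambda>x. f (a - x)) \<longleftrightarrow> integrable lborel f"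
  using integral_diagonal[OF diagonal_map_scale1 _ assms, of a] integral_diagonal[OF diagonal_map_uminus _ assms, of a]
    integrable_diagonal_iff[OF diagonal_map_scale1 _ assms, of a] integrable_diagonal_iff[OF diagonal_map_uminus _ assms, of a]
  by simp_all

lemma nn_integral_translate:
  fixes f :: "'a::euclidean_space \<Rightarrow> ennreal"
  assumes "f \<in> borel_measurable borel"
  shows "(\<integral>\<^sup>+x. f (a + x) \<partial>lborel) = (\<integral>\<^sup>+x. f x \<partial>lborel)"
  using nn_integral_diagonal[OF diagonal_map_scale1 _ assms, of a] by simp

text \<open>Mean value inequality in which the operator norm of the derivative is bounded by the sum
  of the partial derivatives. A convex set \<open>S\<close> is allowed because the weighted
  estimates have the bound only along one segment.\<close>

lemma smooth_lipschitz_on: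
  assumes "smooth f" "convex S" "\<And>b z. b \<in> Basis \<Longrightarrow> z \<in> S \<Longrightarrow> norm (dir_deriv b f z) \<le> B"
    and "x \<in> S" "y \<in> S"
  shows "norm (f x - f y) \<le> real (DIM('a::euclidean_space)) * B * norm (x - y :: 'a)"
proof (rule differentiable_bound[OF assms(2) _ _ assms(4,5)])
  fix z assume z: "z \<in> S"
  show "(f has_derivative frechet_derivative f (at z)) (at z within S)"
    using smooth_has_derivative[OF assms(1)] has_derivative_at_withinI by blast
  have B: "B \<ge> 0" using assms(3)[OF SOME_Basis z] norm_ge_zero order_trans by blast
  show "onorm (frechet_derivative f (at z)) \<le> real DIM('a) * B"
  proof (rule onorm_le)
    fix h
    have lin: "linear (frechet_derivative f (at z))"
      using assms(1) by (intro linear_frechet_derivative smooth_differentiable)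
    have "frechet_derivative f (at z) h = frechet_derivative f (at z) (\<Sum>b\<in>Basis. (h \<bullet> b) *\<^sub>R b)"
      by (simp add: euclidean_representation)
    also have "\<dots> = (\<Sum>b\<in>Basis. (h \<bullet> b) *\<^sub>R dir_deriv b f z)"
      using lin by (simp add: linear_sum linear_scale dir_deriv_def)
    also have "norm \<dots> \<le> (\<Sum>b\<in>(Basis::'a set). norm h * B)"
      using z B by (intro order_trans[OF norm_sum] sum_mono) (auto intro!: mult_mono assms(3) Basis_le_norm)
    finally show "norm (frechet_derivative f (at z) h) \<le> real DIM('a) * B * norm h" by (simp add: mult_ac)
  qed
qed

text \<open>By translation invariance every difference quotient of \<phi> has integral 0; the
  quotients converge to the derivative and are dominated, being bounded by the Lipschitz constant
  and supported in a fixed ball. This is the source of integration by parts.\<close>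

lemma integral_dir_deriv_eq_0:
  assumes "\<phi> \<in> test_functions \<Omega>" "b \<in> Basis"
  shows "(LINT x|lborel. dir_deriv b \<phi> x) = 0"
proof -
  obtain K where K: "smooth \<phi>" "compact K" "K \<subseteq> \<Omega>" "\<And>x bs. x \<notin> K \<Longrightarrow> iter_deriv bs \<phi> x = 0" "\<And>x. x \<notin> K \<Longrightarrow> \<phi> x = 0"
    by (rule test_functionsE[OF assms(1)]) (rule that)
  obtain C where C: "C \<ge> 0" "\<And>bs x. bs \<in> lists Basis \<Longrightarrow> length bs \<le> 1 \<Longrightarrow> (1 + norm x) ^ 0 * norm (iter_deriv bs \<phi> x) \<le> C"
    by (rule schwartz_uniform[OF test_functions_schwartz[OF assms(1)], of 1 0]) (rule that)
  have lip: "norm (\<phi> x - \<phi> y) \<le> real CARD('a) * C * norm (x - y)" for x y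
    using C(2)[of "[_]"] smooth_lipschitz_on[OF K(1) convex_UNIV, of C x y] by (simp add: iter_deriv_Cons)
  obtain R where R: "\<And>x. x \<in> K \<Longrightarrow> norm x \<le> R"
    using compact_imp_bounded[OF K(2)] by (auto simp: bounded_iff)
  \<comment> \<open>Steps of length at most 1 keep the supports of all quotients in the ball of
    radius R + 1.\<close>
  define h where "h n = inverse (real (Suc n))" for n
  have h: "h n > 0" "h n \<le> 1" "h \<longlonglongrightarrow> 0" for n
    unfolding h_def using LIMSEQ_inverse_real_of_nat by (auto simp: field_simps)
  define q where "q n x = (\<phi> (h n *\<^sub>R b + x) - \<phi> x) / h n" for n x
  have [measurable]: "\<phi> \<in> borel_measurable borel" "dir_deriv b \<phi> \<in> borel_measurable borel"
    using K(1) assms(2) by (auto intro: smooth_borel smooth_dir_deriv)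
  have q0: "(LINT x|lborel. q n x) = 0" for n
  proof -
    have "(LINT x|lborel. \<phi> (h n *\<^sub>R b + x) - \<phi> x) = 0"
      using integrable_test[OF assms(1)]
      by (subst Bochner_Integration.integral_diff) (auto simp: integral_translate integrable_translate_iff)
    then show ?thesis by (simp add: q_def)
  qed
  have lim: "(\<lambda>n. q n x) \<longlonglongrightarrow> dir_deriv b \<phi> x" for x
  proof -
    have "((\<lambda>t. \<phi> (x + t *\<^sub>R b)) has_vector_derivative dir_deriv b \<phi> x) (at 0)"
    proof -
      have 1: "((\<lambda>t. x + t *\<^sub>R b) has_derivative (\<lambda>t. t *\<^sub>R b)) (at 0)"
        by (auto intro!: derivative_eq_intros)
      have 2: "(\<phi> has_derivative frechet_derivative \<phi> (at x)) (at (x + 0 *\<^sub>R b))"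
        using smooth_has_derivative[OF K(1), of x] by simp
      show ?thesis
        using has_derivative_compose[OF 1 2] linear_scale[OF linear_frechet_derivative[OF smooth_differentiable[OF K(1)]]]
        by (simp add: has_vector_derivative_def dir_deriv_def)
    qed
    then have "((\<lambda>t. norm (\<phi> (x + t *\<^sub>R b) - \<phi> x - t *\<^sub>R dir_deriv b \<phi> x) / norm t) \<longlongrightarrow> 0) (at 0)"
      by (simp add: has_vector_derivative_def has_derivative_iff_norm)
    moreover have "norm (\<phi> (x + t *\<^sub>R b) - \<phi> x - t *\<^sub>R dir_deriv b \<phi> x) / norm t =
        norm ((\<phi> (x + t *\<^sub>R b) - \<phi> x) /\<^sub>R t - dir_deriv b \<phi> x)" if "t \<noteq> 0" for t
    proof -
      have "(\<phi> (x + t *\<^sub>R b) - \<phi> x) /\<^sub>R t - dir_deriv b \<phi> x =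
          (\<phi> (x + t *\<^sub>R b) - \<phi> x - t *\<^sub>R dir_deriv b \<phi> x) /\<^sub>R t"
        using that by (simp add: scaleR_diff_right)
      then show ?thesis by (simp add: divide_inverse mult.commute)
    qed
    ultimately have "((\<lambda>t. norm ((\<phi> (x + t *\<^sub>R b) - \<phi> x) /\<^sub>R t - dir_deriv b \<phi> x)) \<longlongrightarrow> 0) (at 0)"
      by (elim Lim_transform_eventually) (simp add: eventually_at_filter)
    then have "((\<lambda>t. (\<phi> (x + t *\<^sub>R b) - \<phi> x) /\<^sub>R t) \<longlongrightarrow> dir_deriv b \<phi> x) (at 0)"
      by (subst Lim_null) (rule tendsto_norm_zero_cancel)
    then have "(\<lambda>n. (\<phi> (x + h n *\<^sub>R b) - \<phi> x) /\<^sub>R h n) \<longlonglongrightarrow> dir_deriv b \<phi> x"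
      by (rule filterlim_compose) (use h in \<open>auto simp: filterlim_at intro!: always_eventually less_imp_neq[THEN not_sym]\<close>)
    then show ?thesis by (simp add: q_def scaleR_conv_of_real divide_inverse mult.commute add.commute)
  qed
  have "(\<lambda>n. LINT x|lborel. q n x) \<longlonglongrightarrow> (LINT x|lborel. dir_deriv b \<phi> x)"
  proof (rule integral_dominated_convergence[where w = "\<lambda>x. indicator (cball 0 (R + 1)) x *\<^sub>R (real CARD('a) * C)"])
    show "integrable lborel (\<lambda>x. indicator (cball 0 (R + 1)) x *\<^sub>R (real CARD('a) * C))"
      by (intro borel_integrable_compact) auto
    show "AE x in lborel. norm (q n x) \<le> indicator (cball 0 (R + 1)) x *\<^sub>R (real CARD('a) * C)" for n
    proof (rule AE_I2)
      fix x
      show "norm (q n x) \<le> indicator (cball 0 (R + 1)) x *\<^sub>R (real CARD('a) * C)"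
      proof (cases "norm x \<le> R + 1")
        case True
        have "norm (q n x) \<le> real CARD('a) * C * norm (h n *\<^sub>R b) / h n"
          using lip[of "h n *\<^sub>R b + x" x] h(1)[of n] by (simp add: q_def norm_divide field_simps)
        then show ?thesis using True h(1)[of n] assms(2) by simp
      next
        case False
        have "norm (h n *\<^sub>R b) \<le> 1" using h(1,2)[of n] assms(2) by simp
        then have "norm (h n *\<^sub>R b + x) > R" using False norm_triangle_ineq4[of "h n *\<^sub>R b + x" "h n *\<^sub>R b"] by simp
        then have "h n *\<^sub>R b + x \<notin> K" "x \<notin> K" using R False by force+
        then show ?thesis using K(5) False by (simp add: q_def)
      qed
    qed
  qed (use lim in \<open>auto simp: q_def\<close>)
  then show ?thesis using q0 LIMSEQ_unique[OF _ tendsto_const] by fastforce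
qed

section \<open>Integrability of Schwartz functions\<close>

lemma integrable_inverse_1_plus_square: "integrable lborel (\<lambda>x::real. inverse (1 + x\<^sup>2))"
proof -
  have 1: "integrable lborel (\<lambda>x::real. indicator {0<..} x *\<^sub>R inverse (1 + x\<^sup>2))"
    using integrable_I0i_1_div_plus_square
    by (simp add: interval_lebesgue_integrable_def einterval_def set_integrable_def greaterThan_def zero_ereal_def divide_inverse)
  have 2: "integrable lborel (\<lambda>x. indicator {0<..} (0 - x) *\<^sub>R inverse (1 + (0 - x)\<^sup>2) :: real)"
    using integrable_reflect_iff[of "\<lambda>x::real. indicator {0<..} x *\<^sub>R inverse (1 + x\<^sup>2)" 0] 1 by simp
  \<comment> \<open>The two open half-lines miss the origin, which is added as a compact set of its
    own.\<close>
  have "integrable lborel (\<lambda>x::real. indicator {0} x *\<^sub>R inverse (1 + x\<^sup>2))"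
    by (intro borel_integrable_compact continuous_intros) auto
  from Bochner_Integration.integrable_add[OF Bochner_Integration.integrable_add[OF 1 2] this] show ?thesis
    by (rule Bochner_Integration.integrable_cong_AE_imp) (auto simp: indicator_def)
qed

text \<open>Fubini's theorem for products of functions of one coordinate each, read off from the
  description of \<open>lborel\<close> as an image of a product measure. It serves both the
  polynomial weight and the Gaussian.\<close>

lemma integrable_prod_Basis:
  fixes f :: "'a::euclidean_space \<Rightarrow> real \<Rightarrow> 'b::{real_normed_field, banach, second_countable_topology}"
  assumes "\<And>b. b \<in> Basis \<Longrightarrow> integrable lborel (f b)"
  shows "integrable lborel (\<lambda>x. \<Prod>b\<in>Basis. f b (x \<bullet> b))"
    and "(LINT x|lborel. (\<Prod>b\<in>Basis. f b (x \<bullet> b))) = (\<Prod>b\<in>Basis. (LINT t|lborel. f b t))"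
proof -
  interpret product_sigma_finite "\<lambda>b::'a. lborel :: real measure" ..
  have [measurable]: "f b \<in> borel_measurable borel" if "b \<in> Basis" for b
    using borel_measurable_integrable[OF assms[OF that]] by simp
  have eq: "(\<Prod>b\<in>Basis. f b ((\<Sum>c\<in>Basis. y c *\<^sub>R c) \<bullet> b)) = (\<Prod>b\<in>Basis. f b (y b))" for y
    by (intro prod.cong refl) (simp add: inner_sum_left inner_Basis if_distrib sum.delta cong: if_cong)
  have meas: "(\<lambda>x::'a. \<Prod>b\<in>Basis. f b (x \<bullet> b)) \<in> borel_measurable borel" by measurable
  have meas2: "(\<lambda>y. \<Sum>c\<in>(Basis::'a set). y c *\<^sub>R c) \<in> (\<Pi>\<^sub>M b\<in>Basis. lborel) \<rightarrow>\<^sub>M borel" by measurable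
  show "integrable lborel (\<lambda>x. \<Prod>b\<in>Basis. f b (x \<bullet> b))"
    unfolding lborel_eq[where 'a = 'a] integrable_distr_eq[OF meas2 meas] eq
    by (intro product_integrable_prod assms) auto
  show "(LINT x|lborel. (\<Prod>b\<in>Basis. f b (x \<bullet> b))) = (\<Prod>b\<in>Basis. (LINT t|lborel. f b t))"
    unfolding lborel_eq[where 'a = 'a] integral_distr[OF meas2 meas] eq
    by (intro product_integral_prod assms) auto
qed

text \<open>The exponent is twice the dimension: each of the factors 1 + (x . b)^2 is at most (1 +
  |x|)^2, so the inverse weight lies below a product of integrable functions of one variable
  each.\<close>

lemma integrable_inverse_weight:
  "integrable lborel (\<lambda>x::'a::euclidean_space. inverse ((1 + norm x) ^ (2 * DIM('a))))"
proof (rule Bochner_Integration.integrable_bound)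
  show "integrable lborel (\<lambda>x::'a. \<Prod>b\<in>Basis. inverse (1 + (x \<bullet> b)\<^sup>2))"
    using integrable_prod_Basis(1)[of "\<lambda>_ t. inverse (1 + t\<^sup>2)"] integrable_inverse_1_plus_square by simp
  have "inverse ((1 + norm x) ^ (2 * DIM('a))) \<le> (\<Prod>b\<in>Basis. inverse (1 + (x \<bullet> b)\<^sup>2))" for x :: 'a
  proof -
    have "(\<Prod>b\<in>Basis. 1 + (x \<bullet> b)\<^sup>2) \<le> (\<Prod>b\<in>(Basis::'a set). (1 + norm x)\<^sup>2)"
    proof (intro prod_mono conjI)
      fix b :: 'a assume "b \<in> Basis"
      then have "(x \<bullet> b)\<^sup>2 \<le> (norm x)\<^sup>2" by (simp add: Basis_le_norm power2_le_iff_abs_le)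
      then show "1 + (x \<bullet> b)\<^sup>2 \<le> (1 + norm x)\<^sup>2" using norm_ge_zero[of x] using norm_ge_zero[of x]
        by (simp only: power2_sum one_power2 mult_1_right)
    qed simp
    then have "(\<Prod>b\<in>Basis. 1 + (x \<bullet> b)\<^sup>2) \<le> (1 + norm x) ^ (2 * DIM('a))"
      by (simp add: power_mult power2_eq_square)
    then have "inverse ((1 + norm x) ^ (2 * DIM('a))) \<le> inverse (\<Prod>b\<in>Basis. 1 + (x \<bullet> b)\<^sup>2)"
      by (intro le_imp_inverse_le prod_pos) (auto simp: add_pos_nonneg)
    then show ?thesis by (simp add: prod_inversef comp_def flip: prod_inversef)
  qed
  then show "AE x in lborel. norm (inverse ((1 + norm x) ^ (2 * DIM('a)))) \<le>
      norm (\<Prod>b\<in>Basis. inverse (1 + ((x::'a) \<bullet> b)\<^sup>2))"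
    by (intro AE_I2) (simp add: prod_nonneg)
qed measurable

lemma schwartz_integrable:
  assumes "\<phi> \<in> schwartz" shows "integrable lborel \<phi>"
proof -
  obtain C where C: "C \<ge> 0" "\<And>x. (1 + norm x) ^ (2 * CARD('a)) * norm (iter_deriv [] \<phi> x) \<le> C"
    by (rule schwartzD[OF assms lists.Nil, of "2 * CARD('a)"]) (rule that)
  have "integrable lborel (\<lambda>x::real^'a. C * inverse ((1 + norm x) ^ (2 * CARD('a))))"
    using integrable_inverse_weight[where 'a = "real^'a"] by (intro integrable_mult_right) simp
  then show ?thesis
  proof (rule Bochner_Integration.integrable_bound)
    show "\<phi> \<in> borel_measurable lborel" using smooth_borel[OF schwartz_smooth[OF assms]] by simp
    have "norm (\<phi> x) \<le> C * inverse ((1 + norm x) ^ (2 * CARD('a)))" for x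
      using C(2)[of x] zero_less_power[of "1 + norm x" "2 * CARD('a)"]
      by (simp add: field_simps add_pos_nonneg)
    then show "AE x in lborel. norm (\<phi> x) \<le> norm (C * inverse ((1 + norm x) ^ (2 * CARD('a))))"
      using C(1) by (intro AE_I2) simp
  qed
qed

section \<open>Fourier transforms of test functions\<close>

text \<open>The Fourier integral with sign + and without normalisation. \<open>fourier\<close> is
  its reflection and \<open>inv_fourier\<close> a multiple of it, so smoothness and decay are proved
  once.\<close>

definition osc :: "(real^'n \<Rightarrow> complex) \<Rightarrow> real^'n \<Rightarrow> complex" where
  "osc \<phi> x = (LINT \<xi>|lborel. exp (\<i> * of_real (x \<bullet> \<xi>)) * \<phi> \<xi>)"

lemma fourier_osc: "fourier \<phi> \<xi> = osc \<phi> (0 - \<xi>)"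
  by (simp add: fourier_def osc_def inner_commute)

lemma inv_fourier_osc: "inv_fourier \<phi> x = complex_of_real (1 / (2 * pi) ^ CARD('n)) * osc \<phi> (x :: real^'n)"
  by (simp only: inv_fourier_def osc_def)

lemma expi_has_derivative:
  "((\<lambda>\<xi>. exp (\<i> * of_real (x \<bullet> \<xi>))) has_derivative
    (\<lambda>h. exp (\<i> * of_real (x \<bullet> \<xi>)) * (\<i> * of_real (x \<bullet> h)))) (at \<xi>)"
proof -
  have "bounded_linear (\<lambda>h. \<i> * complex_of_real (x \<bullet> h))"
    by (intro bounded_linear_const_mult bounded_linear_compose[OF bounded_linear_of_real bounded_linear_inner_right])
  then have "((\<lambda>\<xi>. \<i> * complex_of_real (x \<bullet> \<xi>)) has_derivative (\<lambda>h. \<i> * of_real (x \<bullet> h))) (at \<xi>)"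
    by (rule bounded_linear_imp_has_derivative)
  from has_derivative_compose[OF this DERIV_exp[unfolded has_field_derivative_def]] show ?thesis .
qed

lemma smooth_expi: "smooth (\<lambda>\<xi>. exp (\<i> * of_real (x \<bullet> \<xi>)))"
proof -
  have der: "((\<lambda>\<xi>. c * exp (\<i> * of_real (x \<bullet> \<xi>))) has_derivative
      (\<lambda>h. c * (exp (\<i> * of_real (x \<bullet> \<xi>)) * (\<i> * of_real (x \<bullet> h))))) (at \<xi>)" for c \<xi>
    by (intro has_derivative_mult_right expi_has_derivative)
  have d: "dir_deriv b (\<lambda>\<xi>. c * exp (\<i> * of_real (x \<bullet> \<xi>))) =
      (\<lambda>\<xi>. (c * \<i> * of_real (x \<bullet> b)) * exp (\<i> * of_real (x \<bullet> \<xi>)))" for b c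
    using dir_deriv_eqI[OF der] by (auto simp: mult_ac)
  have dif: "(\<lambda>\<xi>. c * exp (\<i> * of_real (x \<bullet> \<xi>))) differentiable (at \<xi>)" for c \<xi>
    using der unfolding differentiable_def by blast
  have "differentiable_upto n (\<lambda>\<xi>. c * exp (\<i> * of_real (x \<bullet> \<xi>)))" for n c
  proof (induction n arbitrary: c)
    case 0
    show ?case unfolding differentiable_upto_0 using dif[of c] by blast
  next
    case (Suc n)
    show ?case unfolding differentiable_upto_Suc d using dif[of c] Suc by blast
  qed
  from this[of _ 1] show ?thesis by (simp add: smooth_iff_upto)
qed

lemma test_expi: "\<phi> \<in> test_functions \<Omega> \<Longrightarrow> (\<lambda>\<xi>. exp (\<i> * of_real (x \<bullet> \<xi>)) * \<phi> \<xi>) \<in> test_functions \<Omega>"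
  by (rule test_functions_mult[OF _ smooth_expi])

lemma test_coordinate: "\<phi> \<in> test_functions \<Omega> \<Longrightarrow> (\<lambda>\<xi>. (\<i> * of_real (\<xi> \<bullet> b)) * \<phi> \<xi>) \<in> test_functions \<Omega>"
  by (rule test_functions_mult[OF _ smooth_cmult[OF smooth_inner]])

lemma norm_osc_le: "\<phi> \<in> test_functions \<Omega> \<Longrightarrow> norm (osc \<phi> x) \<le> (LINT \<xi>|lborel. norm (\<phi> \<xi>))"
  unfolding osc_def by (rule order_trans[OF integral_norm_bound]) (simp add: norm_mult)

text \<open>Differentiation under the integral sign by Taylor's formula: |exp(it) - 1 - it| \<le>
  t^2 with t = \<xi> . (y - x), so the remainder quotient is at most |y - x| times the second moment
  of |\<phi>|, which is finite by compact support.\<close>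

lemma osc_has_derivative:
  assumes "\<phi> \<in> test_functions \<Omega>"
  shows "(osc \<phi> has_derivative (\<lambda>h. osc (\<lambda>\<xi>. (\<i> * of_real (\<xi> \<bullet> h)) * \<phi> \<xi>) x)) (at x)"
proof (rule has_derivativeI_sandwich[of 1])
  let ?D = "\<lambda>h. osc (\<lambda>\<xi>. (\<i> * of_real (\<xi> \<bullet> h)) * \<phi> \<xi>) x"
  note int = integrable_test[OF test_expi[OF test_coordinate[OF assms]]]
  note int0 = integrable_test[OF test_expi[OF assms]]
  have "linear ?D"
  proof (rule linearI)
    show "?D (a + b) = ?D a + ?D b" for a b
      unfolding osc_def Bochner_Integration.integral_add[OF int int, symmetric]
      by (simp add: inner_add_right algebra_simps)
    show "?D (c *\<^sub>R a) = c *\<^sub>R ?D a" for c a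
      unfolding osc_def integral_scaleR_right[symmetric] inner_scaleR_right by (simp add: scaleR_conv_of_real mult_ac)
  qed
  then show "bounded_linear ?D" by (rule linear_conv_bounded_linear[THEN iffD1])
  have sm: "smooth \<phi>" using assms by (rule test_functions_smooth)
  obtain K where K: "smooth \<phi>" "compact K" "K \<subseteq> \<Omega>" "\<And>x bs. x \<notin> K \<Longrightarrow> iter_deriv bs \<phi> x = 0" "\<And>x. x \<notin> K \<Longrightarrow> \<phi> x = 0"
    by (rule test_functionsE[OF assms]) (rule that)
  define c where "c = (LINT \<xi>|lborel. (norm \<xi>)\<^sup>2 * norm (\<phi> \<xi>))"
  have intc: "integrable lborel (\<lambda>\<xi>. (norm \<xi>)\<^sup>2 * norm (\<phi> \<xi>))"
    using K by (intro integrable_compact_support[of _ K] continuous_intros smooth_continuous_on) auto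
  show "norm (osc \<phi> y - osc \<phi> x - ?D (y - x)) / norm (y - x) \<le> c * norm (y - x)" if "y \<noteq> x" for y
  proof -
    have "osc \<phi> y - osc \<phi> x - ?D (y - x) = (LINT \<xi>|lborel. exp (\<i> * of_real (y \<bullet> \<xi>)) * \<phi> \<xi> -
        exp (\<i> * of_real (x \<bullet> \<xi>)) * \<phi> \<xi> - exp (\<i> * of_real (x \<bullet> \<xi>)) * (\<i> * of_real (\<xi> \<bullet> (y - x)) * \<phi> \<xi>))"
      unfolding osc_def
      by (subst Bochner_Integration.integral_diff[OF Bochner_Integration.integrable_diff[OF int0 int0] int],
          subst Bochner_Integration.integral_diff[OF int0 int0]) simp
    also have "norm \<dots> \<le> (LINT \<xi>|lborel. (norm (y - x))\<^sup>2 * ((norm \<xi>)\<^sup>2 * norm (\<phi> \<xi>)))"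
    proof (rule Bochner_Integration.integral_norm_bound_integral)
      show "integrable lborel (\<lambda>\<xi>. exp (\<i> * of_real (y \<bullet> \<xi>)) * \<phi> \<xi> -
        exp (\<i> * of_real (x \<bullet> \<xi>)) * \<phi> \<xi> - exp (\<i> * of_real (x \<bullet> \<xi>)) * (\<i> * of_real (\<xi> \<bullet> (y - x)) * \<phi> \<xi>))"
        by (intro Bochner_Integration.integrable_diff int0 int)
      show "integrable lborel (\<lambda>\<xi>. (norm (y - x))\<^sup>2 * ((norm \<xi>)\<^sup>2 * norm (\<phi> \<xi>)))"
        by (intro integrable_mult_right intc)
      fix \<xi>
      define t where "t = \<xi> \<bullet> (y - x)"
      have y: "y \<bullet> \<xi> = x \<bullet> \<xi> + t" by (simp add: t_def inner_diff_right inner_commute)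
      have "exp (\<i> * of_real (y \<bullet> \<xi>)) * \<phi> \<xi> - exp (\<i> * of_real (x \<bullet> \<xi>)) * \<phi> \<xi> -
          exp (\<i> * of_real (x \<bullet> \<xi>)) * (\<i> * of_real (\<xi> \<bullet> (y - x)) * \<phi> \<xi>) =
          exp (\<i> * of_real (x \<bullet> \<xi>)) * ((exp (\<i> * of_real t) - (1 + \<i> * of_real t)) * \<phi> \<xi>)"
        unfolding y t_def[symmetric] by (simp add: exp_add algebra_simps)
      also have "norm \<dots> = norm (exp (\<i> * of_real t) - (1 + \<i> * of_real t)) * norm (\<phi> \<xi>)"
        by (simp add: norm_mult)
      also have "norm (exp (\<i> * of_real t) - (1 + \<i> * of_real t)) \<le> \<bar>t\<bar>\<^sup>2"
        using iexp_approx1[of t 1] norm_ge_zero[of "exp (\<i> * of_real t) - (1 + \<i> * of_real t)"]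
          by (simp add: power2_eq_square del: norm_ge_zero)
      also have "\<bar>t\<bar>\<^sup>2 \<le> (norm \<xi> * norm (y - x))\<^sup>2"
        unfolding t_def by (intro power_mono Cauchy_Schwarz_ineq2) simp
      finally show "norm (exp (\<i> * of_real (y \<bullet> \<xi>)) * \<phi> \<xi> - exp (\<i> * of_real (x \<bullet> \<xi>)) * \<phi> \<xi> -
          exp (\<i> * of_real (x \<bullet> \<xi>)) * (\<i> * of_real (\<xi> \<bullet> (y - x)) * \<phi> \<xi>)) \<le>
          (norm (y - x))\<^sup>2 * ((norm \<xi>)\<^sup>2 * norm (\<phi> \<xi>))"
        by (simp add: mult_right_mono power_mult_distrib mult_ac)
    qed
    also have "\<dots> = c * (norm (y - x))\<^sup>2" by (simp add: c_def mult.commute)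
    finally show ?thesis using that by (simp add: field_simps power2_eq_square)
  qed
  have "((\<lambda>y. c * norm (y - x)) \<longlongrightarrow> c * norm (x - x)) (at x)"
    by (intro tendsto_intros)
  then show "((\<lambda>y. c * norm (y - x)) \<longlongrightarrow> 0) (at x)" by simp
qed simp

section \<open>Smoothness and decay of Fourier integrals of test functions\<close>

lemma dir_deriv_osc:
  "\<phi> \<in> test_functions \<Omega> \<Longrightarrow> dir_deriv b (osc \<phi>) = osc (\<lambda>\<xi>. (\<i> * of_real (\<xi> \<bullet> b)) * \<phi> \<xi>)"
  using dir_deriv_eqI[OF osc_has_derivative] by blast

lemma smooth_osc:
  assumes "\<phi> \<in> test_functions \<Omega>" shows "smooth (osc \<phi>)"
proof -
  have "differentiable_upto n (osc \<phi>)" if "\<phi> \<in> test_functions \<Omega>" for n \<phi>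
    using that
  proof (induction n arbitrary: \<phi>)
    case 0
    then show ?case using osc_has_derivative unfolding differentiable_upto_0 differentiable_def by blast
  next
    case (Suc n)
    have "(osc \<phi>) differentiable (at x)" for x
      using osc_has_derivative[OF Suc.prems] unfolding differentiable_def by blast
    then show ?case
      using Suc.IH[OF test_coordinate[OF Suc.prems]]
      by (simp add: differentiable_upto_Suc dir_deriv_osc[OF Suc.prems])
  qed
  then show ?thesis using assms by (simp add: smooth_iff_upto)
qed

text \<open>The Fourier symbol of \<open>iter_deriv bs\<close>.\<close>

definition coord_prod :: "(real^'n) list \<Rightarrow> real^'n \<Rightarrow> complex" where
  "coord_prod bs \<xi> = (\<Prod>b\<leftarrow>bs. \<i> * of_real (\<xi> \<bullet> b))"

lemma test_coord_prod:
  assumes "\<phi> \<in> test_functions \<Omega>" shows "(\<lambda>\<xi>. coord_prod bs \<xi> * \<phi> \<xi>) \<in> test_functions \<Omega>"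
proof (induction bs)
  case (Cons b bs)
  from test_coordinate[OF this, of b] show ?case by (simp add: coord_prod_def mult.assoc)
qed (simp add: coord_prod_def assms)

lemma iter_deriv_osc:
  assumes "\<phi> \<in> test_functions \<Omega>" shows "iter_deriv bs (osc \<phi>) = osc (\<lambda>\<xi>. coord_prod bs \<xi> * \<phi> \<xi>)"
proof (induction bs)
  case (Cons b bs)
  show ?case
    unfolding iter_deriv_Cons Cons dir_deriv_osc[OF test_coord_prod[OF assms]] by (simp add: coord_prod_def mult.assoc)
qed (simp add: coord_prod_def)

text \<open>The derivative along b of exp(i x . \<xi>) \<phi>(\<xi>) has integral 0. Only moduli are
  recorded, because the identity is used for decay.\<close>

lemma osc_integrate_by_parts:
  assumes "\<phi> \<in> test_functions \<Omega>" "b \<in> Basis"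
  shows "norm (osc (dir_deriv b \<phi>) x) = \<bar>x \<bullet> b\<bar> * norm (osc \<phi> x)"
proof -
  let ?e = "\<lambda>\<xi>. exp (\<i> * complex_of_real (x \<bullet> \<xi>))"
  have de: "dir_deriv b ?e = (\<lambda>\<xi>. (\<i> * of_real (x \<bullet> b)) * ?e \<xi>)"
  proof
    fix \<xi>
    show "dir_deriv b ?e \<xi> = (\<i> * of_real (x \<bullet> b)) * ?e \<xi>"
      using dir_deriv_eqI[OF expi_has_derivative, of b x \<xi>] by (simp only: mult_ac)
  qed
  have "0 = (LINT \<xi>|lborel. dir_deriv b (\<lambda>\<xi>. ?e \<xi> * \<phi> \<xi>) \<xi>)"
    using integral_dir_deriv_eq_0[OF test_expi[OF assms(1)] assms(2)] by simp
  also have "\<dots> = (LINT \<xi>|lborel. (\<i> * of_real (x \<bullet> b)) * (?e \<xi> * \<phi> \<xi>) + ?e \<xi> * dir_deriv b \<phi> \<xi>)"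
    using assms(1)
    by (subst dir_deriv_mult) (auto simp: de mult.assoc intro: smooth_differentiable smooth_expi test_functions_smooth)
  also have "\<dots> = (\<i> * of_real (x \<bullet> b)) * osc \<phi> x + osc (dir_deriv b \<phi>) x"
    unfolding osc_def
    by (subst Bochner_Integration.integral_add)
       (auto intro!: integrable_mult_right integrable_test[OF test_expi[OF assms(1)]]
         integrable_test[OF test_expi[OF test_functions_dir_deriv[OF assms]]])
  finally have "osc (dir_deriv b \<phi>) x = - ((\<i> * of_real (x \<bullet> b)) * osc \<phi> x)"
    by (simp add: eq_neg_iff_add_eq_0 add.commute)
  then show ?thesis by (simp add: norm_mult)
qed

text \<open>Each of the N integrations by parts trades a factor |x . b| for a derivative of \<phi>,
  which is again a test function; the start is the bound by the L_1 norm.\<close>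

lemma osc_coordinate_decay:
  assumes "\<phi> \<in> test_functions \<Omega>" "b \<in> Basis"
  shows "\<exists>C\<ge>0. \<forall>x. \<bar>x \<bullet> b\<bar> ^ N * norm (osc \<phi> x) \<le> C"
  using assms(1)
proof (induction N arbitrary: \<phi>)
  case 0
  then show ?case using norm_osc_le[OF 0] by (intro exI[of _ "LINT \<xi>|lborel. norm (\<phi> \<xi>)"]) auto
next
  case (Suc N)
  obtain C where "C \<ge> 0" "\<forall>x. \<bar>x \<bullet> b\<bar> ^ N * norm (osc (dir_deriv b \<phi>) x) \<le> C"
    using Suc.IH[OF test_functions_dir_deriv[OF Suc.prems assms(2)]] by blast
  then show ?case
    by (intro exI[of _ C]) (simp add: osc_integrate_by_parts[OF Suc.prems assms(2)] mult_ac)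
qed

text \<open>With m the largest |x . b|, the norm of x is at most the dimension times m, and m^N is
  one of the summands. Decay in the norm is thus reduced to decay in one coordinate at a
  time.\<close>

lemma weight_le_coordinates:
  "(1 + norm x) ^ N \<le> (1 + real DIM('a)) ^ N * (1 + (\<Sum>b\<in>Basis. \<bar>x \<bullet> b\<bar> ^ N))"
  for x :: "'a::euclidean_space"
proof -
  define m where "m = Max ((\<lambda>b. \<bar>x \<bullet> b\<bar>) ` (Basis :: 'a set))"
  have "m \<in> (\<lambda>b. \<bar>x \<bullet> b\<bar>) ` (Basis :: 'a set)" unfolding m_def by (intro Max_in) auto
  then obtain c where c: "c \<in> Basis" "m = \<bar>x \<bullet> c\<bar>" by blast
  have m: "\<bar>x \<bullet> b\<bar> \<le> m" if "b \<in> Basis" for b unfolding m_def using that by (intro Max_ge) auto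
  have "norm x \<le> (\<Sum>b\<in>(Basis::'a set). m)"
    by (rule order_trans[OF norm_le_l1]) (intro sum_mono m)
  also have "\<dots> \<le> real DIM('a) * max 1 m" by (simp add: mult_left_mono)
  finally have "1 + norm x \<le> (1 + real DIM('a)) * max 1 m" by (simp add: distrib_right)
  then have "(1 + norm x) ^ N \<le> ((1 + real DIM('a)) * max 1 m) ^ N" by (intro power_mono) auto
  also have "\<dots> = (1 + real DIM('a)) ^ N * (max 1 m) ^ N" by (rule power_mult_distrib)
  also have "(max 1 m) ^ N \<le> 1 + m ^ N" using c by (cases "m \<le> 1") (auto simp: max_def)
  also have "m ^ N \<le> (\<Sum>b\<in>Basis. \<bar>x \<bullet> b\<bar> ^ N)"
    unfolding c(2) using c(1) by (intro member_le_sum) auto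
  finally show ?thesis by (simp add: mult_left_mono)
qed

lemma osc_decay:
  fixes \<phi> :: "real^'n \<Rightarrow> complex"
  assumes "\<phi> \<in> test_functions \<Omega>"
  shows "\<exists>C. \<forall>x. (1 + norm x) ^ N * norm (osc \<phi> x) \<le> C"
proof -
  have "\<forall>b\<in>Basis. \<exists>C\<ge>0. \<forall>x. \<bar>x \<bullet> b\<bar> ^ N * norm (osc \<phi> x) \<le> C"
    using osc_coordinate_decay[OF assms] by blast
  from bchoice[OF this] obtain c where c: "\<forall>b\<in>Basis. c b \<ge> 0 \<and> (\<forall>x. \<bar>x \<bullet> b\<bar> ^ N * norm (osc \<phi> x) \<le> c b)"
    by blast
  define C0 where "C0 = (LINT \<xi>|lborel. norm (\<phi> \<xi>))"
  have "(1 + norm x) ^ N * norm (osc \<phi> x) \<le> (1 + real DIM(real^'n)) ^ N * (C0 + (\<Sum>b\<in>Basis. c b))" for x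
  proof -
    have "(1 + norm x) ^ N * norm (osc \<phi> x) \<le>
        ((1 + real DIM(real^'n)) ^ N * (1 + (\<Sum>b\<in>Basis. \<bar>x \<bullet> b\<bar> ^ N))) * norm (osc \<phi> x)"
      by (intro mult_right_mono weight_le_coordinates) simp
    also have "\<dots> = (1 + real DIM(real^'n)) ^ N * (norm (osc \<phi> x) + (\<Sum>b\<in>Basis. \<bar>x \<bullet> b\<bar> ^ N * norm (osc \<phi> x)))"
      unfolding sum_distrib_right[symmetric] by (simp add: algebra_simps)
    also have "\<dots> \<le> (1 + real DIM(real^'n)) ^ N * (C0 + (\<Sum>b\<in>Basis. c b))"
      using norm_osc_le[OF assms, of x] c unfolding C0_def
      by (intro mult_left_mono add_mono sum_mono) auto
    finally show ?thesis .
  qed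
  then show ?thesis by blast
qed

text \<open>Every derivative of \<open>osc \<phi>\<close> is \<open>osc\<close> of another test
  function, so one decay estimate serves all derivatives. Test functions suffice as input, because a
  multiplier with compactly supported symbol is only ever tested against compactly supported
  functions.\<close>

lemma osc_schwartz:
  assumes "\<phi> \<in> test_functions \<Omega>" shows "osc \<phi> \<in> schwartz"
  by (rule schwartzI[OF smooth_osc[OF assms]])
     (simp add: iter_deriv_osc[OF assms] osc_decay[OF test_coord_prod[OF assms]])

lemma fourier_schwartz: "\<phi> \<in> test_functions \<Omega> \<Longrightarrow> fourier \<phi> \<in> schwartz"
  unfolding fourier_osc[abs_def] by (intro schwartz_reflect osc_schwartz)

lemma inv_fourier_schwartz: "\<phi> \<in> test_functions \<Omega> \<Longrightarrow> inv_fourier \<phi> \<in> schwartz"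
  unfolding inv_fourier_osc[abs_def] by (intro schwartz_cmult osc_schwartz)

text \<open>The double integrand is continuous and supported in the compact set K \<times> L, so
  Fubini's theorem applies. This is the convolution theorem in dual form, with
  \<open>inv_fourier \<sigma>\<close> as kernel.\<close>

lemma osc_mult_inv_fourier:
  fixes \<phi> \<sigma> :: "real^'n \<Rightarrow> complex"
  assumes "\<phi> \<in> test_functions UNIV" "\<sigma> \<in> test_functions UNIV"
  shows "osc (\<lambda>\<xi>. \<sigma> \<xi> * inv_fourier \<phi> \<xi>) (0 - y) = (LINT x|lborel. \<phi> x * inv_fourier \<sigma> (x - y))"
proof -
  define c where "c = complex_of_real (1 / (2 * pi) ^ CARD('n))"
  define f where "f x \<xi> = \<phi> x * (c * (exp (\<i> * of_real ((x - y) \<bullet> \<xi>)) * \<sigma> \<xi>))" for x \<xi>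
  obtain K where K: "smooth \<phi>" "compact K" "K \<subseteq> UNIV" "\<And>x bs. x \<notin> K \<Longrightarrow> iter_deriv bs \<phi> x = 0" "\<And>x. x \<notin> K \<Longrightarrow> \<phi> x = 0"
    by (rule test_functionsE[OF assms(1)]) (rule that)
  obtain L where L: "smooth \<sigma>" "compact L" "L \<subseteq> UNIV" "\<And>x bs. x \<notin> L \<Longrightarrow> iter_deriv bs \<sigma> x = 0" "\<And>x. x \<notin> L \<Longrightarrow> \<sigma> x = 0"
    by (rule test_functionsE[OF assms(2)]) (rule that)
  have "integrable lborel (\<lambda>p. f (fst p) (snd p))"
    unfolding f_def
    by (rule integrable_compact_support[of _ "K \<times> L"])
       (use K(2) L(2) K(5)[of "fst _"] L(5)[of "snd _"] in \<open>auto simp: mem_Times_iff intro!: continuous_intros compact_Times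
         continuous_on_compose2[OF smooth_continuous_on[OF K(1), of UNIV]] continuous_on_compose2[OF smooth_continuous_on[OF L(1), of UNIV]]\<close>)
  then have int: "integrable (lborel \<Otimes>\<^sub>M lborel) (case_prod f)"
    by (simp add: lborel_prod case_prod_beta')
  have "osc (\<lambda>\<xi>. \<sigma> \<xi> * inv_fourier \<phi> \<xi>) (0 - y) = (LINT \<xi>|lborel. (LINT x|lborel. f x \<xi>))"
  proof -
    have "exp (\<i> * of_real ((0 - y) \<bullet> \<xi>)) * (\<sigma> \<xi> * inv_fourier \<phi> \<xi>) = (LINT x|lborel. f x \<xi>)" for \<xi>
    proof -
      have "(LINT x|lborel. f x \<xi>) = (LINT x|lborel.
          (exp (\<i> * of_real ((0 - y) \<bullet> \<xi>)) * \<sigma> \<xi> * c) * (exp (\<i> * of_real (\<xi> \<bullet> x)) * \<phi> x))"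
      proof (intro Bochner_Integration.integral_cong refl)
        fix x
        have "exp (\<i> * complex_of_real ((x - y) \<bullet> \<xi>)) =
            exp (\<i> * of_real ((0 - y) \<bullet> \<xi>)) * exp (\<i> * of_real (\<xi> \<bullet> x))"
          by (simp add: inner_diff_left inner_commute exp_add[symmetric] algebra_simps)
        then show "f x \<xi> = (exp (\<i> * of_real ((0 - y) \<bullet> \<xi>)) * \<sigma> \<xi> * c) * (exp (\<i> * of_real (\<xi> \<bullet> x)) * \<phi> x)"
          by (simp only: f_def mult_ac)
      qed
      also have "\<dots> = (exp (\<i> * of_real ((0 - y) \<bullet> \<xi>)) * \<sigma> \<xi> * c) * osc \<phi> \<xi>"
        unfolding osc_def by (rule integral_mult_right_zero)
      finally show ?thesis by (simp only: inv_fourier_osc c_def mult.assoc)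
    qed
    then show ?thesis unfolding osc_def by presburger
  qed
  also have "\<dots> = (LINT x|lborel. (LINT \<xi>|lborel. f x \<xi>))"
    by (rule lborel_pair.Fubini_integral[OF int])
  also have "\<dots> = (LINT x|lborel. \<phi> x * inv_fourier \<sigma> (x - y))"
    by (simp only: f_def integral_mult_right_zero inv_fourier_osc osc_def c_def)
  finally show ?thesis .
qed

section \<open>Regularisation of tempered distributions by convolution\<close>

text \<open>Seminorm bounds as a predicate: estimates can then be passed on pointwise, without first
  showing that the set under a supremum is bounded.\<close>

definition seminorm_le :: "nat \<Rightarrow> (real^'n \<Rightarrow> complex) \<Rightarrow> real \<Rightarrow> bool" where
  "seminorm_le N \<phi> B \<longleftrightarrow>
     (\<forall>bs\<in>lists Basis. length bs \<le> N \<longrightarrow> (\<forall>x. (1 + norm x) ^ N * norm (iter_deriv bs \<phi> x) \<le> B))"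

lemma seminorm_leI:
  "(\<And>bs x. bs \<in> lists Basis \<Longrightarrow> length bs \<le> N \<Longrightarrow> (1 + norm x) ^ N * norm (iter_deriv bs \<phi> x) \<le> B) \<Longrightarrow>
    seminorm_le N \<phi> B"
  by (simp add: seminorm_le_def)

lemma seminorm_leD:
  "seminorm_le N \<phi> B \<Longrightarrow> bs \<in> lists Basis \<Longrightarrow> length bs \<le> N \<Longrightarrow> (1 + norm x) ^ N * norm (iter_deriv bs \<phi> x) \<le> B"
  unfolding seminorm_le_def by blast

lemma seminorm_le_mono:
  assumes "seminorm_le N' \<phi> B" "N \<le> N'" shows "seminorm_le N \<phi> B"
proof (rule seminorm_leI)
  fix bs :: "(real^'a) list" and x :: "real^'a" assume bs: "bs \<in> lists Basis" "length bs \<le> N"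
  have "(1 + norm x) ^ N * norm (iter_deriv bs \<phi> x) \<le> (1 + norm x) ^ N' * norm (iter_deriv bs \<phi> x)"
    using assms(2) by (intro mult_right_mono power_increasing) auto
  also have "\<dots> \<le> B" using seminorm_leD[OF assms(1) bs(1)] bs(2) assms(2) by simp
  finally show "(1 + norm x) ^ N * norm (iter_deriv bs \<phi> x) \<le> B" .
qed

text \<open>Continuity in terms of \<open>seminorm_le\<close>. Tempered distributions, their
  differences and \<open>function_dist\<close> of integrable functions all fit, so the kernel
  estimates do not depend on where the functional comes from.\<close>

definition schwartz_functional :: "((real^'n \<Rightarrow> complex) \<Rightarrow> complex) \<Rightarrow> bool" where
  "schwartz_functional u \<longleftrightarrow> linear_functional_on schwartz u \<and>
     (\<exists>C\<ge>0. \<exists>N. \<forall>\<phi>\<in>schwartz. \<forall>B. seminorm_le N \<phi> B \<longrightarrow> norm (u \<phi>) \<le> C * B)"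

lemma schwartz_functionalE:
  assumes "schwartz_functional u"
  obtains C N where "C \<ge> 0" "\<And>\<phi> B. \<phi> \<in> schwartz \<Longrightarrow> seminorm_le N \<phi> B \<Longrightarrow> norm (u \<phi>) \<le> C * B"
  using assms unfolding schwartz_functional_def by blast

lemma schwartz_functional_linear:
  assumes "schwartz_functional u"
  shows "\<phi> \<in> schwartz \<Longrightarrow> \<theta> \<in> schwartz \<Longrightarrow> u (\<lambda>x. \<phi> x + \<theta> x) = u \<phi> + u \<theta>"
    and "\<phi> \<in> schwartz \<Longrightarrow> u (\<lambda>x. c * \<phi> x) = c * u \<phi>"
    and "\<phi> \<in> schwartz \<Longrightarrow> \<theta> \<in> schwartz \<Longrightarrow> u (\<lambda>x. \<phi> x - \<theta> x) = u \<phi> - u \<theta>"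
    and "\<phi> \<notin> schwartz \<Longrightarrow> u \<phi> = 0"
proof -
  show add: "u (\<lambda>x. \<phi> x + \<theta> x) = u \<phi> + u \<theta>" if "\<phi> \<in> schwartz" "\<theta> \<in> schwartz" for \<phi> \<theta>
    using assms that unfolding schwartz_functional_def linear_functional_on_def by blast
  show mult: "u (\<lambda>x. c * \<phi> x) = c * u \<phi>" if "\<phi> \<in> schwartz" for c \<phi>
    using assms that unfolding schwartz_functional_def linear_functional_on_def by blast
  show "u (\<lambda>x. \<phi> x - \<theta> x) = u \<phi> - u \<theta>" if "\<phi> \<in> schwartz" "\<theta> \<in> schwartz"
    using add[OF that(1) schwartz_cmult[OF that(2), of "-1"]] mult[OF that(2), of "-1"] by simp
  show "\<phi> \<notin> schwartz \<Longrightarrow> u \<phi> = 0"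
    using assms unfolding schwartz_functional_def linear_functional_on_def by blast
qed

lemma schwartz_functional_sum:
  assumes "schwartz_functional u" "finite I" "\<And>i. i \<in> I \<Longrightarrow> f i \<in> schwartz"
  shows "u (\<lambda>x. \<Sum>i\<in>I. c i * f i x) = (\<Sum>i\<in>I. c i * u (f i))"
  using assms(2,3)
proof (induction I)
  case empty
  show ?case using schwartz_functional_linear(2)[OF assms(1) schwartz_zero, of 0] by simp
next
  case (insert i I)
  then show ?case
    using schwartz_functional_linear(1)[OF assms(1) schwartz_cmult schwartz_sum[OF schwartz_cmult], of "f i" I f "c i" c]
    by (simp add: schwartz_functional_linear(2)[OF assms(1)])
qed

lemma tempered_schwartz_functional:
  assumes "u \<in> tempered" shows "schwartz_functional u"
proof -
  obtain C N where lin: "linear_functional_on schwartz u" and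
    CN: "\<And>\<phi>. \<phi> \<in> schwartz \<Longrightarrow> norm (u \<phi>) \<le> C * schwartz_seminorm N \<phi>"
    using assms unfolding tempered_def by blast
  \<comment> \<open>The constant in \<open>tempered\<close> may be negative, hence the absolute
    value; the supremum defining the seminorm lies between 0 and B.\<close>
  have "norm (u \<phi>) \<le> \<bar>C\<bar> * B" if \<phi>: "\<phi> \<in> schwartz" and
    B: "seminorm_le N \<phi> B" for \<phi> B
  proof -
    note B = B[unfolded seminorm_le_def]
    have ne: "{bs \<in> lists (Basis :: (real^'a) set). length bs \<le> N} \<times> (UNIV :: (real^'a) set) \<noteq> {}"
      using lists.Nil by fastforce
    have le: "schwartz_seminorm N \<phi> \<le> B"
      unfolding schwartz_seminorm_def using B by (intro cSUP_least[OF ne]) auto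
    have bdd: "bdd_above ((\<lambda>(bs, x). (1 + norm x) ^ N * norm (iter_deriv bs \<phi> x)) `
        ({bs \<in> lists Basis. length bs \<le> N} \<times> UNIV))"
      using B by (intro bdd_aboveI2[where M = B]) auto
    have "0 \<le> schwartz_seminorm N \<phi>"
      unfolding schwartz_seminorm_def by (rule cSUP_upper2[OF bdd, of "([], 0)"]) auto
    then have "C * schwartz_seminorm N \<phi> \<le> \<bar>C\<bar> * B" using le by (intro mult_mono) auto
    then show ?thesis using CN[OF \<phi>] by linarith
  qed
  then show ?thesis using lin unfolding schwartz_functional_def by (metis abs_ge_zero)
qed

lemma schwartz_functional_diff:
  assumes "schwartz_functional u" "schwartz_functional v"
  shows "schwartz_functional (\<lambda>\<phi>. u \<phi> - v \<phi>)"
proof -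
  obtain C N where C: "C \<ge> 0" "\<And>\<phi> B. \<phi> \<in> schwartz \<Longrightarrow> seminorm_le N \<phi> B \<Longrightarrow> norm (u \<phi>) \<le> C * B"
    by (rule schwartz_functionalE[OF assms(1)]) (rule that)
  obtain C' N' where C': "C' \<ge> 0" "\<And>\<phi> B. \<phi> \<in> schwartz \<Longrightarrow> seminorm_le N' \<phi> B \<Longrightarrow> norm (v \<phi>) \<le> C' * B"
    by (rule schwartz_functionalE[OF assms(2)]) (rule that)
  have "norm (u \<phi> - v \<phi>) \<le> (C + C') * B" if \<phi>: "\<phi> \<in> schwartz" and
    B: "seminorm_le (max N N') \<phi> B" for \<phi> B
  proof -
    have "norm (u \<phi>) \<le> C * B" by (rule C(2)[OF \<phi> seminorm_le_mono[OF B]]) simp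
    moreover have "norm (v \<phi>) \<le> C' * B" by (rule C'(2)[OF \<phi> seminorm_le_mono[OF B]]) simp
    ultimately show ?thesis using norm_triangle_ineq4[of "u \<phi>" "v \<phi>"] by (simp add: distrib_right)
  qed
  moreover have "linear_functional_on schwartz (\<lambda>\<phi>. u \<phi> - v \<phi>)"
    unfolding linear_functional_on_def
    using schwartz_functional_linear[OF assms(1)] schwartz_functional_linear[OF assms(2)]
    by (auto simp: algebra_simps)
  moreover have "C + C' \<ge> 0" using C(1) C'(1) by simp
  ultimately show ?thesis unfolding schwartz_functional_def by blast
qed

text \<open>Mean value theorem along the segment from x - y to x' - y. Adding y to a point z of it
  gives a point of the ball of radius R, so the weight at y is at most (1 + R)^N times the weight at
  z, uniformly in y.\<close>

lemma translate_lipschitz: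
  fixes \<kappa> :: "real^'n \<Rightarrow> complex"
  assumes "\<kappa> \<in> schwartz" "R \<ge> 0"
  obtains L where "L \<ge> 0" "\<And>bs x x' y. bs \<in> lists Basis \<Longrightarrow> length bs \<le> N \<Longrightarrow> norm x \<le> R \<Longrightarrow> norm x' \<le> R \<Longrightarrow>
    (1 + norm y) ^ N * norm (iter_deriv bs (\<lambda>y. \<kappa> (x - y)) y - iter_deriv bs (\<lambda>y. \<kappa> (x' - y)) y) \<le> L * norm (x - x')"
proof -
  \<comment> \<open>One derivative more than in the claim: the Lipschitz constant of a derivative of
    order N is governed by order N + 1.\<close>
  obtain C where C: "C \<ge> 0" "\<And>bs z. bs \<in> lists Basis \<Longrightarrow> length bs \<le> Suc N \<Longrightarrow> (1 + norm z) ^ N * norm (iter_deriv bs \<kappa> z) \<le> C"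
    by (rule schwartz_uniform[OF assms(1), of "Suc N" N]) (rule that)
  have sm: "smooth \<kappa>" using assms by (simp add: schwartz_smooth)
  show ?thesis
  proof (rule that[of "real CARD('n) * (C * (1 + R) ^ N)"])
    show "0 \<le> real CARD('n) * (C * (1 + R) ^ N)" using C(1) assms(2) by simp
    fix bs :: "(real^'n) list" and x x' y :: "real^'n"
    assume bs: "bs \<in> lists Basis" "length bs \<le> N" and x: "norm x \<le> R" "norm x' \<le> R"
    let ?B = "C * (1 + R) ^ N / (1 + norm y) ^ N"
    have pos: "(1 + norm y) ^ N > 0" by (intro zero_less_power) (simp add: add_pos_nonneg)
    have bound: "norm (dir_deriv b (iter_deriv bs \<kappa>) z) \<le> ?B"
      if "b \<in> Basis" "z \<in> closed_segment (x - y) (x' - y)" for b z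
    proof -
      have "z + y \<in> closed_segment x x'"
        using that(2) closed_segment_translation_eq[of y z "x - y" "x' - y"] by (simp add: add.commute)
      then have "z + y \<in> cball 0 R"
        using x closed_segment_subset[of x "cball 0 R" x'] by auto
      then have "1 + norm y \<le> (1 + R) * (1 + norm z)"
        using one_plus_norm_mult[of y "z + y"] mult_right_mono[of "1 + norm (z + y)" "1 + R" "1 + norm z"] by simp
      then have "(1 + norm y) ^ N \<le> (1 + R) ^ N * (1 + norm z) ^ N"
        unfolding power_mult_distrib[symmetric] by (intro power_mono) auto
      then have "(1 + norm y) ^ N * norm (iter_deriv (b # bs) \<kappa> z) \<le>
          (1 + R) ^ N * ((1 + norm z) ^ N * norm (iter_deriv (b # bs) \<kappa> z))"
        by (simp add: mult_right_mono mult.assoc[symmetric])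
      also have "\<dots> \<le> (1 + R) ^ N * C"
        using bs that(1) assms(2) by (intro mult_left_mono C(2)) auto
      finally show ?thesis using pos by (simp add: iter_deriv_Cons field_simps)
    qed
    have eq: "iter_deriv bs (\<lambda>y. \<kappa> (x - y)) y = of_real (\<Prod>b\<leftarrow>bs. - 1) * iter_deriv bs \<kappa> (x - y)" for x
      using iter_deriv_affine[OF diagonal_map_uminus sm bs(1), of x] by simp
    have "norm (iter_deriv bs (\<lambda>y. \<kappa> (x - y)) y - iter_deriv bs (\<lambda>y. \<kappa> (x' - y)) y) =
        norm (iter_deriv bs \<kappa> (x - y) - iter_deriv bs \<kappa> (x' - y))"
      unfolding eq right_diff_distrib[symmetric] norm_mult norm_prod_list_minus_one by simp
    also have "\<dots> \<le> real DIM(real^'n) * ?B * norm ((x - y) - (x' - y))"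
      using bound by (intro smooth_lipschitz_on[OF smooth_iter_deriv[OF sm bs(1)] convex_closed_segment]) auto
    finally have "(1 + norm y) ^ N * norm (iter_deriv bs (\<lambda>y. \<kappa> (x - y)) y - iter_deriv bs (\<lambda>y. \<kappa> (x' - y)) y) \<le>
        (1 + norm y) ^ N * (real CARD('n) * ?B * norm (x - x'))"
      using pos by (intro mult_left_mono) simp_all
    also have "\<dots> = real CARD('n) * ((1 + norm y) ^ N * ?B) * norm (x - x')" by (simp only: mult_ac)
    also have "(1 + norm y) ^ N * ?B = C * (1 + R) ^ N"
      by (subst times_divide_eq_right, rule nonzero_mult_div_cancel_left) (use pos in linarith)
    finally show "(1 + norm y) ^ N * norm (iter_deriv bs (\<lambda>y. \<kappa> (x - y)) y - iter_deriv bs (\<lambda>y. \<kappa> (x' - y)) y) \<le>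
        real CARD('n) * (C * (1 + R) ^ N) * norm (x - x')" .
  qed
qed

lemma schwartz_functional_translate_lipschitz:
  assumes "schwartz_functional u" "\<kappa> \<in> schwartz" "R \<ge> 0"
  obtains L where "L \<ge> 0" "\<And>x x'. norm x \<le> R \<Longrightarrow> norm x' \<le> R \<Longrightarrow>
    norm (u (\<lambda>y. \<kappa> (x - y)) - u (\<lambda>y. \<kappa> (x' - y))) \<le> L * norm (x - x')"
proof -
  obtain C N where C: "C \<ge> 0" "\<And>\<phi> B. \<phi> \<in> schwartz \<Longrightarrow> seminorm_le N \<phi> B \<Longrightarrow> norm (u \<phi>) \<le> C * B"
    by (rule schwartz_functionalE[OF assms(1)]) (rule that)
  obtain L where L: "L \<ge> 0" "\<And>bs x x' y. bs \<in> lists Basis \<Longrightarrow> length bs \<le> N \<Longrightarrow> norm x \<le> R \<Longrightarrow> norm x' \<le> R \<Longrightarrow>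
    (1 + norm y) ^ N * norm (iter_deriv bs (\<lambda>y. \<kappa> (x - y)) y - iter_deriv bs (\<lambda>y. \<kappa> (x' - y)) y) \<le> L * norm (x - x')"
    by (rule translate_lipschitz[OF assms(2,3), of N]) (rule that)
  have sm: "smooth (\<lambda>y. \<kappa> (x - y))" for x using assms(2) by (intro smooth_reflect schwartz_smooth)
  show ?thesis
  proof (rule that[of "C * L"])
    show "0 \<le> C * L" using C(1) L(1) by simp
    fix x x' :: "real^'a" assume x: "norm x \<le> R" "norm x' \<le> R"
    have "norm (u (\<lambda>y. \<kappa> (x - y) - \<kappa> (x' - y))) \<le> C * (L * norm (x - x'))"
      using L(2)[OF _ _ x]
      by (intro C(2) schwartz_diff schwartz_reflect assms seminorm_leI) (simp add: iter_deriv_diff sm)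
    then show "norm (u (\<lambda>y. \<kappa> (x - y)) - u (\<lambda>y. \<kappa> (x' - y))) \<le> C * L * norm (x - x')"
      by (simp add: schwartz_functional_linear(3)[OF assms(1)] schwartz_reflect assms(2) mult.assoc)
  qed
qed

lemma continuous_on_UNIV_locally:
  fixes f :: "'a::real_normed_vector \<Rightarrow> 'b::metric_space"
  assumes "\<And>R. R \<ge> 0 \<Longrightarrow> continuous_on (cball 0 R) f"
  shows "continuous_on UNIV f"
proof (rule continuous_at_imp_continuous_on, rule ballI)
  fix x :: 'a
  have "continuous_on (ball 0 (norm x + 1)) f"
    using assms[of "norm x + 1"] by (rule continuous_on_subset) auto
  then show "isCont f x" by (rule continuous_on_interior) simp
qed

lemma schwartz_functional_translate_continuous:
  assumes "schwartz_functional u" "\<kappa> \<in> schwartz"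
  shows "continuous_on UNIV (\<lambda>x. u (\<lambda>y. \<kappa> (x - y)))"
proof (rule continuous_on_UNIV_locally)
  fix R :: real assume "R \<ge> 0"
  obtain L where L: "L \<ge> 0" "\<And>x x'. norm x \<le> R \<Longrightarrow> norm x' \<le> R \<Longrightarrow>
    norm (u (\<lambda>y. \<kappa> (x - y)) - u (\<lambda>y. \<kappa> (x' - y))) \<le> L * norm (x - x')"
    by (rule schwartz_functional_translate_lipschitz[OF assms \<open>R \<ge> 0\<close>]) (rule that)
  have "L-lipschitz_on (cball 0 R) (\<lambda>x. u (\<lambda>y. \<kappa> (x - y)))"
    using L by (intro lipschitz_onI) (auto simp: dist_norm)
  then show "continuous_on (cball 0 R) (\<lambda>x. u (\<lambda>y. \<kappa> (x - y)))" by (rule lipschitz_on_continuous_on)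
qed

text \<open>The coefficients in the sum do not depend on \<open>g\<close>. Hence the same finite
  combination of translates can be evaluated pointwise, with derivatives, and under a
  functional.\<close>

lemma integral_simple_compose:
  fixes \<phi> g :: "'a::euclidean_space \<Rightarrow> complex"
  assumes "simple_function lborel s" "integrable lborel \<phi>"
  shows "integrable lborel (\<lambda>x. \<phi> x * g (s x))"
    and "(LINT x|lborel. \<phi> x * g (s x)) = (\<Sum>z\<in>range s. (LINT x|lborel. indicator (s -` {z}) x *\<^sub>R \<phi> x) * g z)"
proof -
  have fin: "finite (range s)" and meas: "\<And>z. s -` {z} \<in> sets lborel"
    using assms(1) simple_functionD(1)[OF assms(1)] simple_functionD(2)[OF assms(1), of "{z}" for z] by auto
  have eq: "\<phi> x * g (s x) = (\<Sum>z\<in>range s. (indicator (s -` {z}) x *\<^sub>R \<phi> x) * g z)" for x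
  proof -
    have "(\<Sum>z\<in>range s. (indicator (s -` {z}) x *\<^sub>R \<phi> x) * g z) = (\<Sum>z\<in>range s. if z = s x then \<phi> x * g z else 0)"
      by (intro sum.cong refl) (auto simp: indicator_def)
    then show ?thesis using fin by simp
  qed
  have int: "integrable lborel (\<lambda>x. (indicator (s -` {z}) x *\<^sub>R \<phi> x) * g z)" for z
    using assms(2) meas by (intro integrable_mult_left integrable_mult_indicator) auto
  show "integrable lborel (\<lambda>x. \<phi> x * g (s x))"
    unfolding eq by (intro Bochner_Integration.integrable_sum int)
  show "(LINT x|lborel. \<phi> x * g (s x)) = (\<Sum>z\<in>range s. (LINT x|lborel. indicator (s -` {z}) x *\<^sub>R \<phi> x) * g z)"
    unfolding eq by (subst Bochner_Integration.integral_sum[OF int]) (simp only: integral_mult_left_zero)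
qed

text \<open>A continuous functional may be interchanged with the integral: the integral is a limit, in
  every Schwartz seminorm, of finite linear combinations of translates.\<close>

lemma schwartz_functional_convolution:
  fixes \<phi> \<sigma> :: "real^'n \<Rightarrow> complex"
  assumes u: "schwartz_functional u" and \<phi>: "\<phi> \<in> test_functions UNIV" and \<sigma>: "\<sigma> \<in> test_functions UNIV"
  defines "\<kappa> \<equiv> inv_fourier \<sigma>"
  shows "u (fourier (\<lambda>\<xi>. \<sigma> \<xi> * inv_fourier \<phi> \<xi>)) = (LINT x|lborel. \<phi> x * u (\<lambda>y. \<kappa> (x - y)))"
proof -
  define H where "H = fourier (\<lambda>\<xi>. \<sigma> \<xi> * inv_fourier \<phi> \<xi>)"
  define G where "G x = u (\<lambda>y. \<kappa> (x - y))" for x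
  define T where "T x = (\<lambda>y. \<kappa> (x - y))" for x
  have \<kappa>: "\<kappa> \<in> schwartz" unfolding \<kappa>_def by (rule inv_fourier_schwartz[OF \<sigma>])
  have T: "T x \<in> schwartz" for x unfolding T_def by (rule schwartz_reflect[OF \<kappa>])
  have \<sigma>\<phi>: "(\<lambda>\<xi>. \<sigma> \<xi> * inv_fourier \<phi> \<xi>) \<in> test_functions UNIV"
    using test_functions_mult[OF \<sigma> schwartz_smooth[OF inv_fourier_schwartz[OF \<phi>]]] by (simp add: mult.commute)
  have H: "H \<in> schwartz" unfolding H_def by (rule fourier_schwartz[OF \<sigma>\<phi>])
  have \<kappa>bs: "iter_deriv bs \<kappa> = inv_fourier (\<lambda>\<xi>. coord_prod bs \<xi> * \<sigma> \<xi>)" if "bs \<in> lists Basis" for bs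
    unfolding \<kappa>_def inv_fourier_osc[abs_def] iter_deriv_cmult[OF smooth_osc[OF \<sigma>] that] iter_deriv_osc[OF \<sigma>] ..
  have Tbs: "iter_deriv bs (T x) y = of_real (\<Prod>b\<leftarrow>bs. - 1) * iter_deriv bs \<kappa> (x - y)" if "bs \<in> lists Basis" for bs x y
    unfolding T_def using iter_deriv_affine[OF diagonal_map_uminus schwartz_smooth[OF \<kappa>] that, of x] by simp
  \<comment> \<open>Derivatives of \<open>H\<close> are Fourier integrals with the symbol
    \<open>coord_prod bs \<xi> * \<sigma> \<xi>\<close>, and this product is again a test function;
    the dual convolution formula thus gives all orders at once.\<close>
  have Hbs: "iter_deriv bs H y = (LINT x|lborel. \<phi> x * iter_deriv bs (T x) y)" if bs: "bs \<in> lists Basis" for bs y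
  proof -
    have "iter_deriv bs H y = of_real (\<Prod>b\<leftarrow>bs. - 1) * iter_deriv bs (osc (\<lambda>\<xi>. \<sigma> \<xi> * inv_fourier \<phi> \<xi>)) (0 - y)"
      unfolding H_def fourier_osc[abs_def]
      using iter_deriv_affine[OF diagonal_map_uminus smooth_osc[OF \<sigma>\<phi>] bs, of 0] by simp
    also have "iter_deriv bs (osc (\<lambda>\<xi>. \<sigma> \<xi> * inv_fourier \<phi> \<xi>)) (0 - y) =
        osc (\<lambda>\<xi>. (coord_prod bs \<xi> * \<sigma> \<xi>) * inv_fourier \<phi> \<xi>) (0 - y)"
      by (simp add: iter_deriv_osc[OF \<sigma>\<phi>] mult.assoc)
    also have "\<dots> = (LINT x|lborel. \<phi> x * iter_deriv bs \<kappa> (x - y))"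
      by (simp only: osc_mult_inv_fourier[OF \<phi> test_coord_prod[OF \<sigma>]] \<kappa>bs[OF bs])
    also have "of_real (\<Prod>b\<leftarrow>bs. - 1) * \<dots> = (LINT x|lborel. \<phi> x * iter_deriv bs (T x) y)"
      unfolding integral_mult_right_zero[symmetric] Tbs[OF bs] by (simp add: mult_ac)
    finally show ?thesis .
  qed
  obtain K where K: "smooth \<phi>" "compact K" "K \<subseteq> UNIV" "\<And>x bs. x \<notin> K \<Longrightarrow> iter_deriv bs \<phi> x = 0" "\<And>x. x \<notin> K \<Longrightarrow> \<phi> x = 0"
    by (rule test_functionsE[OF \<phi>]) (rule that)
  obtain R where R: "R \<ge> 0" "\<And>x. x \<in> K \<Longrightarrow> norm x \<le> R"
  proof -
    obtain R where "\<And>x. x \<in> K \<Longrightarrow> norm x \<le> R" using compact_imp_bounded[OF K(2)] by (auto simp: bounded_iff)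
    then show ?thesis using that[of "max 0 R"] by fastforce
  qed
  \<comment> \<open>Simple functions tending to the identity act as quadrature rules: \<phi> x dx is
    lumped at the finitely many values of \<open>s i\<close>. The bound 2 |x| keeps the nodes
    belonging to points of K in the ball of radius 2 R.\<close>
  obtain s where s: "\<And>i. simple_function lborel (s i :: real^'n \<Rightarrow> real^'n)"
    "\<And>x. (\<lambda>i. s i x) \<longlonglongrightarrow> x" "\<And>i x. norm (s i x) \<le> 2 * norm x"
    using borel_measurable_implies_sequence_metric[of "\<lambda>x::real^'n. x" lborel 0] by auto
  have int\<phi>: "integrable lborel \<phi>" by (rule integrable_test[OF \<phi>])
  obtain C N where C: "C \<ge> 0" "\<And>\<phi> B. \<phi> \<in> schwartz \<Longrightarrow> seminorm_le N \<phi> B \<Longrightarrow> norm (u \<phi>) \<le> C * B"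
    by (rule schwartz_functionalE[OF u]) (rule that)
  have R2: "2 * R \<ge> 0" using R(1) by simp
  obtain L where L: "L \<ge> 0" "\<And>bs x x' y. bs \<in> lists Basis \<Longrightarrow> length bs \<le> N \<Longrightarrow> norm x \<le> 2 * R \<Longrightarrow> norm x' \<le> 2 * R \<Longrightarrow>
    (1 + norm y) ^ N * norm (iter_deriv bs (\<lambda>y. \<kappa> (x - y)) y - iter_deriv bs (\<lambda>y. \<kappa> (x' - y)) y) \<le> L * norm (x - x')"
    by (rule translate_lipschitz[OF \<kappa> R2, of N]) (rule that)
  define a where "a i z = (LINT x|lborel. indicator (s i -` {z}) x *\<^sub>R \<phi> x)" for i z
  define Hi where "Hi i = (\<lambda>y. \<Sum>z\<in>range (s i). a i z * T z y)" for i
  have fin: "finite (range (s i))" for i using simple_functionD(1)[OF s(1)] by simp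
  have Hi: "Hi i \<in> schwartz" for i unfolding Hi_def by (intro schwartz_sum schwartz_cmult T)
  have Hibs: "iter_deriv bs (Hi i) y = (LINT x|lborel. \<phi> x * iter_deriv bs (T (s i x)) y)" if bs: "bs \<in> lists Basis" for bs i y
    unfolding Hi_def integral_simple_compose(2)[OF s(1) int\<phi>, of "\<lambda>z. iter_deriv bs (T z) y"] a_def[symmetric]
    using schwartz_smooth[OF T] bs
    by (simp add: iter_deriv_sum smooth_cmult iter_deriv_cmult)
  have uHi: "u (Hi i) = (LINT x|lborel. \<phi> x * G (s i x))" for i
  proof -
    have "u (Hi i) = (\<Sum>z\<in>range (s i). a i z * u (T z))"
      unfolding Hi_def by (rule schwartz_functional_sum[OF u fin T])
    also have "\<dots> = (LINT x|lborel. \<phi> x * G (s i x))"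
      by (simp only: integral_simple_compose(2)[OF s(1) int\<phi>, where g = G] a_def, simp only: G_def T_def)
    finally show ?thesis .
  qed
  \<comment> \<open>A bound for the N-th seminorm of \<open>H\<close> minus \<open>Hi i\<close>,
    from the Lipschitz estimate for translates; it tends to 0 by dominated convergence.\<close>
  define \<epsilon> where "\<epsilon> i = (LINT x|lborel. norm (\<phi> x) * (L * norm (x - s i x)))" for i
  have s3: "norm (x - s i x) \<le> 3 * norm x" for x i
    using norm_triangle_ineq4[of x "s i x"] s(3)[of i x] by simp
  have smeas [measurable]: "s i \<in> borel_measurable borel" for i using borel_measurable_simple_function[OF s(1)] by simp
  have \<phi>meas [measurable]: "\<phi> \<in> borel_measurable borel" using K(1) by (rule smooth_borel)
  have dom: "integrable lborel (\<lambda>x. norm (\<phi> x) * (L * (3 * norm x)))"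
    using K by (intro integrable_compact_support[of _ K] continuous_intros smooth_continuous_on) auto
  have \<epsilon>int: "integrable lborel (\<lambda>x. norm (\<phi> x) * (L * norm (x - s i x)))" for i
    by (rule Bochner_Integration.integrable_bound[OF dom])
       (use s3 L(1) in \<open>auto intro!: AE_I2 mult_left_mono simp: abs_mult\<close>)
  have "\<epsilon> \<longlonglongrightarrow> (LINT x|lborel. norm (\<phi> x) * (L * norm (x - (x :: real^'n))))"
    unfolding \<epsilon>_def
  proof (rule integral_dominated_convergence[OF _ _ dom])
    show "AE x in lborel. (\<lambda>i. norm (\<phi> x) * (L * norm (x - s i x))) \<longlonglongrightarrow> norm (\<phi> x) * (L * norm (x - x))"
      by (intro AE_I2 tendsto_intros s(2))
    show "AE x in lborel. norm (norm (\<phi> x) * (L * norm (x - s i x))) \<le> norm (\<phi> x) * (L * (3 * norm x))" for i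
      using s3 L(1) by (intro AE_I2) (auto intro!: mult_left_mono simp: abs_mult)
  qed auto
  then have \<epsilon>0: "\<epsilon> \<longlonglongrightarrow> 0" by simp
  have diff: "norm (u H - u (Hi i)) \<le> C * \<epsilon> i" for i
    unfolding schwartz_functional_linear(3)[OF u H Hi, symmetric]
  proof (rule C(2)[OF schwartz_diff[OF H Hi]], rule seminorm_leI)
    fix bs :: "(real^'n) list" and y :: "real^'n" assume bs: "bs \<in> lists Basis" "length bs \<le> N"
    have contbs: "continuous_on UNIV (\<lambda>x. iter_deriv bs \<kappa> (x - y))"
      by (intro continuous_on_compose2[OF smooth_continuous_on[OF smooth_iter_deriv[OF schwartz_smooth[OF \<kappa>] bs(1)], of UNIV]] continuous_intros) auto
    have int1: "integrable lborel (\<lambda>x. \<phi> x * iter_deriv bs (T x) y)"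
      unfolding Tbs[OF bs(1)]
      using K by (intro integrable_compact_support[of _ K] continuous_intros contbs smooth_continuous_on) auto
    have int2: "integrable lborel (\<lambda>x. \<phi> x * iter_deriv bs (T (s i x)) y)"
      by (rule integral_simple_compose(1)[OF s(1) int\<phi>])
    have "iter_deriv bs (\<lambda>x. H x - Hi i x) y = (LINT x|lborel. \<phi> x * iter_deriv bs (T x) y - \<phi> x * iter_deriv bs (T (s i x)) y)"
      by (simp add: iter_deriv_diff schwartz_smooth H Hi bs Hbs Hibs Bochner_Integration.integral_diff[OF int1 int2])
    then have "(1 + norm y) ^ N * norm (iter_deriv bs (\<lambda>x. H x - Hi i x) y) =
      norm (LINT x|lborel. of_real ((1 + norm y) ^ N) * (\<phi> x * iter_deriv bs (T x) y - \<phi> x * iter_deriv bs (T (s i x)) y))"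
      unfolding integral_mult_right_zero norm_mult norm_of_real by simp
    also have "\<dots> \<le> \<epsilon> i"
      unfolding \<epsilon>_def
    proof (rule Bochner_Integration.integral_norm_bound_integral[OF _ \<epsilon>int])
      show "integrable lborel (\<lambda>x. of_real ((1 + norm y) ^ N) * (\<phi> x * iter_deriv bs (T x) y - \<phi> x * iter_deriv bs (T (s i x)) y))"
        by (intro integrable_mult_right Bochner_Integration.integrable_diff int1 int2)
      fix x
      show "norm (of_real ((1 + norm y) ^ N) * (\<phi> x * iter_deriv bs (T x) y - \<phi> x * iter_deriv bs (T (s i x)) y)) \<le>
          norm (\<phi> x) * (L * norm (x - s i x))"
      proof (cases "x \<in> K")
        case True
        then have "norm x \<le> 2 * R" "norm (s i x) \<le> 2 * R" using R(1) R(2)[OF True] s(3)[of i x] by auto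
        from mult_left_mono[OF L(2)[OF bs this, of y], of "norm (\<phi> x)"]
        show ?thesis
          unfolding right_diff_distrib[symmetric] norm_mult norm_of_real T_def by (simp add: mult_ac)
      qed (simp add: K(5))
    qed
    finally show "(1 + norm y) ^ N * norm (iter_deriv bs (\<lambda>x. H x - Hi i x) y) \<le> \<epsilon> i" .
  qed
  have "(\<lambda>i. u H - u (Hi i)) \<longlonglongrightarrow> 0"
    by (rule Lim_null_comparison[OF always_eventually[rule_format, OF diff]])
       (use tendsto_mult_right_zero[OF \<epsilon>0] in simp)
  then have lim1: "(\<lambda>i. u (Hi i)) \<longlonglongrightarrow> u H" by (simp add: LIMSEQ_iff norm_minus_commute)
  have Gc: "continuous_on UNIV G" unfolding G_def by (rule schwartz_functional_translate_continuous[OF u \<kappa>])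
  have "bounded (G ` cball 0 (2 * R))"
    by (intro compact_imp_bounded compact_continuous_image continuous_on_subset[OF Gc]) auto
  then obtain B where "\<forall>x\<in>cball 0 (2 * R). norm (G x) \<le> B" by (auto simp: bounded_iff)
  then have B: "norm (G x) \<le> B" if "norm x \<le> 2 * R" for x using that by simp
  have [measurable]: "G \<in> borel_measurable borel" by (rule borel_measurable_continuous_onI[OF Gc])
  have "(\<lambda>i. LINT x|lborel. \<phi> x * G (s i x)) \<longlonglongrightarrow> (LINT x|lborel. \<phi> x * G x)"
  proof (rule integral_dominated_convergence[where w = "\<lambda>x. norm (\<phi> x) * B"])
    show "AE x in lborel. (\<lambda>i. \<phi> x * G (s i x)) \<longlonglongrightarrow> \<phi> x * G x"
      using Gc by (intro AE_I2 tendsto_mult tendsto_const continuous_on_tendsto_compose[OF Gc s(2)]) auto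
    show "AE x in lborel. norm (\<phi> x * G (s i x)) \<le> norm (\<phi> x) * B" for i
    proof (rule AE_I2)
      fix x
      show "norm (\<phi> x * G (s i x)) \<le> norm (\<phi> x) * B"
      proof (cases "x \<in> K")
        case True
        then have "norm (s i x) \<le> 2 * R" using R(2)[OF True] s(3)[of i x] by simp
        then show ?thesis by (simp add: norm_mult mult_left_mono B)
      qed (simp add: K(5))
    qed
    show "integrable lborel (\<lambda>x. norm (\<phi> x) * B)" using int\<phi> by simp
  qed auto
  then have "u H = (LINT x|lborel. \<phi> x * G x)"
    using lim1 LIMSEQ_unique unfolding uHi by blast
  then show ?thesis unfolding H_def G_def .
qed

section \<open>The continuous function behind a Fourier multiplier\<close>

lemma test_functions_add:
  assumes "\<phi> \<in> test_functions \<Omega>" "\<theta> \<in> test_functions \<Omega>"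
  shows "(\<lambda>x. \<phi> x + \<theta> x) \<in> test_functions \<Omega>"
  using test_functions_diff[OF assms(1) test_functions_mult[OF assms(2) smooth_const[of "-1"]]] by simp

lemma test_functions_cmult: "\<phi> \<in> test_functions \<Omega> \<Longrightarrow> (\<lambda>x. c * \<phi> x) \<in> test_functions \<Omega>"
  by (rule test_functions_mult[OF _ smooth_const])

lemma integrable_continuous_mult_test:
  assumes "continuous_on UNIV f" "\<phi> \<in> test_functions \<Omega>"
  shows "integrable lborel (\<lambda>x. f x * \<phi> x)"
proof -
  obtain K where K: "smooth \<phi>" "compact K" "K \<subseteq> \<Omega>" "\<And>x bs. x \<notin> K \<Longrightarrow> iter_deriv bs \<phi> x = 0" "\<And>x. x \<notin> K \<Longrightarrow> \<phi> x = 0"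
    by (rule test_functionsE[OF assms(2)]) (rule that)
  show ?thesis
    using K(2,5) by (intro integrable_compact_support[of _ K] continuous_on_mult assms(1) smooth_continuous_on[OF K(1)]) auto
qed

lemma regular_dist_UNIV:
  assumes "f \<in> borel_measurable borel" "\<phi> \<in> test_functions UNIV"
  shows "regular_dist UNIV f \<phi> = (LINT x|lborel. f x * \<phi> x)"
proof -
  have [measurable]: "\<phi> \<in> borel_measurable borel" using assms(2) by (intro smooth_borel test_functions_smooth)
  note [measurable] = assms(1)
  show ?thesis
    using assms(2) by (simp add: regular_dist_def set_lebesgue_integral_def integral_completion)
qed

text \<open>If h a \<noteq> 0, test with a nonnegative \<rho> that lives where h differs from h a by
  less than half of |h a|: the integral of h \<rho> then cannot vanish. It yields uniqueness in the
  description of \<open>fun_of_dist\<close>.\<close>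

lemma continuous_eq_0_if_test_integrals_0:
  fixes h :: "real^'n \<Rightarrow> complex"
  assumes \<Psi>: "LP_generator \<Psi>" and h: "continuous_on UNIV h"
    and 0: "\<And>\<phi>. \<phi> \<in> test_functions UNIV \<Longrightarrow> (LINT x|lborel. h x * \<phi> x) = 0"
  shows "h a = 0"
proof (rule ccontr)
  assume "h a \<noteq> 0"
  then have "norm (h a) / 2 > 0" by simp
  moreover have "isCont h a" using h by (simp add: continuous_on_eq_continuous_at)
  ultimately obtain s where s: "s > 0" "\<And>x. dist x a < s \<Longrightarrow> dist (h x) (h a) < norm (h a) / 2"
    unfolding continuous_at_eps_delta by metis
  define r where "r = s / 3"
  have r: "r > 0" "2 * r < s" using s(1) by (auto simp: r_def)
  obtain \<beta> where \<beta>: "\<beta> \<in> test_functions UNIV" "\<And>x. dist a x \<le> r \<Longrightarrow> \<beta> x = 1" "\<And>x. dist a x \<ge> 2 * r \<Longrightarrow> \<beta> x = 0"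
    by (rule bump_function[OF \<Psi> r(1), of a]) (rule that)
  \<comment> \<open>The squared modulus is used because \<beta> is complex valued, with unspecified
    values between the two spheres.\<close>
  define \<rho> where "\<rho> x = cnj (\<beta> x) * \<beta> x" for x
  have \<rho>: "\<rho> \<in> test_functions UNIV"
    unfolding \<rho>_def using \<beta>(1) by (intro test_functions_mult smooth_cnj test_functions_smooth)
  have n\<rho>: "\<rho> x = of_real (norm (\<rho> x))" for x
    unfolding \<rho>_def by (simp add: norm_mult complex_norm_square[symmetric] power2_eq_square mult.commute)
  define I where "I = (LINT x|lborel. norm (\<rho> x))"
  have int\<rho>: "integrable lborel \<rho>" by (rule integrable_test[OF \<rho>])
  have int: "integrable lborel (\<lambda>x. (h x - h a) * \<rho> x)"
    by (intro integrable_continuous_mult_test[OF _ \<rho>] continuous_on_diff h continuous_on_const)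
  have "0 = (LINT x|lborel. h x * \<rho> x)" using 0[OF \<rho>] by simp
  also have "\<dots> = (LINT x|lborel. (h x - h a) * \<rho> x + h a * \<rho> x)" by (simp add: algebra_simps)
  also have "\<dots> = (LINT x|lborel. (h x - h a) * \<rho> x) + h a * (LINT x|lborel. \<rho> x)"
    using int int\<rho> by (subst Bochner_Integration.integral_add) auto
  also have "(LINT x|lborel. \<rho> x) = of_real I"
    unfolding I_def by (subst n\<rho>) (rule integral_complex_of_real)
  finally have "h a * of_real I = - (LINT x|lborel. (h x - h a) * \<rho> x)" by (simp add: eq_neg_iff_add_eq_0 add.commute)
  then have "norm (h a) * \<bar>I\<bar> = norm (LINT x|lborel. (h x - h a) * \<rho> x)"
    by (metis norm_minus_cancel norm_mult norm_of_real)
  also have "\<dots> \<le> (LINT x|lborel. norm (h a) / 2 * norm (\<rho> x))"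
  proof (rule Bochner_Integration.integral_norm_bound_integral[OF int])
    show "integrable lborel (\<lambda>x. norm (h a) / 2 * norm (\<rho> x))" using int\<rho> by simp
    fix x
    show "norm ((h x - h a) * \<rho> x) \<le> norm (h a) / 2 * norm (\<rho> x)"
    proof (cases "dist a x \<ge> 2 * r")
      case True
      then show ?thesis by (simp add: \<rho>_def \<beta>(3))
    next
      case False
      then have "dist (h x) (h a) < norm (h a) / 2" using r by (intro s(2)) (simp add: dist_commute)
      then show ?thesis unfolding norm_mult by (intro mult_right_mono) (auto simp: dist_norm)
    qed
  qed
  also have "\<dots> = norm (h a) / 2 * I" by (simp add: I_def)
  finally have "norm (h a) * \<bar>I\<bar> \<le> norm (h a) / 2 * I" .
  \<comment> \<open>\<rho> = 1 on the ball of radius r, so its mass is at least the volume of that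
    ball.\<close>
  moreover have "I > 0"
  proof -
    have "0 < measure lborel (cball a r)" using content_cball_pos[OF r(1), of a] by simp
    also have "\<dots> = (LINT x|lborel. indicator (cball a r) x)" by simp
    also have "\<dots> \<le> I"
      unfolding I_def
      by (intro integral_mono integrable_norm int\<rho> integrable_real_indicator)
         (use emeasure_lborel_cball_finite[of a r] in \<open>auto simp: indicator_def \<rho>_def \<beta>(2)\<close>)
    finally show ?thesis .
  qed
  ultimately show False using \<open>h a \<noteq> 0\<close> by simp
qed

text \<open>The definite description in \<open>fun_of_dist\<close> is resolved: the candidate is
  continuous, represents the distribution by the interchange of u with the integral, and no other
  continuous function does. All later estimates work with this pointwise formula.\<close>

lemma fourier_multiplier_eq:
  fixes u :: "(real^'n \<Rightarrow> complex) \<Rightarrow> complex"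
  assumes \<Psi>: "LP_generator \<Psi>" and u: "schwartz_functional u" and \<sigma>: "\<sigma> \<in> test_functions UNIV"
  shows "fourier_multiplier \<sigma> u = (\<lambda>x. u (\<lambda>y. inv_fourier \<sigma> (x - y)))"
proof -
  define G where "G x = u (\<lambda>y. inv_fourier \<sigma> (x - y))" for x
  have G: "continuous_on UNIV G"
    unfolding G_def by (rule schwartz_functional_translate_continuous[OF u inv_fourier_schwartz[OF \<sigma>]])
  define T where "T = inv_fourier_dist (mult_dist \<sigma> (fourier_dist u))"
  have T: "T \<phi> = (LINT x|lborel. G x * \<phi> x)" if \<phi>: "\<phi> \<in> test_functions UNIV" for \<phi>
  proof -
    have 1: "\<phi> \<in> schwartz" "inv_fourier \<phi> \<in> schwartz"
      using \<phi> by (auto intro: test_functions_schwartz inv_fourier_schwartz)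
    have "(\<lambda>\<xi>. inv_fourier \<phi> \<xi> * \<sigma> \<xi>) \<in> test_functions UNIV"
      by (rule test_functions_mult[OF \<sigma> schwartz_smooth[OF 1(2)]])
    then have 2: "(\<lambda>\<xi>. \<sigma> \<xi> * inv_fourier \<phi> \<xi>) \<in> schwartz"
      by (simp add: mult.commute test_functions_schwartz)
    have "T \<phi> = u (fourier (\<lambda>\<xi>. \<sigma> \<xi> * inv_fourier \<phi> \<xi>))"
      using 1 2 by (simp add: T_def inv_fourier_dist_def mult_dist_def fourier_dist_def)
    then show ?thesis
      unfolding schwartz_functional_convolution[OF u \<phi> \<sigma>] by (simp only: G_def mult.commute)
  qed
  have reg: "regular_dist UNIV f = restr UNIV T \<longleftrightarrow>
      (\<forall>\<phi>\<in>test_functions UNIV. (LINT x|lborel. f x * \<phi> x) = (LINT x|lborel. G x * \<phi> x))"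
    if "continuous_on UNIV f" for f
    using regular_dist_UNIV[OF borel_measurable_continuous_onI[OF that]] T
    by (auto simp: fun_eq_iff restr_def regular_dist_def)
  have "fun_of_dist T = G"
    unfolding fun_of_dist_def
  proof (rule the_equality)
    show "continuous_on UNIV G \<and> regular_dist UNIV G = restr UNIV T"
      using reg[OF G] G by simp
    fix f assume f: "continuous_on UNIV f \<and> regular_dist UNIV f = restr UNIV T"
    have "f a - G a = 0" for a
    proof (rule continuous_eq_0_if_test_integrals_0[OF \<Psi>, of "\<lambda>x. f x - G x"])
      show "continuous_on UNIV (\<lambda>x. f x - G x)" using f G by (intro continuous_intros) auto
      fix \<phi> :: "real^'n \<Rightarrow> complex" assume \<phi>: "\<phi> \<in> test_functions UNIV"
      have "integrable lborel (\<lambda>x. f x * \<phi> x)" "integrable lborel (\<lambda>x. G x * \<phi> x)"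
        using f G by (auto intro: integrable_continuous_mult_test[OF _ \<phi>])
      then show "(LINT x|lborel. (f x - G x) * \<phi> x) = 0"
        using reg[of f] f \<phi> by (simp add: left_diff_distrib)
    qed
    then show "f = G" by auto
  qed
  then show ?thesis by (simp add: fourier_multiplier_def T_def G_def[abs_def])
qed

section \<open>Anisotropic dilations of the regularising kernel\<close>

lemma Basis_cart: "b \<in> Basis \<Longrightarrow> \<exists>i. b = (axis i 1 :: real^'n)"
  by (auto simp: Basis_vec_def)

lemma diagonal_map_aniso: "diagonal_map (\<lambda>b. t powr (M \<bullet> b)) (aniso_dilation M t)"
  unfolding diagonal_map_def
proof (intro conjI ballI)
  show "linear (aniso_dilation M t)"
    by (rule linearI) (simp_all add: aniso_dilation_def vec_eq_iff algebra_simps)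
  fix b :: "real^'a" assume "b \<in> Basis"
  then obtain i where i: "b = axis i 1" using Basis_cart by blast
  then have "M \<bullet> b = M $ i" by (simp add: inner_axis)
  then show "aniso_dilation M t b = t powr (M \<bullet> b) *\<^sub>R b"
    by (simp only: i) (simp add: aniso_dilation_def vec_eq_iff axis_def)
qed

lemma powr_dilation_cancel: "(2 powr real k) powr m * ((2 powr - real k) powr m) = (1::real)"
  by (simp only: powr_powr powr_add[symmetric]) simp

lemma aniso_dilation_inner:
  "aniso_dilation M (2 powr real k) x \<bullet> aniso_dilation M (2 powr - real k) y = x \<bullet> y"
  unfolding inner_vec_def
  unfolding aniso_dilation_def
proof (intro sum.cong refl)
  fix i
  have "(2 powr real k) powr (M $ i) * x $ i * ((2 powr - real k) powr (M $ i) * y $ i) =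
      ((2 powr real k) powr (M $ i) * ((2 powr - real k) powr (M $ i))) * (x $ i * y $ i)" by (simp only: mult_ac)
  then show "(\<chi> i. (2 powr real k) powr (M $ i) * x $ i) $ i \<bullet> (\<chi> i. (2 powr - real k) powr (M $ i) * y $ i) $ i = x $ i \<bullet> y $ i"
    by (simp only: vec_lambda_beta inner_real_def powr_dilation_cancel mult_1)
qed

lemma aniso_dilation_inverse:
  "aniso_dilation M (2 powr real k) (aniso_dilation M (2 powr - real k) x) = x"
  by (simp only: aniso_dilation_def vec_eq_iff vec_lambda_beta mult.assoc[symmetric] powr_dilation_cancel mult_1)
    simp

text \<open>All entries of a weight are at least 1, so the dilation stretches every coordinate by at
  least 2^k. This isotropic lower bound turns the decay of anisotropic kernels into powers of 2^k
  |z|.\<close>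

lemma aniso_dilation_norm_ge:
  assumes "weight M" shows "2 ^ k * norm z \<le> norm (aniso_dilation M (2 powr real k) z)"
proof -
  have "norm ((2 ^ k) *\<^sub>R z) \<le> norm (aniso_dilation M (2 powr real k) z)"
  proof (rule norm_le_componentwise_cart)
    fix i
    have "(2::real) ^ k \<le> 2 powr (real k * M $ i)"
      using assms mult_left_mono[of 1 "M $ i" "real k"]
      by (simp add: weight_def flip: powr_realpow)
    then show "norm (((2 ^ k) *\<^sub>R z) $ i) \<le> norm (aniso_dilation M (2 powr real k) z $ i)"
      by (simp add: aniso_dilation_def powr_powr abs_mult mult_right_mono)
  qed
  then show ?thesis by simp
qed

lemma test_functions_dilation:
  assumes "\<psi> \<in> test_functions UNIV"
  shows "(\<lambda>\<xi>. \<psi> (aniso_dilation M (2 powr - real k) \<xi>)) \<in> test_functions UNIV"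
proof -
  obtain K where K: "smooth \<psi>" "compact K" "K \<subseteq> UNIV" "\<And>x bs. x \<notin> K \<Longrightarrow> iter_deriv bs \<psi> x = 0" "\<And>x. x \<notin> K \<Longrightarrow> \<psi> x = 0"
    by (rule test_functionsE[OF assms]) (rule that)
  have lin: "linear (aniso_dilation M t)" for t using diagonal_map_aniso unfolding diagonal_map_def by blast
  show ?thesis
  proof (rule test_functionsI)
    show "smooth (\<lambda>\<xi>. \<psi> (aniso_dilation M (2 powr - real k) \<xi>))"
      using smooth_affine[OF diagonal_map_aniso K(1), of 0] by simp
    show "compact (aniso_dilation M (2 powr real k) ` K)"
      by (intro compact_continuous_image K(2) linear_continuous_on)
         (use lin linear_conv_bounded_linear in blast)
    fix \<xi> assume "\<xi> \<notin> aniso_dilation M (2 powr real k) ` K"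
    then have "aniso_dilation M (2 powr - real k) \<xi> \<notin> K"
      by (metis aniso_dilation_inverse image_eqI)
    then show "\<psi> (aniso_dilation M (2 powr - real k) \<xi>) = 0" by (rule K(5))
  qed simp
qed

text \<open>The dilated kernel \<eta>_k of the overview, defined by its Fourier transform so that it
  fits \<open>fourier_multiplier_eq\<close> directly.\<close>

definition kern :: "real^'n \<Rightarrow> (real^'n \<Rightarrow> complex) \<Rightarrow> nat \<Rightarrow> real^'n \<Rightarrow> complex" where
  "kern M \<psi> k = inv_fourier (\<lambda>\<xi>. \<psi> (aniso_dilation M (2 powr - real k) \<xi>))"

text \<open>The determinant 2^(k|M|) of the dilation by 2^(kM); the sum over the basis is
  |M|.\<close>

definition jacobian :: "real^'n \<Rightarrow> nat \<Rightarrow> real" where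
  "jacobian M k = 2 powr (real k * (\<Sum>b\<in>Basis. M \<bullet> b))"

lemma jacobian_prod: "(\<Prod>b\<in>Basis. \<bar>(2 powr - real k) powr (M \<bullet> b)\<bar>) = inverse (jacobian M k)"
  "(\<Prod>b\<in>Basis. \<bar>(2 powr real k) powr (M \<bullet> b)\<bar>) = jacobian M k"
proof -
  have eq: "(\<Prod>b\<in>Basis. \<bar>(2 powr t) powr (M \<bullet> b)\<bar>) = 2 powr (t * (\<Sum>b\<in>Basis. M \<bullet> b))" for t :: real
    by (simp only: powr_powr abs_of_nonneg[OF powr_ge_zero] sum_distrib_left) (simp add: powr_sum)
  show "(\<Prod>b\<in>Basis. \<bar>(2 powr - real k) powr (M \<bullet> b)\<bar>) = inverse (jacobian M k)"
    unfolding eq jacobian_def by (simp add: powr_minus)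
  show "(\<Prod>b\<in>Basis. \<bar>(2 powr real k) powr (M \<bullet> b)\<bar>) = jacobian M k"
    unfolding eq jacobian_def ..
qed

text \<open>Substitution \<xi> = 2^(kM) \<zeta> in the Fourier integral. Mutually inverse dilations
  of the two arguments preserve the inner product, so the dilation passes to x and leaves the
  determinant as a factor.\<close>

lemma kern_eq:
  assumes "\<psi> \<in> test_functions UNIV"
  shows "kern M \<psi> k x = of_real (jacobian M k) * inv_fourier \<psi> (aniso_dilation M (2 powr real k) x)"
proof -
  let ?E = "aniso_dilation M (2 powr real k)" and ?D = "aniso_dilation M (2 powr - real k)"
  define f where "f \<zeta> = exp (\<i> * of_real (?E x \<bullet> \<zeta>)) * \<psi> \<zeta>" for \<zeta>
  have f: "f \<in> borel_measurable borel"
    unfolding f_def by (intro smooth_borel smooth_mult smooth_expi test_functions_smooth[OF assms])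
  have "osc \<psi> (?E x) = inverse (jacobian M k) *\<^sub>R (LINT \<zeta>|lborel. f (?D \<zeta>))"
    using integral_diagonal[OF diagonal_map_aniso _ f, of "2 powr - real k" M 0]
    unfolding jacobian_prod by (simp add: osc_def f_def)
  also have "(LINT \<zeta>|lborel. f (?D \<zeta>)) = osc (\<lambda>\<xi>. \<psi> (?D \<xi>)) x"
    by (simp add: osc_def f_def aniso_dilation_inner)
  finally have "osc (\<lambda>\<xi>. \<psi> (?D \<xi>)) x = of_real (jacobian M k) * osc \<psi> (?E x)"
    by (simp add: scaleR_conv_of_real jacobian_def)
  then show ?thesis by (simp only: kern_def inv_fourier_osc mult_ac)
qed

lemma kern_schwartz: "\<psi> \<in> test_functions UNIV \<Longrightarrow> kern M \<psi> k \<in> schwartz"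
  unfolding kern_def by (intro inv_fourier_schwartz[of _ UNIV] test_functions_dilation)

lemma low_freq_eq:
  assumes "LP_generator \<Psi>" "schwartz_functional u" "\<psi> \<in> test_functions UNIV"
  shows "low_freq M \<psi> k u x = u (\<lambda>y. kern M \<psi> k (x - y))"
  unfolding low_freq_def fourier_multiplier_eq[OF assms(1,2) test_functions_dilation[OF assms(3)]] kern_def ..

lemma low_freq_continuous:
  assumes "LP_generator \<Psi>" "schwartz_functional u" "\<psi> \<in> test_functions UNIV"
  shows "continuous_on UNIV (low_freq M \<psi> k u)"
  using schwartz_functional_translate_continuous[OF assms(2) kern_schwartz[OF assms(3)], of M k]
  by (simp add: low_freq_eq[OF assms])

section \<open>Kernel estimates, growth and locality of low frequency parts\<close>

lemma prod_list_le_power: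
  fixes f :: "'a \<Rightarrow> real"
  assumes "\<And>b. b \<in> set bs \<Longrightarrow> 0 \<le> f b \<and> f b \<le> q"
  shows "0 \<le> (\<Prod>b\<leftarrow>bs. f b) \<and> (\<Prod>b\<leftarrow>bs. f b) \<le> q ^ length bs"
  using assms
proof (induction bs)
  case (Cons a bs)
  have "0 \<le> f a" "f a \<le> q" using Cons.prems[of a] by auto
  moreover have "0 \<le> (\<Prod>b\<leftarrow>bs. f b) \<and> (\<Prod>b\<leftarrow>bs. f b) \<le> q ^ length bs" using Cons by simp
  ultimately show ?case by (auto intro!: mult_mono)
qed simp

text \<open>The order of the quantifiers matters: the exponent A depends on the number N of
  derivatives, not on the power P of the weight. The weight costs no power of 2^k, as 2^k |z| is at
  most the norm of the dilated z; any power of 2^k can therefore be gained away from the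
  origin.\<close>

lemma kern_bound:
  fixes M :: "real^'n"
  assumes M: "weight M" and \<psi>: "\<psi> \<in> test_functions UNIV"
  obtains A where "\<And>P. \<exists>C\<ge>0. \<forall>k bs z. bs \<in> lists Basis \<longrightarrow> length bs \<le> N \<longrightarrow>
    (1 + 2 ^ k * norm z) ^ P * norm (iter_deriv bs (kern M \<psi> k) z) \<le> C * 2 ^ (k * A)"
proof -
  obtain m :: nat where m: "(\<Sum>b\<in>Basis. \<bar>M \<bullet> b\<bar>) \<le> real m" using real_arch_simple by blast
  have mb: "M \<bullet> b \<le> real m" if "b \<in> Basis" for b
  proof -
    have "\<bar>M \<bullet> b\<bar> \<le> (\<Sum>b\<in>Basis. \<bar>M \<bullet> b\<bar>)" using that by (intro member_le_sum) auto
    then show ?thesis using m by linarith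
  qed
  have jac: "jacobian M k \<le> 2 ^ (k * m)" for k
  proof -
    have "(\<Sum>b\<in>Basis. M \<bullet> b) \<le> real m" using sum_mono[of Basis "\<lambda>b. M \<bullet> b" "\<lambda>b. \<bar>M \<bullet> b\<bar>"] m by fastforce
    then have "jacobian M k \<le> 2 powr (real k * real m)"
      unfolding jacobian_def by (intro powr_mono mult_left_mono) auto
    then show ?thesis by (simp flip: powr_realpow)
  qed
  show ?thesis
  \<comment> \<open>One m pays for the determinant, and one for each of at most N
    derivatives.\<close>
  proof (rule that[of "m + m * N"])
    fix P
    obtain C where C: "C \<ge> 0" "\<And>bs z. bs \<in> lists Basis \<Longrightarrow> length bs \<le> N \<Longrightarrow> (1 + norm z) ^ P * norm (iter_deriv bs (inv_fourier \<psi>) z) \<le> C"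
      by (rule schwartz_uniform[OF inv_fourier_schwartz[OF \<psi>], of N P]) (rule that)
    have "(1 + 2 ^ k * norm z) ^ P * norm (iter_deriv bs (kern M \<psi> k) z) \<le> C * 2 ^ (k * (m + m * N))"
      if bs: "bs \<in> lists Basis" "length bs \<le> N" for k bs z
    proof -
      let ?E = "aniso_dilation M (2 powr real k)"
      define p where "p = (\<Prod>b\<leftarrow>bs. (2 powr real k) powr (M \<bullet> b))"
      have "p \<ge> 0 \<and> p \<le> (2 ^ (k * m)) ^ length bs"
        unfolding p_def
      proof (rule prod_list_le_power)
        fix b assume "b \<in> set bs"
        then have "b \<in> Basis" using bs by auto
        then have "(2 powr real k) powr (M \<bullet> b) \<le> 2 powr (real k * real m)"
          unfolding powr_powr using mb by (intro powr_mono mult_left_mono) auto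
        then show "0 \<le> (2 powr real k) powr (M \<bullet> b) \<and> (2 powr real k) powr (M \<bullet> b) \<le> 2 ^ (k * m)"
          by (simp flip: powr_realpow)
      qed
      moreover have "((2::real) ^ (k * m)) ^ length bs \<le> (2 ^ (k * m)) ^ N"
        using bs(2) by (intro power_increasing) auto
      ultimately have p: "p \<ge> 0" "p \<le> (2 ^ (k * m)) ^ N" by auto
      have sm: "smooth (inv_fourier \<psi>)" by (rule schwartz_smooth[OF inv_fourier_schwartz[OF \<psi>]])
      have "kern M \<psi> k = (\<lambda>x. of_real (jacobian M k) * inv_fourier \<psi> (0 + ?E x))"
        using kern_eq[OF \<psi>] by auto
      then have "iter_deriv bs (kern M \<psi> k) z = of_real (jacobian M k) * (of_real p * iter_deriv bs (inv_fourier \<psi>) (?E z))"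
        using iter_deriv_cmult[OF smooth_affine[OF diagonal_map_aniso sm] bs(1), of _ 0]
          iter_deriv_affine[OF diagonal_map_aniso sm bs(1), of 0]
        by (simp add: p_def)
      then have "(1 + 2 ^ k * norm z) ^ P * norm (iter_deriv bs (kern M \<psi> k) z) =
          (jacobian M k * p) * ((1 + 2 ^ k * norm z) ^ P * norm (iter_deriv bs (inv_fourier \<psi>) (?E z)))"
        using p(1) by (simp add: norm_mult jacobian_def mult_ac)
      also have "\<dots> \<le> (2 ^ (k * m) * (2 ^ (k * m)) ^ N) * C"
      proof (rule mult_mono)
        show "jacobian M k * p \<le> 2 ^ (k * m) * (2 ^ (k * m)) ^ N"
          using jac p by (intro mult_mono) auto
        have "(1 + 2 ^ k * norm z) ^ P * norm (iter_deriv bs (inv_fourier \<psi>) (?E z)) \<le>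
            (1 + norm (?E z)) ^ P * norm (iter_deriv bs (inv_fourier \<psi>) (?E z))"
          using aniso_dilation_norm_ge[OF M] by (intro mult_right_mono power_mono add_left_mono) auto
        also have "\<dots> \<le> C" by (rule C(2)[OF bs])
        finally show "(1 + 2 ^ k * norm z) ^ P * norm (iter_deriv bs (inv_fourier \<psi>) (?E z)) \<le> C" .
      qed auto
      also have "2 ^ (k * m) * (2 ^ (k * m)) ^ N = (2::real) ^ (k * (m + m * N))"
        by (simp add: power_mult[symmetric] power_add[symmetric] algebra_simps)
      finally show ?thesis by (simp add: mult.commute)
    qed
    then show "\<exists>C\<ge>0. \<forall>k bs z. bs \<in> lists Basis \<longrightarrow> length bs \<le> N \<longrightarrow>
      (1 + 2 ^ k * norm z) ^ P * norm (iter_deriv bs (kern M \<psi> k) z) \<le> C * 2 ^ (k * (m + m * N))"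
      using C(1) by blast
  qed
qed

text \<open>A functional of order N sees only the N-th seminorm of the translated kernel. The weight
  at y is moved to x - y, where |x - y| \<le> 2^k |x - y| makes the kernel bound with P = N
  applicable.\<close>

lemma low_freq_growth:
  fixes M :: "real^'n"
  assumes \<Psi>: "LP_generator \<Psi>" and M: "weight M" and u: "schwartz_functional u" and \<psi>: "\<psi> \<in> test_functions UNIV"
    and R: "R \<ge> 0"
  obtains A :: nat and C where "C \<ge> 0" "\<And>k x. norm x \<le> R \<Longrightarrow> norm (low_freq M \<psi> k u x) \<le> C * 2 ^ (k * A)"
proof -
  obtain Cu N where Cu: "Cu \<ge> 0" "\<And>\<phi> B. \<phi> \<in> schwartz \<Longrightarrow> seminorm_le N \<phi> B \<Longrightarrow> norm (u \<phi>) \<le> Cu * B"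
    by (rule schwartz_functionalE[OF u]) (rule that)
  obtain A where A: "\<And>P. \<exists>C\<ge>0. \<forall>k bs z. bs \<in> lists Basis \<longrightarrow> length bs \<le> N \<longrightarrow>
    (1 + 2 ^ k * norm z) ^ P * norm (iter_deriv bs (kern M \<psi> k) z) \<le> C * 2 ^ (k * A)"
    by (rule kern_bound[OF M \<psi>, of N]) (rule that)
  obtain C where C: "C \<ge> 0" "\<forall>k bs z. bs \<in> lists Basis \<longrightarrow> length bs \<le> N \<longrightarrow>
    (1 + 2 ^ k * norm z) ^ N * norm (iter_deriv bs (kern M \<psi> k) z) \<le> C * 2 ^ (k * A)"
    using A[of N] by blast
  show ?thesis
  proof (rule that)
    show "0 \<le> Cu * ((1 + R) ^ N * C)" using Cu(1) C(1) R by simp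
    fix k and x :: "real^'n" assume x: "norm x \<le> R"
    have "seminorm_le N (\<lambda>y. kern M \<psi> k (x - y)) ((1 + R) ^ N * (C * 2 ^ (k * A)))"
    proof (rule seminorm_leI)
      fix bs :: "(real^'n) list" and y :: "real^'n" assume bs: "bs \<in> lists Basis" "length bs \<le> N"
      have "(1 + norm y) ^ N * norm (iter_deriv bs (\<lambda>y. kern M \<psi> k (x - y)) y) \<le>
          (1 + norm x) ^ N * ((1 + norm (x - y)) ^ N * norm (iter_deriv bs (kern M \<psi> k) (x - y)))"
        by (rule weighted_reflect_le[OF schwartz_smooth[OF kern_schwartz[OF \<psi>]] bs(1)])
      also have "\<dots> \<le> (1 + R) ^ N * (C * 2 ^ (k * A))"
      proof (rule mult_mono)
        have "1 * norm (x - y) \<le> 2 ^ k * norm (x - y)" by (intro mult_right_mono) auto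
        then have "(1 + norm (x - y)) ^ N * norm (iter_deriv bs (kern M \<psi> k) (x - y)) \<le>
            (1 + 2 ^ k * norm (x - y)) ^ N * norm (iter_deriv bs (kern M \<psi> k) (x - y))"
          by (intro mult_right_mono power_mono) auto
        also have "\<dots> \<le> C * 2 ^ (k * A)" using C(2) bs by blast
        finally show "(1 + norm (x - y)) ^ N * norm (iter_deriv bs (kern M \<psi> k) (x - y)) \<le> C * 2 ^ (k * A)" .
      qed (use x R in \<open>auto intro!: power_mono\<close>)
      finally show "(1 + norm y) ^ N * norm (iter_deriv bs (\<lambda>y. kern M \<psi> k (x - y)) y) \<le> (1 + R) ^ N * (C * 2 ^ (k * A))" .
    qed
    then have "norm (low_freq M \<psi> k u x) \<le> Cu * ((1 + R) ^ N * (C * 2 ^ (k * A)))"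
      unfolding low_freq_eq[OF \<Psi> u \<psi>] by (rule Cu(2)[OF schwartz_reflect[OF kern_schwartz[OF \<psi>]]])
    then show "norm (low_freq M \<psi> k u x) \<le> Cu * ((1 + R) ^ N * C) * 2 ^ (k * A)" by (simp add: mult_ac)
  qed
qed

text \<open>Where \<open>u\<close> vanishes, only the part of the kernel away from the origin contributes, and that part
  is rapidly decreasing in \<open>k\<close>.\<close>

lemma low_freq_decay:
  fixes M :: "real^'n"
  assumes \<Psi>: "LP_generator \<Psi>" and M: "weight M" and u: "schwartz_functional u" and \<psi>: "\<psi> \<in> test_functions UNIV"
    and 0: "\<And>\<phi>. \<phi> \<in> test_functions \<Omega> \<Longrightarrow> u \<phi> = 0" and \<Omega>: "open \<Omega>" and K: "compact K" "K \<subseteq> \<Omega>"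
  obtains C where "C \<ge> 0" "\<And>k x. x \<in> K \<Longrightarrow> norm (low_freq M \<psi> k u x) * 2 ^ (k * B) \<le> C"
proof -
  obtain Cu N where Cu: "Cu \<ge> 0" "\<And>\<phi> B. \<phi> \<in> schwartz \<Longrightarrow> seminorm_le N \<phi> B \<Longrightarrow> norm (u \<phi>) \<le> Cu * B"
    by (rule schwartz_functionalE[OF u]) (rule that)
  obtain A where A: "\<And>P. \<exists>C\<ge>0. \<forall>k bs z. bs \<in> lists Basis \<longrightarrow> length bs \<le> N \<longrightarrow>
    (1 + 2 ^ k * norm z) ^ P * norm (iter_deriv bs (kern M \<psi> k) z) \<le> C * 2 ^ (k * A)"
    by (rule kern_bound[OF M \<psi>, of N]) (rule that)
  \<comment> \<open>On |z| \<ge> \<delta> the additional weight of order Q is at least (2^k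
    \<delta>)^Q: A powers of 2^k absorb the growth of the kernel, the other B give the
    decay.\<close>
  define Q where "Q = A + B"
  obtain C where C: "C \<ge> 0" "\<forall>k bs z. bs \<in> lists Basis \<longrightarrow> length bs \<le> N \<longrightarrow>
    (1 + 2 ^ k * norm z) ^ (N + Q) * norm (iter_deriv bs (kern M \<psi> k) z) \<le> C * 2 ^ (k * A)"
    using A[of "N + Q"] by blast
  obtain e where e: "e > 0" "(\<Union>x\<in>K. cball x e) \<subseteq> \<Omega>"
    using compact_subset_open_imp_cball_epsilon_subset[OF K(1) \<Omega> K(2)] by blast
  \<comment> \<open>\<beta> is supported in radius 2 \<delta> = e, so the near part of the kernel,
    translated to a point x of K, is a test function on \<Omega>.\<close>
  define \<delta> where "\<delta> = e / 2"
  have \<delta>: "\<delta> > 0" using e by (simp add: \<delta>_def)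
  obtain \<beta> :: "real^'n \<Rightarrow> complex" where \<beta>: "\<beta> \<in> test_functions UNIV" "\<And>x. dist 0 x \<le> \<delta> \<Longrightarrow> \<beta> x = 1" "\<And>x. dist 0 x \<ge> 2 * \<delta> \<Longrightarrow> \<beta> x = 0"
    by (rule bump_function[OF \<Psi> \<delta>, of 0]) (rule that)
  obtain C\<beta> where C\<beta>: "C\<beta> \<ge> 0" "\<And>bs z. bs \<in> lists Basis \<Longrightarrow> length bs \<le> N \<Longrightarrow> (1 + norm z) ^ 0 * norm (iter_deriv bs \<beta> z) \<le> C\<beta>"
    by (rule schwartz_uniform[OF test_functions_schwartz[OF \<beta>(1)], of N 0]) (rule that)
  have "bounded K" by (rule compact_imp_bounded[OF K(1)])
  then obtain R where R: "\<And>x. x \<in> K \<Longrightarrow> norm x \<le> R" by (auto simp: bounded_iff)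
  define S where "S = max R 0"
  have S: "S \<ge> 0" "norm x \<le> S" if "x \<in> K" for x using R[OF that] by (auto simp: S_def)
  have S0: "S \<ge> 0" by (simp add: S_def)
  define far where "far k = (\<lambda>z. kern M \<psi> k z - \<beta> z * kern M \<psi> k z)" for k
  have sm: "smooth (kern M \<psi> k)" "smooth \<beta>" for k
    using schwartz_smooth[OF kern_schwartz[OF \<psi>]] \<beta>(1) test_functions_smooth by auto
  have near: "(\<lambda>z. \<beta> z * kern M \<psi> k z) \<in> test_functions UNIV" for k
    using test_functions_mult[OF \<beta>(1) sm(1)] by (simp add: mult.commute)
  have far: "far k \<in> schwartz" for k
    unfolding far_def by (intro schwartz_diff kern_schwartz \<psi> test_functions_schwartz[OF near])
  define F where "F = (1 + 2 ^ N * C\<beta>) * (C / \<delta> ^ Q)"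
  have F: "F \<ge> 0" using C(1) C\<beta>(1) \<delta> by (simp add: F_def)
  have farbound: "(1 + norm z) ^ N * norm (iter_deriv bs (far k) z) \<le> F / 2 ^ (k * B)"
    if bs: "bs \<in> lists Basis" "length bs \<le> N" for k bs z
  proof (cases "norm z < \<delta>")
    case True
    \<comment> \<open>Here \<beta> = 1 in a whole neighbourhood of z, so \<open>far k\<close> and
      its derivatives vanish.\<close>
    have "iter_deriv bs (far k) z = iter_deriv bs (\<lambda>_. 0) z"
      by (rule iter_deriv_cong_open[of "ball 0 \<delta>"]) (use True \<beta>(2) in \<open>auto simp: far_def\<close>)
    then show ?thesis using F by simp
  next
    case False
    define w where "w = (1 + 2 ^ k * norm z) ^ (N + Q)"
    have w: "w > 0" unfolding w_def by (intro zero_less_power add_pos_nonneg) auto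
    define mx where "mx = C * 2 ^ (k * A) / w"
    have mx: "norm (iter_deriv cs (kern M \<psi> k) z) \<le> mx" if "cs \<in> lists Basis" "length cs \<le> N" for cs
    proof -
      have "w * norm (iter_deriv cs (kern M \<psi> k) z) \<le> C * 2 ^ (k * A)"
        using C(2) that unfolding w_def by blast
      then show ?thesis using w by (simp add: mx_def pos_le_divide_eq mult.commute)
    qed
    have C\<beta>': "norm (iter_deriv cs \<beta> z) \<le> C\<beta>" if "cs \<in> lists Basis" "length cs \<le> N" for cs
      using C\<beta>(2)[OF that, of z] by simp
    have mx0: "mx \<ge> 0" using C(1) w by (simp add: mx_def)
    have prod: "norm (iter_deriv bs (\<lambda>z. \<beta> z * kern M \<psi> k z) z) \<le> 2 ^ length bs * (C\<beta> * mx)"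
      by (rule iter_deriv_mult_bound[OF sm(2,1) bs C\<beta>' mx])
    have "iter_deriv bs (far k) z = iter_deriv bs (kern M \<psi> k) z - iter_deriv bs (\<lambda>z. \<beta> z * kern M \<psi> k z) z"
      unfolding far_def using sm by (simp add: iter_deriv_diff smooth_mult bs)
    also have "norm \<dots> \<le> mx + 2 ^ length bs * (C\<beta> * mx)"
      by (rule order_trans[OF norm_triangle_ineq4 add_mono[OF mx[OF bs] prod]])
    also have "2 ^ length bs * (C\<beta> * mx) \<le> 2 ^ N * (C\<beta> * mx)"
      using bs C\<beta>(1) mx0 by (intro mult_right_mono power_increasing) auto
    finally have le: "norm (iter_deriv bs (far k) z) \<le> (1 + 2 ^ N * C\<beta>) * mx" by (simp add: algebra_simps)
    have "(1 + norm z) ^ N * (2 ^ k * \<delta>) ^ Q \<le> w"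
      unfolding w_def power_add
    proof (intro mult_mono power_mono)
      have "1 * norm z \<le> 2 ^ k * norm z" by (intro mult_right_mono) auto
      then show "1 + norm z \<le> 1 + 2 ^ k * norm z" by simp
      have "2 ^ k * \<delta> \<le> 2 ^ k * norm z" using False by (intro mult_left_mono) auto
      then show "2 ^ k * \<delta> \<le> 1 + 2 ^ k * norm z" by linarith
    qed (use \<delta> in auto)
    then have "(1 + norm z) ^ N * (2 ^ k * \<delta>) ^ Q * (C * 2 ^ (k * A)) \<le> w * (C * 2 ^ (k * A))"
      using C(1) by (intro mult_right_mono) auto
    then have "(1 + norm z) ^ N * mx \<le> C * 2 ^ (k * A) / (2 ^ k * \<delta>) ^ Q"
      using w \<delta> by (simp add: mx_def field_simps)
    also have "(2 ^ k * \<delta>) ^ Q = 2 ^ (k * A) * 2 ^ (k * B) * \<delta> ^ Q"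
      by (simp add: power_mult_distrib Q_def power_mult[symmetric] power_add[symmetric] distrib_left)
    also have "C * 2 ^ (k * A) / (2 ^ (k * A) * 2 ^ (k * B) * \<delta> ^ Q) = C / \<delta> ^ Q / 2 ^ (k * B)"
      by simp
    finally have le2: "(1 + norm z) ^ N * mx \<le> C / \<delta> ^ Q / 2 ^ (k * B)" .
    have "(1 + norm z) ^ N * norm (iter_deriv bs (far k) z) \<le> (1 + norm z) ^ N * ((1 + 2 ^ N * C\<beta>) * mx)"
      using le by (intro mult_left_mono) auto
    also have "\<dots> = (1 + 2 ^ N * C\<beta>) * ((1 + norm z) ^ N * mx)" by simp
    also have "\<dots> \<le> (1 + 2 ^ N * C\<beta>) * (C / \<delta> ^ Q / 2 ^ (k * B))"
      using le2 C\<beta>(1) by (intro mult_left_mono) auto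
    finally show ?thesis by (simp add: F_def)
  qed
  show ?thesis
  proof (rule that)
    show "0 \<le> Cu * ((1 + S) ^ N * F)" using Cu(1) F S0 by simp
    fix k and x :: "real^'n" assume x: "x \<in> K"
    have "(\<lambda>y. \<beta> (x - y) * kern M \<psi> k (x - y)) \<in> test_functions \<Omega>"
    proof (rule test_functionsI)
      show "smooth (\<lambda>y. \<beta> (x - y) * kern M \<psi> k (x - y))"
        by (intro smooth_mult smooth_reflect sm)
      show "compact (cball x (2 * \<delta>))" by simp
      show "cball x (2 * \<delta>) \<subseteq> \<Omega>" using e(2) x by (auto simp: \<delta>_def)
      fix y assume "y \<notin> cball x (2 * \<delta>)"
      then have "2 * \<delta> \<le> dist 0 (x - y)" by (simp add: dist_norm norm_minus_commute)
      then show "\<beta> (x - y) * kern M \<psi> k (x - y) = 0" using \<beta>(3) by simp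
    qed
    then have n0: "u (\<lambda>y. \<beta> (x - y) * kern M \<psi> k (x - y)) = 0" by (rule 0)
    have "u (\<lambda>y. far k (x - y)) = u (\<lambda>y. kern M \<psi> k (x - y)) - u (\<lambda>y. \<beta> (x - y) * kern M \<psi> k (x - y))"
      unfolding far_def
      using schwartz_reflect[OF test_functions_schwartz[OF near[of k]], of x]
      by (intro schwartz_functional_linear(3)[OF u] schwartz_reflect[OF kern_schwartz[OF \<psi>]])
    then have "low_freq M \<psi> k u x = u (\<lambda>y. far k (x - y))"
      by (simp add: low_freq_eq[OF \<Psi> u \<psi>] n0)
    also have "norm \<dots> \<le> Cu * ((1 + S) ^ N * (F / 2 ^ (k * B)))"
    proof (rule Cu(2)[OF schwartz_reflect[OF far]], rule seminorm_leI)
      fix bs :: "(real^'n) list" and y :: "real^'n" assume bs: "bs \<in> lists Basis" "length bs \<le> N"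
      have "(1 + norm y) ^ N * norm (iter_deriv bs (\<lambda>y. far k (x - y)) y) \<le>
          (1 + norm x) ^ N * ((1 + norm (x - y)) ^ N * norm (iter_deriv bs (far k) (x - y)))"
        by (rule weighted_reflect_le[OF schwartz_smooth[OF far] bs(1)])
      also have "\<dots> \<le> (1 + S) ^ N * (F / 2 ^ (k * B))"
        using S(2)[OF x] S0 by (intro mult_mono power_mono farbound bs) auto
      finally show "(1 + norm y) ^ N * norm (iter_deriv bs (\<lambda>y. far k (x - y)) y) \<le> (1 + S) ^ N * (F / 2 ^ (k * B))" .
    qed
    finally show "norm (low_freq M \<psi> k u x) * 2 ^ (k * B) \<le> Cu * ((1 + S) ^ N * F)"
      by (simp add: field_simps)
  qed
qed

text \<open>On the support of \<phi> the second factor grows at most like 2^(kA) for some A, while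
  the first, belonging to a functional that vanishes on \<Omega>, decays like 2^(-k(A + 1)); this
  leaves 2^(-k).\<close>

lemma low_freq_product_vanishes:
  fixes M :: "real^'n"
  assumes \<Psi>: "LP_generator \<Psi>" and M: "weight M" and u: "schwartz_functional u" and v: "schwartz_functional v"
    and \<psi>: "\<psi> \<in> test_functions UNIV" and 0: "\<And>\<phi>. \<phi> \<in> test_functions \<Omega> \<Longrightarrow> u \<phi> = 0" and \<Omega>: "open \<Omega>"
    and \<phi>: "\<phi> \<in> test_functions \<Omega>"
  shows "(\<lambda>k. LINT x|lborel. low_freq M \<psi> k u x * low_freq M \<psi> k v x * \<phi> x) \<longlonglongrightarrow> 0"
proof -
  obtain K where K: "smooth \<phi>" "compact K" "K \<subseteq> \<Omega>" "\<And>x bs. x \<notin> K \<Longrightarrow> iter_deriv bs \<phi> x = 0" "\<And>x. x \<notin> K \<Longrightarrow> \<phi> x = 0"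
    by (rule test_functionsE[OF \<phi>]) (rule that)
  have "bounded K" by (rule compact_imp_bounded[OF K(2)])
  then obtain R where R: "\<forall>x\<in>K. norm x \<le> R" by (auto simp: bounded_iff)
  have S0: "max R 0 \<ge> 0" by simp
  obtain A :: nat and C where C: "C \<ge> 0" "\<And>k x. norm x \<le> max R 0 \<Longrightarrow> norm (low_freq M \<psi> k v x) \<le> C * 2 ^ (k * A)"
    by (rule low_freq_growth[OF \<Psi> M v \<psi> S0]) (rule that)
  obtain C' where C': "C' \<ge> 0" "\<And>k x. x \<in> K \<Longrightarrow> norm (low_freq M \<psi> k u x) * 2 ^ (k * (A + 1)) \<le> C'"
    by (rule low_freq_decay[OF \<Psi> M u \<psi> _ \<Omega> K(2,3), where B = "A + 1"], erule 0, rule that)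
  have bound: "norm (LINT x|lborel. low_freq M \<psi> k u x * low_freq M \<psi> k v x * \<phi> x) \<le>
      (C' * C * (LINT x|lborel. norm (\<phi> x))) * (1 / 2) ^ k" for k
  proof -
    have "norm (LINT x|lborel. low_freq M \<psi> k u x * low_freq M \<psi> k v x * \<phi> x) \<le>
        (LINT x|lborel. (C' * C * (1 / 2) ^ k) * norm (\<phi> x))"
    proof (rule Bochner_Integration.integral_norm_bound_integral)
      show "integrable lborel (\<lambda>x. low_freq M \<psi> k u x * low_freq M \<psi> k v x * \<phi> x)"
        by (intro integrable_continuous_mult_test[OF _ \<phi>] continuous_on_mult low_freq_continuous[OF \<Psi>] u v \<psi>)
      show "integrable lborel (\<lambda>x. (C' * C * (1 / 2) ^ k) * norm (\<phi> x))"
        using integrable_test[OF \<phi>] by simp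
      fix x
      show "norm (low_freq M \<psi> k u x * low_freq M \<psi> k v x * \<phi> x) \<le> (C' * C * (1 / 2) ^ k) * norm (\<phi> x)"
      proof (cases "x \<in> K")
        case True
        have "norm (low_freq M \<psi> k u x) \<le> C' / 2 ^ (k * (A + 1))"
          using C'(2)[OF True, of k] by (simp add: pos_le_divide_eq)
        moreover have "norm (low_freq M \<psi> k v x) \<le> C * 2 ^ (k * A)" using R True by (intro C(2)) force
        ultimately have "norm (low_freq M \<psi> k u x) * norm (low_freq M \<psi> k v x) \<le> (C' / 2 ^ (k * (A + 1))) * (C * 2 ^ (k * A))"
          using C'(1) by (intro mult_mono) auto
        also have "\<dots> = C' * C * (1 / 2) ^ k" by (simp add: power_add power_mult field_simps)
        finally show ?thesis by (simp only: norm_mult) (intro mult_right_mono, auto)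
      qed (simp add: K(5))
    qed
    then show ?thesis by (simp add: mult_ac)
  qed
  show ?thesis
  proof (rule Lim_null_comparison[OF always_eventually[rule_format, OF bound]])
    have "(\<lambda>k. (1 / 2 :: real) ^ k) \<longlonglongrightarrow> 0" by (rule LIMSEQ_realpow_zero) auto
    then show "(\<lambda>k. (C' * C * (LINT x|lborel. norm (\<phi> x))) * (1 / 2) ^ k) \<longlonglongrightarrow> 0"
      by (rule tendsto_mult_right_zero)
  qed
qed

text \<open>Low frequency parts are additive in the distribution, and u v - u' v' = (u - u') v + (v
  - v') u'. In each term one factor belongs to a functional that vanishes on \<Omega>.\<close>

lemma low_freq_product_local:
  fixes M :: "real^'n"
  assumes \<Psi>: "LP_generator \<Psi>" and M: "weight M"
    and sf: "schwartz_functional u" "schwartz_functional u'" "schwartz_functional v" "schwartz_functional v'"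
    and \<psi>: "\<psi> \<in> test_functions UNIV" and \<Omega>: "open \<Omega>"
    and u: "\<And>\<phi>. \<phi> \<in> test_functions \<Omega> \<Longrightarrow> u \<phi> = u' \<phi>" and v: "\<And>\<phi>. \<phi> \<in> test_functions \<Omega> \<Longrightarrow> v \<phi> = v' \<phi>"
    and \<phi>: "\<phi> \<in> test_functions \<Omega>"
  shows "(\<lambda>k. (LINT x|lborel. low_freq M \<psi> k u x * low_freq M \<psi> k v x * \<phi> x) -
    (LINT x|lborel. low_freq M \<psi> k u' x * low_freq M \<psi> k v' x * \<phi> x)) \<longlonglongrightarrow> 0"
proof -
  let ?L = "low_freq M \<psi>"
  define du where "du = (\<lambda>\<phi>. u \<phi> - u' \<phi>)"
  define dv where "dv = (\<lambda>\<phi>. v \<phi> - v' \<phi>)"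
  have d: "schwartz_functional du" "schwartz_functional dv"
    unfolding du_def dv_def by (intro schwartz_functional_diff sf)+
  have int: "integrable lborel (\<lambda>x. ?L k a x * ?L k b x * \<phi> x)"
    if "schwartz_functional a" "schwartz_functional b" for k a b
    using that by (intro integrable_continuous_mult_test[OF _ \<phi>] continuous_on_mult low_freq_continuous[OF \<Psi>] \<psi>)
  have eq: "(LINT x|lborel. ?L k u x * ?L k v x * \<phi> x) - (LINT x|lborel. ?L k u' x * ?L k v' x * \<phi> x) =
      (LINT x|lborel. ?L k du x * ?L k v x * \<phi> x) + (LINT x|lborel. ?L k dv x * ?L k u' x * \<phi> x)" for k
  proof -
    have "?L k u x = ?L k du x + ?L k u' x" "?L k v x = ?L k dv x + ?L k v' x" for x
      unfolding low_freq_eq[OF \<Psi> d(1) \<psi>] low_freq_eq[OF \<Psi> d(2) \<psi>] low_freq_eq[OF \<Psi> sf(1) \<psi>] low_freq_eq[OF \<Psi> sf(2) \<psi>]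
        low_freq_eq[OF \<Psi> sf(3) \<psi>] low_freq_eq[OF \<Psi> sf(4) \<psi>] by (simp_all add: du_def dv_def)
    then show ?thesis
      by (subst Bochner_Integration.integral_diff[symmetric, OF int int],
          (intro sf)+, subst Bochner_Integration.integral_add[symmetric, OF int int], (intro sf d)+)
         (simp add: ring_distribs mult_ac add_ac)
  qed
  have "(\<lambda>k. (LINT x|lborel. ?L k du x * ?L k v x * \<phi> x) + (LINT x|lborel. ?L k dv x * ?L k u' x * \<phi> x)) \<longlonglongrightarrow> 0 + 0"
    using u v by (intro tendsto_add low_freq_product_vanishes[OF \<Psi> M _ _ \<psi> _ \<Omega> \<phi>] d sf) (simp_all add: du_def dv_def)
  then show ?thesis unfolding eq by simp
qed

section \<open>Products on open sets\<close>

text \<open>\<open>product_limit\<close> quantifies over all cut-offs; its limit is determined only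
  because there is one.\<close>

lemma cutoffs_nonempty:
  fixes \<Psi> :: "real \<Rightarrow> complex"
  assumes "LP_generator \<Psi>" obtains \<psi> :: "real^'n \<Rightarrow> complex" where "\<psi> \<in> cutoffs"
proof -
  obtain \<beta> :: "real^'n \<Rightarrow> complex" where \<beta>: "\<beta> \<in> test_functions UNIV" "\<And>x. dist 0 x \<le> 1 \<Longrightarrow> \<beta> x = 1" "\<And>x. dist 0 x \<ge> 2 * 1 \<Longrightarrow> \<beta> x = 0"
    by (rule bump_function[OF assms zero_less_one, of 0]) (rule that)
  have "\<forall>\<^sub>F \<xi> in nhds 0. \<beta> \<xi> = 1"
    unfolding eventually_nhds by (rule exI[of _ "ball 0 1"]) (auto intro!: \<beta>(2) less_imp_le)
  then show ?thesis using \<beta>(1) that by (auto simp: cutoffs_def)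
qed

lemma cutoffs_test: "\<psi> \<in> cutoffs \<Longrightarrow> \<psi> \<in> test_functions UNIV"
  by (simp add: cutoffs_def)

lemma restr_regular_low_freq:
  assumes \<Psi>: "LP_generator \<Psi>" and "schwartz_functional u" "schwartz_functional v"
    and "\<psi> \<in> test_functions UNIV" and \<phi>: "\<phi> \<in> test_functions \<Omega>"
  shows "restr \<Omega> (regular_dist UNIV (\<lambda>x. low_freq M \<psi> k u x * low_freq M \<psi> k v x)) \<phi> =
    (LINT x|lborel. low_freq M \<psi> k u x * low_freq M \<psi> k v x * \<phi> x)"
proof -
  have "(\<lambda>x. low_freq M \<psi> k u x * low_freq M \<psi> k v x) \<in> borel_measurable borel"
    by (intro borel_measurable_continuous_onI continuous_on_mult low_freq_continuous[OF \<Psi>] assms)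
  then show ?thesis using \<phi> by (simp add: restr_def regular_dist_UNIV test_functions_UNIV)
qed

lemma restr_eqD: "restr \<Omega> u = restr \<Omega> v \<Longrightarrow> \<phi> \<in> test_functions \<Omega> \<Longrightarrow> u \<phi> = v \<phi>"
  by (metis restr_def)

lemma distributions_outside: "w \<in> distributions \<Omega> \<Longrightarrow> \<phi> \<notin> test_functions \<Omega> \<Longrightarrow> w \<phi> = 0"
  unfolding distributions_def linear_functional_on_def by blast

text \<open>Two choices of extensions give products that differ on \<Omega> by a null sequence, so
  the limits agree on test functions; on all other functions both vanish by the convention in
  \<open>distributions\<close>. This is what makes \<open>pi_on\<close> meaningful.\<close>

lemma product_limit_on_unique:
  fixes M :: "real^'n"
  assumes \<Psi>: "LP_generator \<Psi>" and M: "weight M" and \<Omega>: "open \<Omega>"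
    and "product_limit_on M \<Omega> u v w" "product_limit_on M \<Omega> u v w'"
  shows "w = w'"
proof
  fix \<phi>
  obtain u1 v1 where 1: "restr \<Omega> u1 = u" "restr \<Omega> v1 = v" "product_limit M \<Omega> u1 v1 w"
    using assms(4) unfolding product_limit_on_def by blast
  obtain u2 v2 where 2: "restr \<Omega> u2 = u" "restr \<Omega> v2 = v" "product_limit M \<Omega> u2 v2 w'"
    using assms(5) unfolding product_limit_on_def by blast
  obtain \<psi> :: "real^'n \<Rightarrow> complex" where \<psi>: "\<psi> \<in> cutoffs" by (rule cutoffs_nonempty[OF \<Psi>])
  note \<psi>' = cutoffs_test[OF \<psi>]
  have sf: "schwartz_functional u1" "schwartz_functional v1" "schwartz_functional u2" "schwartz_functional v2"
    using 1(3) 2(3) unfolding product_limit_def by (auto intro: tempered_schwartz_functional)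
  have w: "w \<in> distributions \<Omega>" "w' \<in> distributions \<Omega>"
    using 1(3) 2(3) \<psi> unfolding product_limit_def tendsto_dist_def by blast+
  show "w \<phi> = w' \<phi>"
  proof (cases "\<phi> \<in> test_functions \<Omega>")
    case True
    let ?I = "\<lambda>u v k. LINT x|lborel. low_freq M \<psi> k u x * low_freq M \<psi> k v x * \<phi> x"
    have "?I u1 v1 \<longlonglongrightarrow> w \<phi>"
      using 1(3) \<psi> True restr_regular_low_freq[OF \<Psi> sf(1,2) \<psi>' True]
      unfolding product_limit_def tendsto_dist_def by fastforce
    moreover have "?I u2 v2 \<longlonglongrightarrow> w' \<phi>"
      using 2(3) \<psi> True restr_regular_low_freq[OF \<Psi> sf(3,4) \<psi>' True]
      unfolding product_limit_def tendsto_dist_def by fastforce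
    ultimately have "(\<lambda>k. ?I u1 v1 k - ?I u2 v2 k) \<longlonglongrightarrow> w \<phi> - w' \<phi>" by (rule tendsto_diff)
    moreover have "(\<lambda>k. ?I u1 v1 k - ?I u2 v2 k) \<longlonglongrightarrow> 0"
      by (rule low_freq_product_local[OF \<Psi> M sf(1,3,2,4) \<psi>' \<Omega> _ _ True])
         (use 1 2 restr_eqD in metis)+
    ultimately show ?thesis using LIMSEQ_unique by fastforce
  qed (use w distributions_outside in metis)
qed

lemma pi_on_eqI:
  fixes M :: "real^'n"
  assumes "LP_generator \<Psi>" "weight M" "open \<Omega>" "product_limit M \<Omega> u v w"
  shows "pi_on_defined M \<Omega> (restr \<Omega> u) (restr \<Omega> v)" "pi_on M \<Omega> (restr \<Omega> u) (restr \<Omega> v) = w"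
proof -
  have *: "product_limit_on M \<Omega> (restr \<Omega> u) (restr \<Omega> v) w"
    using assms(4) unfolding product_limit_on_def product_limit_def by blast
  then show "pi_on_defined M \<Omega> (restr \<Omega> u) (restr \<Omega> v)" unfolding pi_on_defined_def by blast
  show "pi_on M \<Omega> (restr \<Omega> u) (restr \<Omega> v) = w"
    unfolding pi_on_def using * product_limit_on_unique[OF assms(1-3)] by blast
qed

section \<open>Boundedness on open sets\<close>

lemma restr_distributions:
  assumes "w \<in> distributions UNIV" shows "restr \<Omega> w \<in> distributions \<Omega>"
proof -
  have lin: "linear_functional_on (test_functions UNIV) w" and
    bd: "\<And>K. compact K \<Longrightarrow> \<exists>C N. \<forall>\<phi>\<in>test_functions UNIV. closure {x. \<phi> x \<noteq> 0} \<subseteq> K \<longrightarrow> norm (w \<phi>) \<le> C * test_seminorm N \<phi>"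
    using assms unfolding distributions_def by auto
  have "linear_functional_on (test_functions \<Omega>) (restr \<Omega> w)"
    using lin unfolding linear_functional_on_def restr_def
    by (simp add: test_functions_add test_functions_cmult test_functions_UNIV)
  moreover have "\<exists>C N. \<forall>\<phi>\<in>test_functions \<Omega>. closure {x. \<phi> x \<noteq> 0} \<subseteq> K \<longrightarrow> norm (restr \<Omega> w \<phi>) \<le> C * test_seminorm N \<phi>"
    if K: "compact K" for K
  proof -
    obtain C N where "\<forall>\<phi>\<in>test_functions UNIV. closure {x. \<phi> x \<noteq> 0} \<subseteq> K \<longrightarrow> norm (w \<phi>) \<le> C * test_seminorm N \<phi>"
      using bd[OF K] by blast
    then have "\<forall>\<phi>\<in>test_functions \<Omega>. closure {x. \<phi> x \<noteq> 0} \<subseteq> K \<longrightarrow> norm (restr \<Omega> w \<phi>) \<le> C * test_seminorm N \<phi>"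
      using test_functions_UNIV by (auto simp: restr_def)
    then show ?thesis by blast
  qed
  ultimately show ?thesis unfolding distributions_def by simp
qed

lemma product_limit_restr:
  assumes "product_limit M UNIV u v w" shows "product_limit M \<Omega> u v (restr \<Omega> w)"
  unfolding product_limit_def
proof (intro conjI ballI)
  show "u \<in> tempered" "v \<in> tempered" using assms unfolding product_limit_def by auto
  fix \<psi> :: "real^'a \<Rightarrow> complex" assume \<psi>: "\<psi> \<in> cutoffs"
  let ?T = "\<lambda>k. regular_dist UNIV (\<lambda>x. low_freq M \<psi> k u x * low_freq M \<psi> k v x)"
  have w: "w \<in> distributions UNIV" and lim: "\<And>\<phi>. \<phi> \<in> test_functions UNIV \<Longrightarrow> (\<lambda>k. restr UNIV (?T k) \<phi>) \<longlonglongrightarrow> w \<phi>"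
    using assms \<psi> unfolding product_limit_def tendsto_dist_def by blast+
  have "(\<lambda>k. restr \<Omega> (?T k) \<phi>) \<longlonglongrightarrow> restr \<Omega> w \<phi>" if "\<phi> \<in> test_functions \<Omega>" for \<phi>
    using lim[OF test_functions_UNIV[OF that]] that test_functions_UNIV[OF that] by (simp add: restr_def)
  then show "tendsto_dist \<Omega> (\<lambda>k. restr \<Omega> (?T k)) (restr \<Omega> w)"
    unfolding tendsto_dist_def using restr_distributions[OF w] by blast
qed

lemma pi_on_restr:
  fixes M :: "real^'n"
  assumes \<Psi>: "LP_generator \<Psi>" and M: "weight M" and \<Omega>: "open \<Omega>" and "pi_defined M u v"
  shows "pi_on_defined M \<Omega> (restr \<Omega> u) (restr \<Omega> v)"
    "pi_on M \<Omega> (restr \<Omega> u) (restr \<Omega> v) = restr \<Omega> (pi_product M u v)"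
proof -
  obtain w where w: "product_limit M UNIV u v w" using assms(4) unfolding pi_defined_def by blast
  \<comment> \<open>The whole space is treated as one of the open sets, so that uniqueness for
    \<open>pi_product\<close> is a case of uniqueness for \<open>pi_on\<close>.\<close>
  have on: "product_limit_on M UNIV (restr UNIV u) (restr UNIV v) w'" if "product_limit M UNIV u v w'" for w'
    using that unfolding product_limit_on_def product_limit_def by blast
  have "pi_product M u v = w"
    unfolding pi_product_def using w product_limit_on_unique[OF \<Psi> M open_UNIV on[OF w] on] by blast
  then show "pi_on_defined M \<Omega> (restr \<Omega> u) (restr \<Omega> v)"
    "pi_on M \<Omega> (restr \<Omega> u) (restr \<Omega> v) = restr \<Omega> (pi_product M u v)"
    using pi_on_eqI[OF \<Psi> M \<Omega> product_limit_restr[OF w]] by auto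
qed

text \<open>Elements of S and T within 1/(n + 1) of the infima are inserted and n tends to
  \<infinity>. Finiteness excludes the product of 0 and \<infinity>, where multiplication in
  \<open>ennreal\<close> is discontinuous.\<close>

lemma ennreal_le_mult_Inf:
  fixes L c :: ennreal
  assumes "S \<noteq> {}" "T \<noteq> {}" "\<And>a. a \<in> S \<Longrightarrow> a < \<infinity>" "\<And>b. b \<in> T \<Longrightarrow> b < \<infinity>" "c < \<infinity>"
    and le: "\<And>a b. a \<in> S \<Longrightarrow> b \<in> T \<Longrightarrow> L \<le> c * a * b"
  shows "L \<le> c * Inf S * Inf T"
proof -
  define x y where "x = Inf S" and "y = Inf T"
  have fin: "x < \<infinity>" "y < \<infinity>"
    unfolding x_def y_def using assms(1-4) by (meson Inf_lower ex_in_conv le_less_trans)+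
  have lt: "z < z + ennreal e" if "z < \<infinity>" "e > 0" for z e
    using that by (cases z) (auto simp: ennreal_plus[symmetric] ennreal_less_iff simp del: ennreal_plus)
  let ?e = "\<lambda>n. ennreal (inverse (real (Suc n)))"
  have e: "?e \<longlonglongrightarrow> 0"
    using tendsto_ennrealI[OF LIMSEQ_inverse_real_of_nat] by simp
  have "L \<le> c * (x + ?e n) * (y + ?e n)" for n
  proof -
    have "x < x + ?e n" by (rule lt[OF fin(1)]) simp
    moreover have "y < y + ?e n" by (rule lt[OF fin(2)]) simp
    ultimately obtain a b where ab: "a \<in> S" "a < x + ?e n" "b \<in> T" "b < y + ?e n"
      unfolding x_def y_def Inf_less_iff by blast
    then have "L \<le> c * a * b" by (intro le)
    also have "\<dots> \<le> c * (x + ?e n) * (y + ?e n)" using ab by (intro mult_mono) auto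
    finally show ?thesis .
  qed
  moreover have "(\<lambda>n. c * (x + ?e n) * (y + ?e n)) \<longlonglongrightarrow> c * (x + 0) * (y + 0)"
    using fin assms(5)
    by (intro tendsto_mult_ennreal tendsto_add e tendsto_const)
       (auto simp: ennreal_mult_eq_top_iff)
  ultimately have "L \<le> c * (x + 0) * (y + 0)"
    by (intro LIMSEQ_le_const) auto
  then show ?thesis by (simp add: x_def y_def)
qed

text \<open>Every pair of extensions of f and g gives an extension of the product with norm at most
  c times the product of their norms. The quasi-norm of the product over \<Omega> does not depend on
  the pair, so both infima can be taken; the constant is the one for the whole space.\<close>

theorem pi_bounded_imp_pi_on_bounded:
  fixes M :: "real^'n"
  assumes \<Psi>: "LP_generator \<Psi>" and M: "weight M" and \<Omega>: "open \<Omega>" and "pi_bounded M \<Psi> A0 A1 A2"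
  shows "pi_on_bounded M \<Psi> \<Omega> A0 A1 A2"
proof -
  obtain c :: real where c: "\<And>u v. u \<in> aniso_space M \<Psi> A0 \<Longrightarrow> v \<in> aniso_space M \<Psi> A1 \<Longrightarrow>
        pi_defined M u v \<and>
        (\<exists>w\<in>aniso_space M \<Psi> A2. restr UNIV w = pi_product M u v \<and>
           space_norm M \<Psi> A2 w \<le> ennreal c * space_norm M \<Psi> A0 u * space_norm M \<Psi> A1 v)"
    using assms(4) unfolding pi_bounded_def by blast
  have key: "pi_on_defined M \<Omega> (restr \<Omega> u) (restr \<Omega> v) \<and>
      (\<exists>w\<in>aniso_space M \<Psi> A2. restr \<Omega> w = pi_on M \<Omega> (restr \<Omega> u) (restr \<Omega> v) \<and>
           space_norm M \<Psi> A2 w \<le> ennreal c * space_norm M \<Psi> A0 u * space_norm M \<Psi> A1 v)"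
    if uv: "u \<in> aniso_space M \<Psi> A0" "v \<in> aniso_space M \<Psi> A1" for u v
  proof -
    obtain w where w: "pi_defined M u v" "w \<in> aniso_space M \<Psi> A2" "restr UNIV w = pi_product M u v"
      "space_norm M \<Psi> A2 w \<le> ennreal c * space_norm M \<Psi> A0 u * space_norm M \<Psi> A1 v"
      using c[OF uv] by blast
    have "restr \<Omega> w = restr \<Omega> (restr UNIV w)"
      using test_functions_UNIV by (auto simp: restr_def fun_eq_iff)
    then show ?thesis using w pi_on_restr[OF \<Psi> M \<Omega> w(1)] by auto
  qed
  have "pi_on_defined M \<Omega> f g \<and> pi_on M \<Omega> f g \<in> aniso_space_on M \<Psi> A2 \<Omega> \<and>
      space_norm_on M \<Psi> A2 \<Omega> (pi_on M \<Omega> f g) \<le>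
        ennreal c * space_norm_on M \<Psi> A0 \<Omega> f * space_norm_on M \<Psi> A1 \<Omega> g"
    if f: "f \<in> aniso_space_on M \<Psi> A0 \<Omega>" and g: "g \<in> aniso_space_on M \<Psi> A1 \<Omega>" for f g
  proof (intro conjI)
    obtain u v where uv: "u \<in> aniso_space M \<Psi> A0" "f = restr \<Omega> u" "v \<in> aniso_space M \<Psi> A1" "g = restr \<Omega> v"
      using f g unfolding aniso_space_on_def by blast
    show "pi_on_defined M \<Omega> f g" using key[OF uv(1,3)] unfolding uv by blast
    obtain w where "w \<in> aniso_space M \<Psi> A2" "restr \<Omega> w = pi_on M \<Omega> f g"
      using key[OF uv(1,3)] unfolding uv by blast
    then show "pi_on M \<Omega> f g \<in> aniso_space_on M \<Psi> A2 \<Omega>"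
      unfolding aniso_space_on_def by (metis imageI)
    let ?S = "{space_norm M \<Psi> A0 w | w. w \<in> aniso_space M \<Psi> A0 \<and> restr \<Omega> w = f}"
    let ?T = "{space_norm M \<Psi> A1 w | w. w \<in> aniso_space M \<Psi> A1 \<and> restr \<Omega> w = g}"
    have "space_norm_on M \<Psi> A2 \<Omega> (pi_on M \<Omega> f g) \<le> ennreal c * Inf ?S * Inf ?T"
    proof (rule ennreal_le_mult_Inf)
      fix a b assume "a \<in> ?S" "b \<in> ?T"
      then obtain u v where *: "u \<in> aniso_space M \<Psi> A0" "f = restr \<Omega> u" "a = space_norm M \<Psi> A0 u"
        "v \<in> aniso_space M \<Psi> A1" "g = restr \<Omega> v" "b = space_norm M \<Psi> A1 v" by blast
      obtain w where w: "w \<in> aniso_space M \<Psi> A2" "restr \<Omega> w = pi_on M \<Omega> f g"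
         "space_norm M \<Psi> A2 w \<le> ennreal c * a * b"
        using key[OF *(1,4)] unfolding * by blast
      have "space_norm_on M \<Psi> A2 \<Omega> (pi_on M \<Omega> f g) \<le> space_norm M \<Psi> A2 w"
        unfolding space_norm_on_def using w by (intro Inf_lower) blast
      then show "space_norm_on M \<Psi> A2 \<Omega> (pi_on M \<Omega> f g) \<le> ennreal c * a * b" using w(3) by (rule order_trans)
    qed (use uv in \<open>auto simp: aniso_space_def\<close>)
    then show "space_norm_on M \<Psi> A2 \<Omega> (pi_on M \<Omega> f g) \<le>
        ennreal c * space_norm_on M \<Psi> A0 \<Omega> f * space_norm_on M \<Psi> A1 \<Omega> g"
      by (simp only: space_norm_on_def)
  qed
  then show ?thesis unfolding pi_on_bounded_def by blast
qed

section \<open>The mass of the regularising kernel\<close>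

lemma integral_pair_mult:
  fixes f :: "'a::euclidean_space \<Rightarrow> complex" and g :: "'b::euclidean_space \<Rightarrow> complex"
  assumes f: "integrable lborel f" and g: "integrable lborel g"
  shows "integrable lborel (\<lambda>p. f (fst p) * g (snd p))"
    and "(LINT p|lborel. f (fst p) * g (snd p)) = (LINT x|lborel. f x) * (LINT y|lborel. g y)"
proof -
  have [measurable]: "f \<in> borel_measurable borel" "g \<in> borel_measurable borel"
    using f g by (auto dest: borel_measurable_integrable)
  have int: "integrable (lborel \<Otimes>\<^sub>M lborel) (\<lambda>p. f (fst p) * g (snd p))"
  proof (rule lborel_pair.Fubini_integrable)
    show "(\<lambda>p. f (fst p) * g (snd p)) \<in> borel_measurable (lborel \<Otimes>\<^sub>M lborel)" by measurable
    show "integrable lborel (\<lambda>x. LINT y|lborel. norm (f (fst (x, y)) * g (snd (x, y))))"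
      using f by (simp add: norm_mult)
    show "AE x in lborel. integrable lborel (\<lambda>y. f (fst (x, y)) * g (snd (x, y)))"
      using g by simp
  qed
  then show "integrable lborel (\<lambda>p. f (fst p) * g (snd p))" by (simp add: lborel_prod)
  show "(LINT p|lborel. f (fst p) * g (snd p)) = (LINT x|lborel. f x) * (LINT y|lborel. g y)"
    using lborel_pair.integral_fst'[OF int] by (simp add: lborel_prod)
qed

section \<open>The Gaussian and its Fourier integral\<close>

definition gauss :: "'a::euclidean_space \<Rightarrow> real" where
  "gauss x = exp (- (norm x)\<^sup>2 / 2)"

lemma gauss_prod: "gauss x = (\<Prod>b\<in>Basis. exp (- (x \<bullet> b)\<^sup>2 / 2))"
proof -
  have "- (norm x)\<^sup>2 / 2 = (\<Sum>b\<in>Basis. - (x \<bullet> b)\<^sup>2 / 2)"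
    unfolding power2_norm_eq_inner euclidean_inner[of x x]
    by (simp add: sum_negf sum_divide_distrib power2_eq_square)
  then show ?thesis by (simp add: gauss_def exp_sum)
qed

lemma gauss_bounds: "0 \<le> gauss x" "gauss x \<le> 1"
  by (simp_all add: gauss_def)

lemma gauss_continuous: "continuous_on S gauss"
  unfolding gauss_def by (intro continuous_intros) auto

lemma gauss_borel [measurable]: "gauss \<in> borel_measurable borel"
  by (rule borel_measurable_continuous_onI[OF gauss_continuous])

text \<open>The integral is the characteristic function of the standard normal distribution, apart
  from the factor \<open>sqrt (2 * pi)\<close> of the density.\<close>

lemma fourier_gauss_1d:
  "integrable lborel (\<lambda>x. exp (\<i> * complex_of_real (t * x)) * of_real (exp (- x\<^sup>2 / 2)))"
  "(LINT x|lborel. exp (\<i> * complex_of_real (t * x)) * of_real (exp (- x\<^sup>2 / 2))) = of_real (sqrt (2 * pi) * exp (- t\<^sup>2 / 2))"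
proof -
  have eq: "exp (\<i> * complex_of_real (t * x)) * of_real (exp (- x\<^sup>2 / 2)) =
      of_real (sqrt (2 * pi)) * (std_normal_density x *\<^sub>R exp (\<i> * complex_of_real (t * x)))" for x
    by (simp add: std_normal_density_def scaleR_conv_of_real del: of_real_mult)
  have int: "integrable lborel (\<lambda>x. std_normal_density x *\<^sub>R exp (\<i> * complex_of_real (t * x)))"
    by (rule Bochner_Integration.integrable_bound[OF integrable_normal_density[of 1 0]]) auto
  then show "integrable lborel (\<lambda>x. exp (\<i> * complex_of_real (t * x)) * of_real (exp (- x\<^sup>2 / 2)))"
    unfolding eq by (rule integrable_mult_right)
  have "char std_normal_distribution t = (LINT x|lborel. std_normal_density x *\<^sub>R exp (\<i> * complex_of_real (t * x)))"
    unfolding char_def by (subst integral_density) auto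
  then show "(LINT x|lborel. exp (\<i> * complex_of_real (t * x)) * of_real (exp (- x\<^sup>2 / 2))) = of_real (sqrt (2 * pi) * exp (- t\<^sup>2 / 2))"
    unfolding eq integral_mult_right_zero char_std_normal_distribution by simp
qed

text \<open>Both the Gaussian and the exponential factor over the coordinates, which leaves the
  one-dimensional integral.\<close>

lemma osc_gauss:
  fixes x :: "real^'n"
  shows "integrable lborel (\<lambda>\<xi>. exp (\<i> * of_real (x \<bullet> \<xi>)) * complex_of_real (gauss \<xi>))"
    and "osc (\<lambda>\<xi>. of_real (gauss \<xi>)) x = of_real (sqrt (2 * pi) ^ CARD('n) * gauss x)"
proof -
  have eq: "exp (\<i> * of_real (x \<bullet> \<xi>)) * complex_of_real (gauss \<xi>) =
      (\<Prod>b\<in>Basis. exp (\<i> * complex_of_real ((x \<bullet> b) * (\<xi> \<bullet> b))) * of_real (exp (- (\<xi> \<bullet> b)\<^sup>2 / 2)))" for \<xi>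
    unfolding gauss_prod of_real_prod prod.distrib
    by (simp add: exp_sum[symmetric] sum_distrib_left[symmetric] euclidean_inner[of x \<xi>])
  show "integrable lborel (\<lambda>\<xi>. exp (\<i> * of_real (x \<bullet> \<xi>)) * complex_of_real (gauss \<xi>))"
    unfolding eq by (rule integrable_prod_Basis(1)[OF fourier_gauss_1d(1)])
  have "osc (\<lambda>\<xi>. of_real (gauss \<xi>)) x = (\<Prod>b\<in>Basis. of_real (sqrt (2 * pi) * exp (- (x \<bullet> b)\<^sup>2 / 2)))"
    unfolding osc_def eq by (simp only: integrable_prod_Basis(2)[OF fourier_gauss_1d(1)] fourier_gauss_1d(2))
  then show "osc (\<lambda>\<xi>. of_real (gauss \<xi>)) x = of_real (sqrt (2 * pi) ^ CARD('n) * gauss x)"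
    by (simp add: gauss_prod prod.distrib del: of_real_mult of_real_power flip: of_real_prod)
qed

lemma gauss_integral:
  "integrable lborel (\<lambda>x::real^'n. complex_of_real (gauss x))"
  "(LINT x|lborel. complex_of_real (gauss (x :: real^'n))) = of_real (sqrt (2 * pi) ^ CARD('n))"
  using osc_gauss[of "0 :: real^'n"] by (simp_all add: osc_def gauss_def[of 0])

lemma aniso_dilation_inverse':
  "aniso_dilation M (2 powr - real k) (aniso_dilation M (2 powr real k) x) = x"
  by (simp only: aniso_dilation_def vec_eq_iff vec_lambda_beta mult.assoc[symmetric]
      mult.commute[of "(2 powr - real k) powr _"] powr_dilation_cancel mult_1)
    simp

lemma aniso_dilation_tendsto_0:
  assumes "weight M" shows "(\<lambda>k. aniso_dilation M (2 powr - real k) x) \<longlonglongrightarrow> 0"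
proof (rule Lim_null_comparison)
  show "\<forall>\<^sub>F k in sequentially. norm (aniso_dilation M (2 powr - real k) x) \<le> norm x * (1 / 2) ^ k"
  proof (rule always_eventually, rule allI)
    fix k
    have "2 ^ k * norm (aniso_dilation M (2 powr - real k) x) \<le> norm x"
      using aniso_dilation_norm_ge[OF assms, of k "aniso_dilation M (2 powr - real k) x"]
      by (simp only: aniso_dilation_inverse)
    then show "norm (aniso_dilation M (2 powr - real k) x) \<le> norm x * (1 / 2) ^ k" by (simp add: field_simps)
  qed
  have "(\<lambda>k. (1 / 2 :: real) ^ k) \<longlonglongrightarrow> 0" by (rule LIMSEQ_realpow_zero) auto
  then show "(\<lambda>k. norm x * (1 / 2) ^ k) \<longlonglongrightarrow> 0" by (rule tendsto_mult_right_zero)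
qed

lemma aniso_dilation_borel [measurable]: "aniso_dilation M t \<in> borel \<rightarrow>\<^sub>M borel"
  by (rule diagonal_map_measurable[OF diagonal_map_aniso])

lemma integral_dilation:
  fixes f :: "real^'n \<Rightarrow> complex"
  assumes "f \<in> borel_measurable borel"
  shows "(LINT x|lborel. f x) = (LINT x|lborel. of_real (jacobian M k) * f (aniso_dilation M (2 powr real k) x))"
  using integral_diagonal[OF diagonal_map_aniso _ assms, of "2 powr real k" M 0]
  unfolding jacobian_prod by (simp add: scaleR_conv_of_real)

text \<open>Fourier inversion at the origin, by Gaussian summation.\<close>

lemma integral_inv_fourier:
  fixes \<psi> :: "real^'n \<Rightarrow> complex"
  assumes \<psi>: "\<psi> \<in> test_functions UNIV"
  shows "(LINT x|lborel. inv_fourier \<psi> x) = \<psi> 0"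
proof -
  \<comment> \<open>The isotropic weight; it makes the dilated kernels and their change of variables
    available for a statement without weight.\<close>
  define M :: "real^'n" where "M = (\<chi> i. 1)"
  have M: "weight M" by (simp add: weight_def M_def)
  define \<eta> where "\<eta> = inv_fourier \<psi>"
  let ?D = "\<lambda>k. aniso_dilation M (2 powr - real k)" and ?E = "\<lambda>k. aniso_dilation M (2 powr real k)"
  have \<eta>: "\<eta> \<in> schwartz" unfolding \<eta>_def by (rule inv_fourier_schwartz[OF \<psi>])
  have [measurable]: "\<eta> \<in> borel_measurable borel" "\<psi> \<in> borel_measurable borel"
    using \<eta> \<psi> by (auto intro: smooth_borel schwartz_smooth test_functions_smooth)
  \<comment> \<open>The mass of \<eta> with a Gaussian summation factor, computed twice: directly in
    the limit of large k, and after dilation and Fubini's theorem as a Gaussian mean of \<psi> near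
    0.\<close>
  define A where "A k = (LINT x|lborel. \<eta> x * of_real (gauss (?D k x)))" for k
  define c where "c = complex_of_real (1 / (2 * pi) ^ CARD('n))"
  have A: "A k = (LINT \<zeta>|lborel. (c * of_real (sqrt (2 * pi) ^ CARD('n))) * (\<psi> (?D k \<zeta>) * of_real (gauss \<zeta>)))" for k
  proof -
    have "A k = (LINT y|lborel. of_real (jacobian M k) * (\<eta> (?E k y) * of_real (gauss (?D k (?E k y)))))"
      unfolding A_def by (rule integral_dilation) measurable
    also have "\<dots> = (LINT y|lborel. kern M \<psi> k y * of_real (gauss y))"
      by (simp add: aniso_dilation_inverse' kern_eq[OF \<psi>] \<eta>_def mult.assoc)
    also have "\<dots> = (LINT y|lborel. (LINT \<zeta>|lborel. c * (exp (\<i> * of_real (y \<bullet> \<zeta>)) * \<psi> (?D k \<zeta>)) * of_real (gauss y)))"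
      by (simp only: kern_def inv_fourier_osc osc_def c_def integral_mult_right_zero integral_mult_left_zero)
    also have "\<dots> = (LINT \<zeta>|lborel. (LINT y|lborel. c * (exp (\<i> * of_real (y \<bullet> \<zeta>)) * \<psi> (?D k \<zeta>)) * of_real (gauss y)))"
    proof (rule lborel_pair.Fubini_integral[symmetric])
      have "integrable lborel (\<lambda>p::(real^'n) \<times> (real^'n). of_real (gauss (fst p)) * \<psi> (?D k (snd p)))"
        by (intro integral_pair_mult gauss_integral integrable_test[OF test_functions_dilation[OF \<psi>]])
      then have "integrable (lborel \<Otimes>\<^sub>M lborel) (\<lambda>p::(real^'n) \<times> (real^'n). c * (of_real (gauss (fst p)) * \<psi> (?D k (snd p))))"
        by (simp add: lborel_prod)
      then show "integrable (lborel \<Otimes>\<^sub>M lborel) (\<lambda>(\<zeta>, y). c * (exp (\<i> * of_real (\<zeta> \<bullet> y)) * \<psi> (?D k y)) * of_real (gauss \<zeta>))"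
        by (rule Bochner_Integration.integrable_bound) (auto simp: norm_mult)
    qed
    also have "\<dots> = (LINT \<zeta>|lborel. c * \<psi> (?D k \<zeta>) * osc (\<lambda>y. of_real (gauss y)) \<zeta>)"
      unfolding osc_def integral_mult_right_zero[symmetric] by (simp only: inner_commute mult_ac)
    finally show ?thesis by (simp only: osc_gauss(2) of_real_mult mult_ac)
  qed
  have "A \<longlonglongrightarrow> (LINT x|lborel. \<eta> x)"
    unfolding A_def
  proof (rule integral_dominated_convergence[where w = "\<lambda>x. norm (\<eta> x)"])
    show "AE x in lborel. (\<lambda>k. \<eta> x * of_real (gauss (?D k x))) \<longlonglongrightarrow> \<eta> x"
    proof (rule AE_I2)
      fix x
      have "(\<lambda>k. gauss (?D k x)) \<longlonglongrightarrow> gauss (0 :: real^'n)"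
        by (rule continuous_on_tendsto_compose[OF gauss_continuous[of UNIV] aniso_dilation_tendsto_0[OF M]]) auto
      then have "(\<lambda>k. \<eta> x * of_real (gauss (?D k x))) \<longlonglongrightarrow> \<eta> x * of_real (gauss (0 :: real^'n))"
        by (intro tendsto_intros)
      then show "(\<lambda>k. \<eta> x * of_real (gauss (?D k x))) \<longlonglongrightarrow> \<eta> x" by (simp add: gauss_def[of 0])
    qed
    show "AE x in lborel. norm (\<eta> x * of_real (gauss (?D k x))) \<le> norm (\<eta> x)" for k
      by (intro AE_I2) (simp add: norm_mult mult_left_le gauss_bounds)
    show "integrable lborel (\<lambda>x. norm (\<eta> x))" using schwartz_integrable[OF \<eta>] by simp
  qed auto
  moreover
  obtain B where B: "B \<ge> 0" "\<And>x. (1 + norm x) ^ 0 * norm (iter_deriv [] \<psi> x) \<le> B"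
    by (rule schwartzD[OF test_functions_schwartz[OF \<psi>] lists.Nil, of 0]) (rule that)
  have "A \<longlonglongrightarrow> (LINT \<zeta>|lborel. (c * of_real (sqrt (2 * pi) ^ CARD('n))) * (\<psi> 0 * of_real (gauss (\<zeta> :: real^'n))))"
    unfolding A
  proof (rule integral_dominated_convergence[where w = "\<lambda>\<zeta>. norm (c * of_real (sqrt (2 * pi) ^ CARD('n))) * (B * gauss \<zeta>)"])
    show "AE \<zeta> in lborel. (\<lambda>k. (c * of_real (sqrt (2 * pi) ^ CARD('n))) * (\<psi> (?D k \<zeta>) * of_real (gauss \<zeta>)))
        \<longlonglongrightarrow> (c * of_real (sqrt (2 * pi) ^ CARD('n))) * (\<psi> 0 * of_real (gauss \<zeta>))"
      by (intro AE_I2 tendsto_mult tendsto_const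
          continuous_on_tendsto_compose[OF smooth_continuous_on[OF test_functions_smooth[OF \<psi>], of UNIV] aniso_dilation_tendsto_0[OF M]]) auto
    show "AE \<zeta> in lborel. norm ((c * of_real (sqrt (2 * pi) ^ CARD('n))) * (\<psi> (?D k \<zeta>) * of_real (gauss \<zeta>)))
        \<le> norm (c * of_real (sqrt (2 * pi) ^ CARD('n))) * (B * gauss \<zeta>)" for k
      unfolding norm_mult norm_of_real abs_of_nonneg[OF gauss_bounds(1)]
      using B(2) by (intro AE_I2 mult_left_mono mult_right_mono gauss_bounds mult_nonneg_nonneg) auto
    show "integrable lborel (\<lambda>\<zeta>::real^'n. norm (c * of_real (sqrt (2 * pi) ^ CARD('n))) * (B * gauss \<zeta>))"
      using gauss_integral(1)[where 'n = 'n] by (intro integrable_mult_right) (simp add: complex_of_real_integrable_eq)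
  qed auto
  ultimately have "(LINT x|lborel. \<eta> x) =
      (LINT \<zeta>|lborel. (c * of_real (sqrt (2 * pi) ^ CARD('n))) * (\<psi> 0 * of_real (gauss (\<zeta> :: real^'n))))"
    by (rule LIMSEQ_unique)
  also have "\<dots> = c * of_real (sqrt (2 * pi) ^ CARD('n)) * (\<psi> 0 * of_real (sqrt (2 * pi) ^ CARD('n)))"
    by (simp only: integral_mult_right_zero gauss_integral(2))
  also have "\<dots> = (c * of_real (sqrt (2 * pi) ^ CARD('n) * sqrt (2 * pi) ^ CARD('n))) * \<psi> 0"
    by (simp only: of_real_mult mult_ac)
  \<comment> \<open>One root comes from the transform of the Gaussian and one from its integral;
    together they cancel the normalisation of \<open>inv_fourier\<close>.\<close>
  also have "sqrt (2 * pi) ^ CARD('n) * sqrt (2 * pi) ^ CARD('n) = (2 * pi) ^ CARD('n)"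
    by (simp only: power_mult_distrib[symmetric] real_sqrt_mult_self) simp
  also have "c * of_real ((2 * pi) ^ CARD('n)) = 1"
    unfolding c_def of_real_mult[symmetric] by simp
  finally show ?thesis by (simp add: \<eta>_def)
qed

section \<open>Mollification of integrable functions\<close>

definition function_dist :: "(real^'n \<Rightarrow> complex) \<Rightarrow> (real^'n \<Rightarrow> complex) \<Rightarrow> complex" where
  "function_dist f = (\<lambda>\<phi>. if \<phi> \<in> schwartz then (LINT x|lborel. f x * \<phi> x) else 0)"

lemma integrable_mult_bounded:
  fixes f \<phi> :: "'a::euclidean_space \<Rightarrow> complex"
  assumes "integrable lborel f" "\<phi> \<in> borel_measurable borel" "\<And>x. norm (\<phi> x) \<le> B"
  shows "integrable lborel (\<lambda>x. f x * \<phi> x)"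
proof (rule Bochner_Integration.integrable_bound)
  show "integrable lborel (\<lambda>x. of_real B * f x)" using assms(1) by simp
  show "(\<lambda>x. f x * \<phi> x) \<in> borel_measurable lborel" using assms by auto
  have "norm (f x) * norm (\<phi> x) \<le> \<bar>B\<bar> * norm (f x)" for x
    using mult_left_mono[OF order_trans[OF assms(3) abs_ge_self], of "norm (f x)" x] by (simp add: mult.commute)
  then show "AE x in lborel. norm (f x * \<phi> x) \<le> norm (of_real B * f x)"
    by (intro AE_I2) (simp add: norm_mult)
qed

lemma schwartz_functional_function_dist:
  assumes "integrable lborel f" shows "schwartz_functional (function_dist f)"
proof -
  have int: "integrable lborel (\<lambda>x. f x * \<phi> x)" if \<phi>: "\<phi> \<in> schwartz" for \<phi>
  proof -
    obtain B where B: "B \<ge> 0" "\<And>x. (1 + norm x) ^ 0 * norm (iter_deriv [] \<phi> x) \<le> B"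
      by (rule schwartzD[OF \<phi> lists.Nil, of 0]) (rule that)
    show ?thesis
      using B(2) \<phi> by (intro integrable_mult_bounded[OF assms, of _ B] smooth_borel schwartz_smooth) auto
  qed
  have "linear_functional_on schwartz (function_dist f)"
    unfolding linear_functional_on_def function_dist_def
  proof (intro conjI ballI allI impI)
    fix \<phi> \<theta> :: "real^'a \<Rightarrow> complex" assume *: "\<phi> \<in> schwartz" "\<theta> \<in> schwartz"
    have "(LINT x|lborel. f x * (\<phi> x + \<theta> x)) = (LINT x|lborel. f x * \<phi> x) + (LINT x|lborel. f x * \<theta> x)"
      unfolding distrib_left by (rule Bochner_Integration.integral_add[OF int[OF *(1)] int[OF *(2)]])
    then show "(if (\<lambda>x. \<phi> x + \<theta> x) \<in> schwartz then LINT x|lborel. f x * (\<phi> x + \<theta> x) else 0) =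
        (if \<phi> \<in> schwartz then LINT x|lborel. f x * \<phi> x else 0) + (if \<theta> \<in> schwartz then LINT x|lborel. f x * \<theta> x else 0)"
      using * by (simp add: schwartz_add)
  next
    fix c and \<phi> :: "real^'a \<Rightarrow> complex" assume *: "\<phi> \<in> schwartz"
    have "(LINT x|lborel. f x * (c * \<phi> x)) = c * (LINT x|lborel. f x * \<phi> x)"
      unfolding integral_mult_right_zero[symmetric] by (simp only: mult_ac)
    then show "(if (\<lambda>x. c * \<phi> x) \<in> schwartz then LINT x|lborel. f x * (c * \<phi> x) else 0) =
        c * (if \<phi> \<in> schwartz then LINT x|lborel. f x * \<phi> x else 0)"
      using * by (simp add: schwartz_cmult)
  qed simp
  moreover have "norm (function_dist f \<phi>) \<le> (LINT x|lborel. norm (f x)) * B"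
    if \<phi>: "\<phi> \<in> schwartz" and B: "seminorm_le 0 \<phi> B" for \<phi> B
  proof -
    have le: "norm (\<phi> x) \<le> B" for x using seminorm_leD[OF B lists.Nil] by simp
    have "norm (LINT x|lborel. f x * \<phi> x) \<le> (LINT x|lborel. norm (f x) * B)"
      using assms le
      by (intro Bochner_Integration.integral_norm_bound_integral int \<phi>) (auto simp: norm_mult intro!: mult_left_mono)
    then show ?thesis using \<phi> by (simp add: function_dist_def)
  qed
  moreover have "0 \<le> (LINT x|lborel. norm (f x))" by simp
  ultimately show ?thesis unfolding schwartz_functional_def by blast
qed

text \<open>Reflection and dilation of the variable move k from the kernel into the shift of
  \<open>f\<close>. What remains is an average of translates with the fixed integrable weight
  \<open>inv_fourier \<psi>\<close>, to which dominated convergence applies as the shifts tend to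
  0.\<close>

lemma low_freq_function_dist:
  fixes M :: "real^'n"
  assumes \<Psi>: "LP_generator \<Psi>" and f: "integrable lborel f" and \<psi>: "\<psi> \<in> test_functions UNIV"
  shows "low_freq M \<psi> k (function_dist f) x =
    (LINT y|lborel. f (x - aniso_dilation M (2 powr - real k) y) * inv_fourier \<psi> y)"
proof -
  let ?D = "aniso_dilation M (2 powr - real k)" and ?E = "aniso_dilation M (2 powr real k)"
  have [measurable]: "f \<in> borel_measurable borel" "inv_fourier \<psi> \<in> borel_measurable borel" "kern M \<psi> k \<in> borel_measurable borel"
    using f inv_fourier_schwartz[OF \<psi>] kern_schwartz[OF \<psi>, of M k]
    by (auto intro: smooth_borel schwartz_smooth)
  have "low_freq M \<psi> k (function_dist f) x = (LINT y|lborel. f y * kern M \<psi> k (x - y))"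
    unfolding low_freq_eq[OF \<Psi> schwartz_functional_function_dist[OF f] \<psi>]
    by (simp add: function_dist_def schwartz_reflect[OF kern_schwartz[OF \<psi>]])
  also have "\<dots> = (LINT w|lborel. f (x - w) * kern M \<psi> k (x - (x - w)))"
    by (rule integral_reflect[symmetric]) measurable
  also have "\<dots> = (LINT w|lborel. of_real (jacobian M k) * (f (x - ?D (?E w)) * inv_fourier \<psi> (?E w)))"
    by (simp add: kern_eq[OF \<psi>] aniso_dilation_inverse' mult_ac)
  also have "\<dots> = (LINT y|lborel. f (x - ?D y) * inv_fourier \<psi> y)"
    by (rule integral_dilation[symmetric]) measurable
  finally show ?thesis .
qed

text \<open>\<open>g\<close> is approximated by a bounded continuous function up to an error that is
  small in L_1 against \<open>f\<close>, uniformly over all translates. Convergence of translated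
  products can be deduced from this one-sided condition, and it hides the exponents, endpoints
  included.\<close>

definition translation_approximable :: "('a::euclidean_space \<Rightarrow> complex) \<Rightarrow> ('a \<Rightarrow> complex) \<Rightarrow> bool" where
  "translation_approximable f g \<longleftrightarrow> (\<forall>\<epsilon>>0. \<exists>g'. continuous_on UNIV g' \<and> bounded (range g') \<and>
     (\<forall>a. integrable lborel (\<lambda>x. f x * (g (a + x) - g' (a + x))) \<and>
        (LINT x|lborel. norm (f x * (g (a + x) - g' (a + x)))) \<le> \<epsilon>))"

lemma translation_approximableE:
  assumes "translation_approximable f g" "\<epsilon> > 0"
  obtains g' B where "continuous_on UNIV g'" "\<And>x. norm (g' x) \<le> B"
    "\<And>a. integrable lborel (\<lambda>x. f x * (g (a + x) - g' (a + x)))"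
    "\<And>a. (LINT x|lborel. norm (f x * (g (a + x) - g' (a + x)))) \<le> \<epsilon>"
proof -
  obtain g' where g': "continuous_on UNIV g'" "bounded (range g')" "\<forall>a. integrable lborel (\<lambda>x. f x * (g (a + x) - g' (a + x))) \<and>
        (LINT x|lborel. norm (f x * (g (a + x) - g' (a + x)))) \<le> \<epsilon>"
    using assms unfolding translation_approximable_def by blast
  obtain B where "\<forall>x. norm (g' x) \<le> B" using g'(2) by (auto simp: bounded_iff)
  then show ?thesis using that g' by blast
qed

text \<open>Approximation with \<epsilon> = 1 splits the product into an error of L_1 norm at most 1
  and \<open>f\<close> times a bounded function. A translation by a reduces the two shifts to the
  single shift a - b of \<open>g\<close>.\<close>

lemma translation_product_bound:
  fixes f g :: "'a::euclidean_space \<Rightarrow> complex"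
  assumes [measurable]: "f \<in> borel_measurable borel" "g \<in> borel_measurable borel"
    and f: "integrable lborel f" and ta: "translation_approximable f g"
  obtains C where "C \<ge> 0" "\<And>a b. integrable lborel (\<lambda>x. f (x - a) * g (x - b))"
    "\<And>a b. (LINT x|lborel. norm (f (x - a) * g (x - b))) \<le> C"
proof -
  obtain g' B where g': "continuous_on UNIV g'" "\<And>x. norm (g' x) \<le> B"
    "\<And>a. integrable lborel (\<lambda>x. f x * (g (a + x) - g' (a + x)))"
    "\<And>a. (LINT x|lborel. norm (f x * (g (a + x) - g' (a + x)))) \<le> 1"
    by (rule translation_approximableE[OF ta zero_less_one]) (rule that)
  have [measurable]: "g' \<in> borel_measurable borel" by (rule borel_measurable_continuous_onI[OF g'(1)])
  have B: "B \<ge> 0" using norm_ge_zero g'(2) order_trans by blast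
  have int': "integrable lborel (\<lambda>x. f x * g' (c + x))" for c
    using g'(2) by (intro integrable_mult_bounded[OF f, of _ B]) auto
  have int: "integrable lborel (\<lambda>x. f x * g (c + x))" for c
    using Bochner_Integration.integrable_add[OF g'(3)[of c] int'[of c]] by (simp add: algebra_simps)
  have bd: "(LINT x|lborel. norm (f x * g (c + x))) \<le> 1 + B * (LINT x|lborel. norm (f x))" for c
  proof -
    have "(LINT x|lborel. norm (f x * g (c + x))) \<le>
        (LINT x|lborel. norm (f x * (g (c + x) - g' (c + x))) + B * norm (f x))"
    proof (rule integral_mono)
      fix x
      have "norm (f x * g (c + x)) \<le> norm (f x * (g (c + x) - g' (c + x))) + norm (f x * g' (c + x))"
        using norm_triangle_ineq[of "f x * (g (c + x) - g' (c + x))" "f x * g' (c + x)"] by (simp add: algebra_simps)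
      also have "norm (f x * g' (c + x)) \<le> B * norm (f x)"
        unfolding norm_mult using g'(2) by (subst mult.commute) (intro mult_right_mono, auto)
      finally show "norm (f x * g (c + x)) \<le> norm (f x * (g (c + x) - g' (c + x))) + B * norm (f x)" by simp
    qed (use int g'(3) f in auto)
    also have "\<dots> = (LINT x|lborel. norm (f x * (g (c + x) - g' (c + x)))) + B * (LINT x|lborel. norm (f x))"
      using g'(3) f by (subst Bochner_Integration.integral_add) auto
    finally show ?thesis using g'(4)[of c] by linarith
  qed
  show ?thesis
  proof (rule that)
    show "0 \<le> 1 + B * (LINT x|lborel. norm (f x))" using B by simp
    fix a b
    have eq: "f (a + x - a) * g (a + x - b) = f x * g ((a - b) + x)" for x by (simp add: algebra_simps)
    show "integrable lborel (\<lambda>x. f (x - a) * g (x - b))"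
      using int[of "a - b"] integrable_translate_iff[of "\<lambda>x. f (x - a) * g (x - b)" a] unfolding eq by simp
    have "(LINT x|lborel. norm (f (x - a) * g (x - b))) = (LINT x|lborel. norm (f x * g ((a - b) + x)))"
      using integral_translate[of "\<lambda>x. norm (f (x - a) * g (x - b))" a] unfolding eq by simp
    then show "(LINT x|lborel. norm (f (x - a) * g (x - b))) \<le> 1 + B * (LINT x|lborel. norm (f x))"
      using bd by simp
  qed
qed

text \<open>With \<open>g\<close> replaced by a continuous g', dominated convergence gives the
  limit; the replacement costs at most r/3 for every k and in the limit, because the approximation
  is uniform in the shift.\<close>

lemma translation_product_tendsto:
  fixes f g \<phi> :: "'a::euclidean_space \<Rightarrow> complex"
  assumes [measurable]: "f \<in> borel_measurable borel" "g \<in> borel_measurable borel"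
    and f: "integrable lborel f" and ta: "translation_approximable f g"
    and \<phi>: "continuous_on UNIV \<phi>" "\<And>x. norm (\<phi> x) \<le> C" and ab: "a \<longlonglongrightarrow> 0" "b \<longlonglongrightarrow> 0"
  shows "(\<lambda>k. LINT x|lborel. f (x - a k) * g (x - b k) * \<phi> x) \<longlonglongrightarrow> (LINT x|lborel. f x * g x * \<phi> x)"
proof -
  have [measurable]: "\<phi> \<in> borel_measurable borel" by (rule borel_measurable_continuous_onI[OF \<phi>(1)])
  have C: "C \<ge> 0" using norm_ge_zero \<phi>(2) order_trans by blast
  \<comment> \<open>Substituting a + x for x frees \<open>f\<close> of its shift: the fixed
    integrable \<open>f\<close> can then be used for domination, and \<open>g\<close> is shifted by
    c = a - b.\<close>
  define J where "J a c = (LINT x|lborel. f x * g (c + x) * \<phi> (a + x))" for a c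
  have J: "(LINT x|lborel. f (x - a k) * g (x - b k) * \<phi> x) = J (a k) (a k - b k)" for k
    unfolding J_def
    by (subst integral_translate[of "\<lambda>x. f (x - a k) * g (x - b k) * \<phi> x" "a k", symmetric]) (simp_all add: algebra_simps)
  have "(\<lambda>k. J (a k) (a k - b k)) \<longlonglongrightarrow> J 0 0"
  proof (rule LIMSEQ_I)
    fix r :: real assume r: "r > 0"
    \<comment> \<open>The summand 1 avoids division by 0 when C = 0.\<close>
    define \<epsilon> where "\<epsilon> = r / (3 * (C + 1))"
    have \<epsilon>: "\<epsilon> > 0" "C * \<epsilon> \<le> r / 3" using r C by (auto simp: \<epsilon>_def field_simps)
    obtain g' B where g': "continuous_on UNIV g'" "\<And>x. norm (g' x) \<le> B"
      "\<And>a. integrable lborel (\<lambda>x. f x * (g (a + x) - g' (a + x)))"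
      "\<And>a. (LINT x|lborel. norm (f x * (g (a + x) - g' (a + x)))) \<le> \<epsilon>"
      by (rule translation_approximableE[OF ta \<epsilon>(1)]) (rule that)
    have [measurable]: "g' \<in> borel_measurable borel" by (rule borel_measurable_continuous_onI[OF g'(1)])
    have B: "B \<ge> 0" using norm_ge_zero g'(2) order_trans by blast
    define J' where "J' a c = (LINT x|lborel. f x * g' (c + x) * \<phi> (a + x))" for a c
    have int': "integrable lborel (\<lambda>x. f x * g' (c + x) * \<phi> (a + x))" for a c
      using g'(2) \<phi>(2) by (intro integrable_mult_bounded[of _ _ C] integrable_mult_bounded[OF f, of _ B]) auto
    have intd: "integrable lborel (\<lambda>x. f x * (g (c + x) - g' (c + x)) * \<phi> (a + x))" for a c
      using \<phi>(2) by (intro integrable_mult_bounded[OF g'(3), of _ C]) auto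
    have JJ': "norm (J a c - J' a c) \<le> r / 3" for a c
    proof -
      have "J a c = (LINT x|lborel. f x * (g (c + x) - g' (c + x)) * \<phi> (a + x) + f x * g' (c + x) * \<phi> (a + x))"
        unfolding J_def by (simp add: algebra_simps)
      also have "\<dots> = (LINT x|lborel. f x * (g (c + x) - g' (c + x)) * \<phi> (a + x)) + J' a c"
        unfolding J'_def by (rule Bochner_Integration.integral_add[OF intd int'])
      finally have "norm (J a c - J' a c) = norm (LINT x|lborel. f x * (g (c + x) - g' (c + x)) * \<phi> (a + x))" by simp
      also have "\<dots> \<le> (LINT x|lborel. norm (f x * (g (c + x) - g' (c + x))) * C)"
      proof (rule Bochner_Integration.integral_norm_bound_integral[OF intd])
        show "integrable lborel (\<lambda>x. norm (f x * (g (c + x) - g' (c + x))) * C)"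
          using integrable_norm[OF g'(3)[of c]] by (rule integrable_mult_left)
        show "norm (f x * (g (c + x) - g' (c + x)) * \<phi> (a + x)) \<le> norm (f x * (g (c + x) - g' (c + x))) * C" for x
          by (subst norm_mult) (intro mult_left_mono \<phi>(2), simp)
      qed
      also have "\<dots> \<le> C * \<epsilon>"
        using mult_left_mono[OF g'(4)[of c] C] by (simp add: mult.commute)
      finally show ?thesis using \<epsilon>(2) by linarith
    qed
    have "(\<lambda>k. J' (a k) (a k - b k)) \<longlonglongrightarrow> J' 0 0"
      unfolding J'_def
    proof (rule integral_dominated_convergence[where w = "\<lambda>x. norm (f x) * (B * C)"])
      have c: "(\<lambda>k. a k - b k) \<longlonglongrightarrow> 0" using tendsto_diff[OF ab] by simp
      show "AE x in lborel. (\<lambda>k. f x * g' (a k - b k + x) * \<phi> (a k + x)) \<longlonglongrightarrow> f x * g' (0 + x) * \<phi> (0 + x)"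
        by (intro AE_I2 tendsto_mult tendsto_const continuous_on_tendsto_compose[OF g'(1)]
            continuous_on_tendsto_compose[OF \<phi>(1)] tendsto_add ab c) auto
      show "AE x in lborel. norm (f x * g' (a k - b k + x) * \<phi> (a k + x)) \<le> norm (f x) * (B * C)" for k
        unfolding norm_mult mult.assoc using g'(2) \<phi>(2) B by (intro AE_I2 mult_left_mono mult_mono) auto
      show "integrable lborel (\<lambda>x. norm (f x) * (B * C))" using f by simp
    qed auto
    moreover have "r / 3 > 0" using r by simp
    ultimately obtain n where n: "\<forall>k\<ge>n. norm (J' (a k) (a k - b k) - J' 0 0) < r / 3"
      using LIMSEQ_D by blast
    have "norm (J (a k) (a k - b k) - J 0 0) < r" if "k \<ge> n" for k
    proof -
      have "J (a k) (a k - b k) - J 0 0 = (J (a k) (a k - b k) - J' (a k) (a k - b k)) +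
          (J' (a k) (a k - b k) - J' 0 0) - (J 0 0 - J' 0 0)" by simp
      also have "norm \<dots> \<le> norm (J (a k) (a k - b k) - J' (a k) (a k - b k)) +
          norm (J' (a k) (a k - b k) - J' 0 0) + norm (J 0 0 - J' 0 0)"
        by (intro order_trans[OF norm_triangle_ineq4] add_right_mono norm_triangle_ineq)
      also have "\<dots> < r" using n[rule_format, OF that] JJ'[of "a k" "a k - b k"] JJ'[of 0 0] by linarith
      finally show ?thesis .
    qed
    then show "\<exists>n. \<forall>k\<ge>n. norm (J (a k) (a k - b k) - J 0 0) < r" by blast
  qed
  then show ?thesis unfolding J by (simp add: J_def)
qed

text \<open>The product of the two mollifications is an average, with weight \<open>\<eta>(y) \<eta>(z)\<close>, of translated
  products \<open>\<integral> f(x - y) g(x - z) \<phi>(x) dx\<close>, which are bounded and continuous at the origin.\<close>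

lemma low_freq_product_tendsto:
  fixes M :: "real^'n" and f g \<phi> \<psi> :: "real^'n \<Rightarrow> complex"
  assumes \<Psi>: "LP_generator \<Psi>" and M: "weight M"
    and f: "integrable lborel f" and g: "integrable lborel g" and ta: "translation_approximable f g"
    and \<psi>: "\<psi> \<in> test_functions UNIV" and \<phi>: "\<phi> \<in> test_functions UNIV"
  shows "(\<lambda>k. LINT x|lborel. low_freq M \<psi> k (function_dist f) x * low_freq M \<psi> k (function_dist g) x * \<phi> x)
    \<longlonglongrightarrow> \<psi> 0 * \<psi> 0 * (LINT x|lborel. f x * g x * \<phi> x)"
proof -
  define \<eta> where "\<eta> = inv_fourier \<psi>"
  have \<eta>: "\<eta> \<in> schwartz" unfolding \<eta>_def by (rule inv_fourier_schwartz[OF \<psi>])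
  have [measurable]: "f \<in> borel_measurable borel" "g \<in> borel_measurable borel"
    "\<eta> \<in> borel_measurable borel" "\<phi> \<in> borel_measurable borel"
    using f g \<eta> \<phi> by (auto intro: smooth_borel schwartz_smooth test_functions_smooth)
  have [measurable]: "fst \<in> (borel :: ((real^'n) \<times> (real^'n)) measure) \<rightarrow>\<^sub>M borel" "snd \<in> (borel :: ((real^'n) \<times> (real^'n)) measure) \<rightarrow>\<^sub>M borel"
    by (intro borel_measurable_continuous_onI continuous_intros)+
  obtain B where B: "B \<ge> 0" "\<And>x. (1 + norm x) ^ 0 * norm (iter_deriv [] \<eta> x) \<le> B"
    by (rule schwartzD[OF \<eta> lists.Nil, of 0]) (rule that)
  then have \<eta>B: "norm (\<eta> x) \<le> B" for x by simp
  obtain C\<phi> where C\<phi>: "C\<phi> \<ge> 0" "\<And>x. (1 + norm x) ^ 0 * norm (iter_deriv [] \<phi> x) \<le> C\<phi>"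
    by (rule schwartzD[OF test_functions_schwartz[OF \<phi>] lists.Nil, of 0]) (rule that)
  then have \<phi>C: "norm (\<phi> x) \<le> C\<phi>" for x by simp
  obtain C where C: "C \<ge> 0" "\<And>a b. integrable lborel (\<lambda>x. f (x - a) * g (x - b))"
    "\<And>a b. (LINT x|lborel. norm (f (x - a) * g (x - b))) \<le> C"
    by (rule translation_product_bound[OF _ _ f ta]) (simp, simp, rule that)
  define D where "D k = aniso_dilation M (2 powr - real k)" for k
  have [measurable]: "D k \<in> borel \<rightarrow>\<^sub>M borel" for k unfolding D_def by measurable
  \<comment> \<open>Both shifts are averaged with this product weight, whose integral is the square
    of the mass \<psi> 0 of \<eta>.\<close>
  define w where "w p = \<eta> (fst p) * \<eta> (snd p)" for p :: "(real^'n) \<times> (real^'n)"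
  have w: "integrable lborel w" "(LINT p|lborel. w p) = \<psi> 0 * \<psi> 0"
    unfolding w_def using integral_pair_mult[OF schwartz_integrable[OF \<eta>] schwartz_integrable[OF \<eta>]]
      integral_inv_fourier[OF \<psi>] by (simp_all add: \<eta>_def)
  have [measurable]: "w \<in> borel_measurable borel" unfolding w_def by measurable
  define F where "F k p x = w p * (f (x - D k (fst p)) * g (x - D k (snd p)) * \<phi> x)" for k p x
  have [measurable]: "(\<lambda>(p, x). F k p x) \<in> borel_measurable (lborel \<Otimes>\<^sub>M lborel)" for k
    unfolding F_def by measurable
  have intx: "integrable lborel (\<lambda>x. f (x - a) * g (x - b) * \<phi> x)" for a b
    using \<phi>C by (intro integrable_mult_bounded[OF C(2), of _ C\<phi>]) auto
  have bdx: "(LINT x|lborel. norm (f (x - a) * g (x - b) * \<phi> x)) \<le> C * C\<phi>" for a b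
  proof -
    have "(LINT x|lborel. norm (f (x - a) * g (x - b) * \<phi> x)) \<le> (LINT x|lborel. norm (f (x - a) * g (x - b)) * C\<phi>)"
    proof (rule integral_mono)
      show "integrable lborel (\<lambda>x. norm (f (x - a) * g (x - b) * \<phi> x))" using intx by (rule integrable_norm)
      show "integrable lborel (\<lambda>x. norm (f (x - a) * g (x - b)) * C\<phi>)" using integrable_norm[OF C(2)] by simp
      show "norm (f (x - a) * g (x - b) * \<phi> x) \<le> norm (f (x - a) * g (x - b)) * C\<phi>" for x
        by (subst norm_mult) (intro mult_left_mono \<phi>C, simp)
    qed
    also have "\<dots> = (LINT x|lborel. norm (f (x - a) * g (x - b))) * C\<phi>" by simp
    also have "\<dots> \<le> C * C\<phi>" by (intro mult_right_mono C C\<phi>)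
    finally show ?thesis .
  qed
  \<comment> \<open>Absolute integrability in (p, x): the integral over x is bounded by
    \<open>C * C\<phi>\<close> for all shifts, and \<open>w\<close> is integrable.\<close>
  have int: "integrable (lborel \<Otimes>\<^sub>M lborel) (\<lambda>(p, x). F k p x)" for k
  proof (rule lborel_pair.Fubini_integrable)
    show "AE p in lborel. integrable lborel (\<lambda>x. case (p, x) of (p, x) \<Rightarrow> F k p x)"
      unfolding F_def prod.case by (intro AE_I2 integrable_mult_right intx)
    show "integrable lborel (\<lambda>p. LINT x|lborel. norm (case (p, x) of (p, x) \<Rightarrow> F k p x))"
    proof (rule Bochner_Integration.integrable_bound)
      show "integrable lborel (\<lambda>p. of_real (C * C\<phi>) * w p)" using w(1) by (rule integrable_mult_right)
      show "(\<lambda>p. LINT x|lborel. norm (case (p, x) of (p, x) \<Rightarrow> F k p x)) \<in> borel_measurable lborel" by measurable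
      have "(LINT x|lborel. norm (F k p x)) \<le> norm (w p) * (C * C\<phi>)" for p
        unfolding F_def norm_mult[of "w p"] integral_mult_right_zero by (intro mult_left_mono bdx) simp
      then show "AE p in lborel. norm (LINT x|lborel. norm (case (p, x) of (p, x) \<Rightarrow> F k p x)) \<le> norm (of_real (C * C\<phi>) * w p)"
        using C(1) C\<phi>(1) by (intro AE_I2) (simp add: norm_mult mult_ac)
    qed
  qed measurable
  have eq: "(LINT x|lborel. low_freq M \<psi> k (function_dist f) x * low_freq M \<psi> k (function_dist g) x * \<phi> x) =
      (LINT p|lborel. w p * (LINT x|lborel. f (x - D k (fst p)) * g (x - D k (snd p)) * \<phi> x))" for k
  proof -
    have Fx: "(LINT p|lborel. F k p x) = low_freq M \<psi> k (function_dist f) x * low_freq M \<psi> k (function_dist g) x * \<phi> x" for x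
    proof -
      have i: "integrable lborel (\<lambda>y. h (x - D k y) * \<eta> y)" if h: "integrable lborel h" for h
      proof -
        have [measurable]: "h \<in> borel_measurable borel" using h by auto
        have "integrable lborel (\<lambda>y. h (x - y))" using integrable_reflect_iff[of h x] h by simp
        then have "integrable lborel (\<lambda>y. h (x - D k y))"
          using integrable_diagonal_iff[OF diagonal_map_aniso, of "2 powr - real k" M "\<lambda>y. h (x - y)" 0] by (simp add: D_def)
        then show ?thesis using \<eta>B by (intro integrable_mult_bounded[of _ _ B]) auto
      qed
      have "(LINT p|lborel. F k p x) =
          (LINT p|lborel. (f (x - D k (fst p)) * \<eta> (fst p)) * (g (x - D k (snd p)) * \<eta> (snd p)) * \<phi> x)"
        unfolding F_def w_def by (simp only: mult_ac)
      also have "\<dots> = (LINT y|lborel. f (x - D k y) * \<eta> y) * (LINT y|lborel. g (x - D k y) * \<eta> y) * \<phi> x"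
        unfolding integral_mult_left_zero by (simp only: integral_pair_mult(2)[OF i[OF f] i[OF g]])
      finally show ?thesis
        by (simp only: low_freq_function_dist[OF \<Psi> f \<psi>] low_freq_function_dist[OF \<Psi> g \<psi>] D_def \<eta>_def)
    qed
    have "(LINT x|lborel. (LINT p|lborel. F k p x)) = (LINT p|lborel. (LINT x|lborel. F k p x))"
      by (rule lborel_pair.Fubini_integral[OF int])
    then show ?thesis unfolding Fx by (simp only: F_def integral_mult_right_zero)
  qed
  have "(\<lambda>k. LINT p|lborel. w p * (LINT x|lborel. f (x - D k (fst p)) * g (x - D k (snd p)) * \<phi> x))
      \<longlonglongrightarrow> (LINT p|lborel. w p * (LINT x|lborel. f x * g x * \<phi> x))"
  proof (rule integral_dominated_convergence[where w = "\<lambda>p. norm (w p) * (C * C\<phi>)"])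
    show "AE p in lborel. (\<lambda>k. w p * (LINT x|lborel. f (x - D k (fst p)) * g (x - D k (snd p)) * \<phi> x))
        \<longlonglongrightarrow> w p * (LINT x|lborel. f x * g x * \<phi> x)"
      using smooth_continuous_on[OF test_functions_smooth[OF \<phi>], of UNIV]
      by (intro AE_I2 tendsto_mult tendsto_const translation_product_tendsto[OF _ _ f ta _ \<phi>C])
         (simp_all add: D_def aniso_dilation_tendsto_0[OF M])
    show "AE p in lborel. norm (w p * (LINT x|lborel. f (x - D k (fst p)) * g (x - D k (snd p)) * \<phi> x)) \<le> norm (w p) * (C * C\<phi>)" for k
    proof (rule AE_I2)
      fix p
      have "norm (LINT x|lborel. f (x - D k (fst p)) * g (x - D k (snd p)) * \<phi> x) \<le> C * C\<phi>"
        by (rule order_trans[OF integral_norm_bound bdx])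
      then show "norm (w p * (LINT x|lborel. f (x - D k (fst p)) * g (x - D k (snd p)) * \<phi> x)) \<le> norm (w p) * (C * C\<phi>)"
        unfolding norm_mult[of "w p"] by (rule mult_left_mono) simp
    qed
    show "integrable lborel (\<lambda>p. norm (w p) * (C * C\<phi>))" using w(1) by simp
    show "(\<lambda>p. w p * (LINT x|lborel. f (x - D k (fst p)) * g (x - D k (snd p)) * \<phi> x)) \<in> borel_measurable lborel" for k
      by measurable
  qed auto
  then show ?thesis unfolding eq integral_mult_left_zero w(2) .
qed

section \<open>Approximation in Lebesgue spaces\<close>

text \<open>The nearest point of the disc of radius N. As a projection onto a closed convex set it
  is continuous, and it moves no point by more than its modulus.\<close>

definition clip :: "nat \<Rightarrow> complex \<Rightarrow> complex" where
  "clip N = closest_point (cball 0 (real N))"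

lemma clip:
  shows continuous_on_clip: "continuous_on S (clip N)"
    and norm_clip_le: "norm (clip N z) \<le> real N"
    and clip_eq: "norm z \<le> real N \<Longrightarrow> clip N z = z"
    and norm_diff_clip_le: "norm (z - clip N z) \<le> norm z"
    and clip_borel [measurable]: "clip N \<in> borel_measurable borel"
proof -
  have ne: "cball (0::complex) (real N) \<noteq> {}" by simp
  show c: "continuous_on S (clip N)" for S
    unfolding clip_def by (intro continuous_on_closest_point convex_cball closed_cball ne)
  show "norm (clip N z) \<le> real N"
    using closest_point_in_set[OF closed_cball ne, of z] unfolding clip_def by simp
  show "norm z \<le> real N \<Longrightarrow> clip N z = z" unfolding clip_def by (intro closest_point_self) simp
  show "norm (z - clip N z) \<le> norm z"
    using closest_point_le[OF closed_cball, of 0 0 "real N" z] unfolding clip_def by (simp add: dist_norm)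
  show "clip N \<in> borel_measurable borel" by (rule borel_measurable_continuous_onI[OF c])
qed

lemma Lp_truncate:
  fixes g :: "'a::euclidean_space \<Rightarrow> complex"
  assumes [measurable]: "g \<in> borel_measurable borel" and q: "q > 0"
    and fin: "(\<integral>\<^sup>+x. ennreal (norm (g x) powr q) \<partial>lborel) < \<infinity>" and \<delta>: "\<delta> > 0"
  obtains N where "(\<integral>\<^sup>+x. ennreal (norm (g x - clip N (g x)) powr q) \<partial>lborel) \<le> ennreal \<delta>"
proof -
  have "(\<lambda>N. \<integral>\<^sup>+x. ennreal (norm (g x - clip N (g x)) powr q) \<partial>lborel) \<longlonglongrightarrow> (\<integral>\<^sup>+(x::'a). 0 \<partial>lborel)"
  proof (rule nn_integral_dominated_convergence[OF _ _ _ _ fin])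
    show "AE x in lborel. ennreal (norm (g x - clip N (g x)) powr q) \<le> ennreal (norm (g x) powr q)" for N
      using q by (intro AE_I2 ennreal_leI powr_mono2 norm_diff_clip_le) auto
    show "AE x in lborel. (\<lambda>N. ennreal (norm (g x - clip N (g x)) powr q)) \<longlonglongrightarrow> 0"
    proof (rule AE_I2, rule tendsto_eventually)
      fix x
      obtain N0 :: nat where N0: "norm (g x) \<le> real N0" using real_arch_simple by blast
      show "\<forall>\<^sub>F N in sequentially. ennreal (norm (g x - clip N (g x)) powr q) = 0"
        unfolding eventually_sequentially
        by (rule exI[of _ N0]) (use N0 in \<open>auto simp: clip_eq\<close>)
    qed
  qed measurable
  then have "(\<lambda>N. \<integral>\<^sup>+x. ennreal (norm (g x - clip N (g x)) powr q) \<partial>lborel) \<longlonglongrightarrow> 0" by simp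
  then have "\<forall>\<^sub>F N in sequentially. (\<integral>\<^sup>+x. ennreal (norm (g x - clip N (g x)) powr q) \<partial>lborel) < ennreal \<delta>"
    by (rule order_tendstoD) (use \<delta> in simp)
  then obtain N where "(\<integral>\<^sup>+x. ennreal (norm (g x - clip N (g x)) powr q) \<partial>lborel) < ennreal \<delta>"
    by (auto simp: eventually_sequentially)
  then show ?thesis using that[of N] by (simp add: less_imp_le)
qed

text \<open>A measurable function is almost everywhere a limit of continuous functions. Clipping at
  level N and a cut-off vanishing beyond radius R + 1 provide a common bounded majorant with compact
  support; they leave the limit as it is, since \<open>g\<close> is bounded by N and vanishes beyond
  R.\<close>

lemma Lp_continuous_approx:
  fixes g :: "'a::euclidean_space \<Rightarrow> complex"
  assumes g [measurable]: "g \<in> borel_measurable borel" and q: "q > 0" and \<delta>: "\<delta> > 0"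
    and N: "\<And>x. norm (g x) \<le> real N" and R: "\<And>x. norm x > R \<Longrightarrow> g x = 0"
  obtains g' where "continuous_on UNIV g'" "bounded (range g')"
    "(\<integral>\<^sup>+x. ennreal (norm (g x - g' x) powr q) \<partial>lborel) \<le> ennreal \<delta>"
proof -
  have "g \<in> borel_measurable lebesgue" by (rule measurable_completion) simp
  then have "g measurable_on UNIV" by (rule lebesgue_measurable_imp_measurable_on) simp
  then obtain S G where S: "negligible S" and G: "\<And>n. continuous_on UNIV (G n)" "\<And>x. x \<notin> S \<Longrightarrow> (\<lambda>n. G n x) \<longlonglongrightarrow> g x"
    unfolding measurable_on_def by auto
  define cut where "cut x = max 0 (min 1 (R + 1 - norm x))" for x :: 'a
  define g' where "g' n x = of_real (cut x) * clip N (G n x)" for n x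
  have g'c: "continuous_on UNIV (g' n)" for n
    unfolding g'_def cut_def
    by (intro continuous_intros continuous_on_compose2[OF continuous_on_clip[of UNIV] G(1)]) auto
  then have g'm: "g' n \<in> borel_measurable borel" for n by (rule borel_measurable_continuous_onI)
  have cut: "0 \<le> cut x" "cut x \<le> 1" for x by (auto simp: cut_def)
  have g'N: "norm (g' n x) \<le> real N" for n x
    unfolding g'_def norm_mult norm_of_real using cut[of x] norm_clip_le[of N "G n x"]
    by (metis abs_of_nonneg mult_left_le_one_le norm_ge_zero order_trans)
  have "AE x in lebesgue. x \<notin> S"
    using S by (intro AE_not_in) (simp add: negligible_iff_null_sets)
  then have AE: "AE x in lborel. x \<notin> S" by (simp add: AE_completion_iff)
  have "(\<lambda>n. \<integral>\<^sup>+x. ennreal (norm (g x - g' n x) powr q) \<partial>lborel) \<longlonglongrightarrow> (\<integral>\<^sup>+(x::'a). 0 \<partial>lborel)"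
  proof (rule nn_integral_dominated_convergence)
    show "AE x in lborel. ennreal (norm (g x - g' n x) powr q) \<le> ennreal ((2 * real N) powr q) * indicator (cball 0 (R + 1)) x" for n
    proof (rule AE_I2)
      fix x
      show "ennreal (norm (g x - g' n x) powr q) \<le> ennreal ((2 * real N) powr q) * indicator (cball 0 (R + 1)) x"
      proof (cases "norm x \<le> R + 1")
        case True
        have "norm (g x - g' n x) \<le> 2 * real N"
          using norm_triangle_ineq4[of "g x" "g' n x"] N[of x] g'N[of n x] by linarith
        then have "norm (g x - g' n x) powr q \<le> (2 * real N) powr q" using q by (intro powr_mono2) auto
        then show ?thesis using True by (simp add: ennreal_leI)
      next
        case False
        then have "g x = 0" "cut x = 0" using R[of x] by (auto simp: cut_def)
        then show ?thesis by (simp add: g'_def)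
      qed
    qed
    show "(\<integral>\<^sup>+x. ennreal ((2 * real N) powr q) * indicator (cball 0 (R + 1)) (x :: 'a) \<partial>lborel) < \<infinity>"
      using emeasure_lborel_cball_finite[of "0 :: 'a" "R + 1"]
      by (subst nn_integral_cmult_indicator) (auto simp: ennreal_mult_less_top)
    show "AE x in lborel. (\<lambda>n. ennreal (norm (g x - g' n x) powr q)) \<longlonglongrightarrow> 0"
      using AE
    proof eventually_elim
      case (elim x)
      have "(\<lambda>n. clip N (G n x)) \<longlonglongrightarrow> clip N (g x)"
        by (rule continuous_on_tendsto_compose[OF continuous_on_clip[of UNIV] G(2)[OF elim]]) auto
      then have "(\<lambda>n. g x - g' n x) \<longlonglongrightarrow> g x - of_real (cut x) * clip N (g x)"
        unfolding g'_def by (intro tendsto_intros)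
      also have "g x - of_real (cut x) * clip N (g x) = 0"
      proof (cases "norm x \<le> R")
        case True
        then show ?thesis by (simp add: cut_def clip_eq N)
      next
        case False
        then show ?thesis by (simp add: R clip_eq)
      qed
      finally have "(\<lambda>n. norm (g x - g' n x)) \<longlonglongrightarrow> 0" by (rule tendsto_norm_zero)
      then have "(\<lambda>n. norm (g x - g' n x) powr q) \<longlonglongrightarrow> 0"
        by (rule tendsto_zero_powrI[OF _ tendsto_const]) (use q in auto)
      then show ?case using tendsto_ennrealI[of "\<lambda>n. norm (g x - g' n x) powr q" 0] by simp
    qed
    show "(\<lambda>x. ennreal (norm (g x - g' n x) powr q)) \<in> borel_measurable lborel" for n
      using g g'm[of n] by simp
    show "(\<lambda>x::'a. ennreal ((2 * real N) powr q) * indicator (cball 0 (R + 1)) x) \<in> borel_measurable lborel"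
      by (intro borel_measurable_times_ennreal borel_measurable_const borel_measurable_indicator) simp
  qed simp
  then have "(\<lambda>n. \<integral>\<^sup>+x. ennreal (norm (g x - g' n x) powr q) \<partial>lborel) \<longlonglongrightarrow> 0" by simp
  then have "\<forall>\<^sub>F n in sequentially. (\<integral>\<^sup>+x. ennreal (norm (g x - g' n x) powr q) \<partial>lborel) < ennreal \<delta>"
    by (rule order_tendstoD) (use \<delta> in simp)
  then obtain n where "(\<integral>\<^sup>+x. ennreal (norm (g x - g' n x) powr q) \<partial>lborel) < ennreal \<delta>"
    by (auto simp: eventually_sequentially)
  moreover have "bounded (range (g' n))" using g'N by (auto simp: bounded_iff)
  ultimately show ?thesis using that[of "g' n"] g'c by (simp add: less_imp_le)
qed

text \<open>\<open>f\<close> pairs continuously with \<open>L\<^sub>q\<close>; stated without reference to the norm of the dual space.\<close>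

definition pairing :: "('a::euclidean_space \<Rightarrow> complex) \<Rightarrow> real \<Rightarrow> bool" where
  "pairing f q \<longleftrightarrow> (\<forall>\<epsilon>>0. \<exists>\<delta>>0. \<forall>h\<in>borel_measurable borel.
     (\<integral>\<^sup>+x. ennreal (norm (h x :: complex) powr q) \<partial>lborel) \<le> ennreal \<delta> \<longrightarrow>
     (\<integral>\<^sup>+x. ennreal (norm (f x) * norm (h x)) \<partial>lborel) \<le> ennreal \<epsilon>)"

text \<open>Truncation and continuous approximation each make an error that is small in L_q, and
  pairing with \<open>f\<close> turns it into at most \<epsilon>/2. The L_q size of an error is
  invariant under translation, whence uniformity in the shift.\<close>

lemma pairing_translation_approximable:
  fixes f g :: "'a::euclidean_space \<Rightarrow> complex"
  assumes [measurable]: "f \<in> borel_measurable borel" "g \<in> borel_measurable borel" and q: "q > 0"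
    and fin: "(\<integral>\<^sup>+x. ennreal (norm (g x) powr q) \<partial>lborel) < \<infinity>" and R: "\<And>x. norm x > R \<Longrightarrow> g x = 0"
    and pair: "pairing f q"
  shows "translation_approximable f g"
  unfolding translation_approximable_def
proof (intro allI impI)
  fix \<epsilon> :: real assume \<epsilon>: "\<epsilon> > 0"
  then have "\<epsilon> / 2 > 0" by simp
  from pair[unfolded pairing_def, rule_format, OF this] obtain \<delta> where \<delta>0: "\<delta> > 0" and
    pair': "\<forall>h\<in>borel_measurable borel. (\<integral>\<^sup>+x. ennreal (norm (h x :: complex) powr q) \<partial>lborel) \<le> ennreal \<delta> \<longrightarrow>
     (\<integral>\<^sup>+x. ennreal (norm (f x) * norm (h x)) \<partial>lborel) \<le> ennreal (\<epsilon> / 2)"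
    by blast
  note \<delta> = \<delta>0 pair'[rule_format]
  obtain N where N: "(\<integral>\<^sup>+x. ennreal (norm (g x - clip N (g x)) powr q) \<partial>lborel) \<le> ennreal \<delta>"
    by (rule Lp_truncate[OF assms(2) q fin \<delta>(1)]) (rule that)
  obtain g' where g': "continuous_on UNIV g'" "bounded (range g')"
    "(\<integral>\<^sup>+x. ennreal (norm (clip N (g x) - g' x) powr q) \<partial>lborel) \<le> ennreal \<delta>"
  proof (rule Lp_continuous_approx[of "\<lambda>x. clip N (g x)" q \<delta> N R])
    show "(\<lambda>x. clip N (g x)) \<in> borel_measurable borel" by measurable
    show "norm x > R \<Longrightarrow> clip N (g x) = 0" for x by (simp add: R clip_eq)
  qed (use q \<delta>(1) norm_clip_le that in auto)
  have [measurable]: "g' \<in> borel_measurable borel" by (rule borel_measurable_continuous_onI[OF g'(1)])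
  have small: "(\<integral>\<^sup>+x. ennreal (norm (f x) * norm (h (a + x))) \<partial>lborel) \<le> ennreal (\<epsilon> / 2)"
    if [measurable]: "h \<in> borel_measurable borel" and h: "(\<integral>\<^sup>+x. ennreal (norm (h x :: complex) powr q) \<partial>lborel) \<le> ennreal \<delta>" for h a
  proof (rule \<delta>(2))
    show "(\<integral>\<^sup>+x. ennreal (norm (h (a + x)) powr q) \<partial>lborel) \<le> ennreal \<delta>"
      using nn_integral_translate[of "\<lambda>x. ennreal (norm (h x) powr q)" a] h by simp
  qed measurable
  have "integrable lborel (\<lambda>x. f x * (g (a + x) - g' (a + x))) \<and>
      (LINT x|lborel. norm (f x * (g (a + x) - g' (a + x)))) \<le> \<epsilon>" for a
  proof -
    have "(\<integral>\<^sup>+x. ennreal (norm (f x * (g (a + x) - g' (a + x)))) \<partial>lborel) \<le>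
        (\<integral>\<^sup>+x. ennreal (norm (f x) * norm (g (a + x) - clip N (g (a + x)))) +
          ennreal (norm (f x) * norm (clip N (g (a + x)) - g' (a + x))) \<partial>lborel)"
    proof (rule nn_integral_mono)
      fix x
      have "norm (g (a + x) - g' (a + x)) \<le> norm (g (a + x) - clip N (g (a + x))) + norm (clip N (g (a + x)) - g' (a + x))"
        using norm_triangle_ineq[of "g (a + x) - clip N (g (a + x))" "clip N (g (a + x)) - g' (a + x)"] by simp
      then have "norm (f x * (g (a + x) - g' (a + x))) \<le>
          norm (f x) * (norm (g (a + x) - clip N (g (a + x))) + norm (clip N (g (a + x)) - g' (a + x)))"
        unfolding norm_mult by (intro mult_left_mono) auto
      then show "ennreal (norm (f x * (g (a + x) - g' (a + x)))) \<le>
          ennreal (norm (f x) * norm (g (a + x) - clip N (g (a + x)))) +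
          ennreal (norm (f x) * norm (clip N (g (a + x)) - g' (a + x)))"
        by (simp add: distrib_left flip: ennreal_plus)
    qed
    also have "\<dots> = (\<integral>\<^sup>+x. ennreal (norm (f x) * norm (g (a + x) - clip N (g (a + x)))) \<partial>lborel) +
          (\<integral>\<^sup>+x. ennreal (norm (f x) * norm (clip N (g (a + x)) - g' (a + x))) \<partial>lborel)"
      by (rule nn_integral_add) measurable
    also have "\<dots> \<le> ennreal (\<epsilon> / 2) + ennreal (\<epsilon> / 2)"
      using small[of "\<lambda>x. g x - clip N (g x)" a] small[of "\<lambda>x. clip N (g x) - g' x" a] N g'(3) by (intro add_mono) auto
    also have "\<dots> = ennreal \<epsilon>" using \<epsilon> by (simp flip: ennreal_plus)
    finally have le: "(\<integral>\<^sup>+x. ennreal (norm (f x * (g (a + x) - g' (a + x)))) \<partial>lborel) \<le> ennreal \<epsilon>" .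
    have int: "integrable lborel (\<lambda>x. f x * (g (a + x) - g' (a + x)))"
      by (rule integrableI_bounded) (measurable, rule le_less_trans[OF le], simp)
    moreover have "ennreal (LINT x|lborel. norm (f x * (g (a + x) - g' (a + x)))) \<le> ennreal \<epsilon>"
      using le nn_integral_eq_integral[OF integrable_norm[OF int]] by simp
    ultimately show ?thesis using \<epsilon> by (simp add: ennreal_le_iff)
  qed
  then show "\<exists>g'. continuous_on UNIV g' \<and> bounded (range g') \<and>
     (\<forall>a. integrable lborel (\<lambda>x. f x * (g (a + x) - g' (a + x))) \<and>
        (LINT x|lborel. norm (f x * (g (a + x) - g' (a + x)))) \<le> \<epsilon>)"
    using g'(1,2) by blast
qed

lemma pairing_bounded:
  assumes "AE x in lborel. norm (f x) \<le> B" shows "pairing f 1"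
  unfolding pairing_def
proof (intro allI impI)
  fix \<epsilon> :: real assume \<epsilon>: "\<epsilon> > 0"
  \<comment> \<open>Strictly positive, so that \<delta> = \<epsilon> / C makes sense even for B =
    0.\<close>
  define C where "C = \<bar>B\<bar> + 1"
  have C: "C > 0" "B \<le> C" by (auto simp: C_def)
  show "\<exists>\<delta>>0. \<forall>h\<in>borel_measurable borel.
     (\<integral>\<^sup>+x. ennreal (norm (h x :: complex) powr 1) \<partial>lborel) \<le> ennreal \<delta> \<longrightarrow>
     (\<integral>\<^sup>+x. ennreal (norm (f x) * norm (h x)) \<partial>lborel) \<le> ennreal \<epsilon>"
  proof (intro exI[of _ "\<epsilon> / C"] conjI ballI impI)
    show "\<epsilon> / C > 0" using \<epsilon> C by simp
    fix h :: "'a \<Rightarrow> complex" assume [measurable]: "h \<in> borel_measurable borel"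
      and h: "(\<integral>\<^sup>+x. ennreal (norm (h x) powr 1) \<partial>lborel) \<le> ennreal (\<epsilon> / C)"
    have "(\<integral>\<^sup>+x. ennreal (norm (f x) * norm (h x)) \<partial>lborel) \<le> (\<integral>\<^sup>+x. ennreal C * ennreal (norm (h x) powr 1) \<partial>lborel)"
    proof (rule nn_integral_mono_AE)
      show "AE x in lborel. ennreal (norm (f x) * norm (h x)) \<le> ennreal C * ennreal (norm (h x) powr 1)"
        using assms
      proof eventually_elim
        case (elim x)
        then have "norm (f x) * norm (h x) \<le> C * norm (h x)" using C by (intro mult_right_mono) auto
        then show ?case using C by (simp flip: ennreal_mult)
      qed
    qed
    also have "\<dots> = ennreal C * (\<integral>\<^sup>+x. ennreal (norm (h x) powr 1) \<partial>lborel)"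
      by (rule nn_integral_cmult) measurable
    also have "\<dots> \<le> ennreal C * ennreal (\<epsilon> / C)" using h by (intro mult_left_mono) auto
    also have "\<dots> = ennreal \<epsilon>" using C \<epsilon> by (simp flip: ennreal_mult)
    finally show "(\<integral>\<^sup>+x. ennreal (norm (f x) * norm (h x)) \<partial>lborel) \<le> ennreal \<epsilon>" .
  qed
qed

text \<open>A variant of Young's inequality with constant 1: if m is the larger of a^p and b^q, then
  a b \<le> m^(1/p) m^(1/q) = m^(1/r). It covers Hoelder's inequality, as far as finiteness goes,
  for every positive r.\<close>

lemma mult_powr_le:
  fixes a b p q r :: real
  assumes ab: "0 \<le> a" "0 \<le> b" and pos: "0 < p" "0 < q" "0 < r" and r: "1 / r = 1 / p + 1 / q"
  shows "(a * b) powr r \<le> a powr p + b powr q"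
proof -
  define m where "m = max (a powr p) (b powr q)"
  have m: "0 \<le> m" by (simp add: m_def le_max_iff_disj)
  have "a = (a powr p) powr (1 / p)" "b = (b powr q) powr (1 / q)" using ab pos by (simp_all add: powr_powr)
  moreover have "(a powr p) powr (1 / p) \<le> m powr (1 / p)" "(b powr q) powr (1 / q) \<le> m powr (1 / q)"
    using pos by (intro powr_mono2; simp add: m_def)+
  ultimately have "a * b \<le> m powr (1 / p) * m powr (1 / q)"
    using ab by (intro mult_mono) auto
  also have "\<dots> = m powr (1 / r)" by (simp add: r powr_add)
  finally have "(a * b) powr r \<le> (m powr (1 / r)) powr r" using ab pos by (intro powr_mono2) auto
  also have "\<dots> = m" using m pos by (simp add: powr_powr)
  also have "m \<le> a powr p + b powr q" by (simp add: m_def)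
  finally show ?thesis .
qed

text \<open>The preceding inequality with r = 1 is applied to |f|/t and t|h|: the term with
  \<open>f\<close> becomes F/T, at most \<epsilon>/2 by the choice of t, after which \<delta> makes
  the term with h small.\<close>

lemma pairing_Lp:
  fixes f :: "'a::euclidean_space \<Rightarrow> complex"
  assumes [measurable]: "f \<in> borel_measurable borel" and pq: "0 < p" "0 < q" "1 / p + 1 / q = 1"
    and fin: "(\<integral>\<^sup>+x. ennreal (norm (f x) powr p) \<partial>lborel) < \<infinity>"
  shows "pairing f q"
  unfolding pairing_def
proof (intro allI impI)
  fix \<epsilon> :: real assume \<epsilon>: "\<epsilon> > 0"
  obtain F where F: "F \<ge> 0" "(\<integral>\<^sup>+x. ennreal (norm (f x) powr p) \<partial>lborel) = ennreal F"
    using fin by (cases "\<integral>\<^sup>+x. ennreal (norm (f x) powr p) \<partial>lborel") auto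
  \<comment> \<open>T will be t^p. Its first summand gives F/T \<le> \<epsilon>/2, and the summand 1
    keeps it positive when F = 0.\<close>
  define T where "T = 2 * F / \<epsilon> + 1"
  have T: "T > 0" using F(1) \<epsilon> by (simp add: T_def add_nonneg_pos)
  define t where "t = T powr (1 / p)"
  have t: "t > 0" "t powr p = T" using T pq by (simp_all add: t_def powr_powr)
  have FT: "F / T \<le> \<epsilon> / 2" using F(1) \<epsilon> T by (simp add: T_def field_simps)
  show "\<exists>\<delta>>0. \<forall>h\<in>borel_measurable borel.
     (\<integral>\<^sup>+x. ennreal (norm (h x :: complex) powr q) \<partial>lborel) \<le> ennreal \<delta> \<longrightarrow>
     (\<integral>\<^sup>+x. ennreal (norm (f x) * norm (h x)) \<partial>lborel) \<le> ennreal \<epsilon>"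
  proof (intro exI[of _ "\<epsilon> / 2 / t powr q"] conjI ballI impI)
    show "\<epsilon> / 2 / t powr q > 0" using \<epsilon> t by simp
    fix h :: "'a \<Rightarrow> complex" assume [measurable]: "h \<in> borel_measurable borel"
      and h: "(\<integral>\<^sup>+x. ennreal (norm (h x) powr q) \<partial>lborel) \<le> ennreal (\<epsilon> / 2 / t powr q)"
    have "(\<integral>\<^sup>+x. ennreal (norm (f x) * norm (h x)) \<partial>lborel) \<le>
        (\<integral>\<^sup>+x. ennreal (1 / T) * ennreal (norm (f x) powr p) + ennreal (t powr q) * ennreal (norm (h x) powr q) \<partial>lborel)"
    proof (rule nn_integral_mono)
      fix x
      have "norm (f x) * norm (h x) = (norm (f x) / t * (t * norm (h x))) powr 1" using t by simp
      also have "\<dots> \<le> (norm (f x) / t) powr p + (t * norm (h x)) powr q"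
        using t pq by (intro mult_powr_le) auto
      also have "\<dots> = 1 / T * norm (f x) powr p + t powr q * norm (h x) powr q"
        using t by (simp add: powr_divide powr_mult)
      finally show "ennreal (norm (f x) * norm (h x)) \<le>
          ennreal (1 / T) * ennreal (norm (f x) powr p) + ennreal (t powr q) * ennreal (norm (h x) powr q)"
        using T by (simp add: ennreal_leI flip: ennreal_mult ennreal_plus)
    qed
    also have "\<dots> = ennreal (1 / T) * ennreal F + ennreal (t powr q) * (\<integral>\<^sup>+x. ennreal (norm (h x) powr q) \<partial>lborel)"
      unfolding F(2)[symmetric] by (subst nn_integral_add) (auto simp: nn_integral_cmult)
    also have "\<dots> \<le> ennreal (1 / T) * ennreal F + ennreal (t powr q) * ennreal (\<epsilon> / 2 / t powr q)"
      using h by (intro add_left_mono mult_left_mono) auto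
    also have "\<dots> = ennreal (F / T + \<epsilon> / 2)"
      using T F(1) t \<epsilon> by (simp flip: ennreal_mult ennreal_plus)
    also have "\<dots> \<le> ennreal \<epsilon>" using FT by (intro ennreal_leI) linarith
    finally show "(\<integral>\<^sup>+x. ennreal (norm (f x) * norm (h x)) \<partial>lborel) \<le> ennreal \<epsilon>" .
  qed
qed

section \<open>Local Lebesgue spaces\<close>

text \<open>Finiteness of \<open>Lp_norm\<close>, freed of the outer root and of the essential
  supremum: real exponents and almost everywhere bounds are what the estimates work with.\<close>

definition Lp_mem :: "'a measure \<Rightarrow> ennreal \<Rightarrow> ('a \<Rightarrow> complex) \<Rightarrow> bool" where
  "Lp_mem N p f \<longleftrightarrow> (if p = \<infinity> then \<exists>B. AE x in N. norm (f x) \<le> B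
     else (\<integral>\<^sup>+x. ennreal (norm (f x) powr enn2real p) \<partial>N) < \<infinity>)"

lemma Lp_norm_finite_iff:
  assumes [measurable]: "f \<in> borel_measurable N" and "0 < p"
  shows "Lp_norm N p (\<lambda>x. ennreal (norm (f x))) < \<infinity> \<longleftrightarrow> Lp_mem N p f"
proof (cases "p = \<infinity>")
  case True
  have "esssup N (\<lambda>x. ennreal (norm (f x))) < \<infinity> \<longleftrightarrow> (\<exists>B. AE x in N. norm (f x) \<le> B)"
  proof
    assume "esssup N (\<lambda>x. ennreal (norm (f x))) < \<infinity>"
    then obtain B where B: "B \<ge> 0" "esssup N (\<lambda>x. ennreal (norm (f x))) = ennreal B"
      by (cases "esssup N (\<lambda>x. ennreal (norm (f x)))") auto
    have "AE x in N. norm (f x) \<le> B"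
      using esssup_AE[of "\<lambda>x. ennreal (norm (f x))" N] unfolding B(2) using B(1) by (simp add: ennreal_le_iff)
    then show "\<exists>B. AE x in N. norm (f x) \<le> B" by blast
  next
    assume "\<exists>B. AE x in N. norm (f x) \<le> B"
    then obtain B where B: "AE x in N. norm (f x) \<le> B" by blast
    have "esssup N (\<lambda>x. ennreal (norm (f x))) \<le> ennreal B"
      by (rule esssup_I) (use B in \<open>auto intro: ennreal_leI elim!: eventually_mono\<close>)
    then show "esssup N (\<lambda>x. ennreal (norm (f x))) < \<infinity>" by (rule le_less_trans) simp
  qed
  then show ?thesis using True by (simp add: Lp_norm_def Lp_mem_def)
next
  case False
  then show ?thesis by (auto simp: Lp_norm_def Lp_mem_def ennreal_powr_def less_top)
qed

lemma Lp_mem_cong_AE: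
  assumes "AE x in N. f x = g x" "Lp_mem N p f" shows "Lp_mem N p g"
proof (cases "p = \<infinity>")
  case True
  then obtain B where "AE x in N. norm (f x) \<le> B" using assms(2) by (auto simp: Lp_mem_def)
  with assms(1) have "AE x in N. norm (g x) \<le> B" by eventually_elim simp
  then show ?thesis using True by (auto simp: Lp_mem_def)
next
  case False
  have "(\<integral>\<^sup>+x. ennreal (norm (f x) powr enn2real p) \<partial>N) = (\<integral>\<^sup>+x. ennreal (norm (g x) powr enn2real p) \<partial>N)"
    by (rule nn_integral_cong_AE) (use assms(1) in \<open>eventually_elim, simp\<close>)
  then show ?thesis using False assms(2) by (simp add: Lp_mem_def)
qed

lemma ennreal_exponent_cases:
  fixes p :: ennreal
  assumes "0 < p" "p \<noteq> \<infinity>"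
  shows "0 < enn2real p" "inverse p = ennreal (1 / enn2real p)"
proof -
  obtain p' where p: "p = ennreal p'" "p' \<ge> 0" using assms(2) by (cases p) auto
  then have "p' > 0" using assms(1) by (auto simp: zero_less_iff_neq_zero ennreal_eq_0_iff)
  then show "0 < enn2real p" "inverse p = ennreal (1 / enn2real p)"
    using p by (simp_all add: inverse_ennreal divide_inverse)
qed

lemma Lp_mem_mult_bounded:
  assumes "AE x in N. norm (f x) \<le> B" "Lp_mem N q g" and [measurable]: "g \<in> borel_measurable N" and "0 < q"
  shows "Lp_mem N q (\<lambda>x. f x * g x)"
proof (cases "q = \<infinity>")
  case True
  then obtain C where "AE x in N. norm (g x) \<le> C" using assms(2) by (auto simp: Lp_mem_def)
  with assms(1) have "AE x in N. norm (f x * g x) \<le> B * C"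
  proof eventually_elim
    case (elim x)
    have "0 \<le> B" using elim(1) norm_ge_zero order_trans by blast
    then show ?case unfolding norm_mult using elim by (intro mult_mono) auto
  qed
  then show ?thesis using True by (auto simp: Lp_mem_def)
next
  case False
  have q: "0 < enn2real q" by (rule ennreal_exponent_cases(1)[OF assms(4) False])
  have "(\<integral>\<^sup>+x. ennreal (norm (f x * g x) powr enn2real q) \<partial>N) \<le>
      (\<integral>\<^sup>+x. ennreal (\<bar>B\<bar> powr enn2real q) * ennreal (norm (g x) powr enn2real q) \<partial>N)"
  proof (rule nn_integral_mono_AE)
    show "AE x in N. ennreal (norm (f x * g x) powr enn2real q) \<le> ennreal (\<bar>B\<bar> powr enn2real q) * ennreal (norm (g x) powr enn2real q)"
      using assms(1)
    proof eventually_elim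
      case (elim x)
      have "norm (f x) powr enn2real q \<le> \<bar>B\<bar> powr enn2real q" using elim q by (intro powr_mono2) auto
      then show ?case
        by (simp add: norm_mult powr_mult mult_right_mono ennreal_leI flip: ennreal_mult)
    qed
  qed
  also have "\<dots> = ennreal (\<bar>B\<bar> powr enn2real q) * (\<integral>\<^sup>+x. ennreal (norm (g x) powr enn2real q) \<partial>N)"
    by (rule nn_integral_cmult) measurable
  also have "\<dots> < \<infinity>" using assms(2) False by (simp add: Lp_mem_def ennreal_mult_less_top)
  finally show ?thesis using False by (simp add: Lp_mem_def)
qed

text \<open>For finite exponents \<open>mult_powr_le\<close> is integrated; the cases p =
  \<infinity> and q = \<infinity> are multiplication by an essentially bounded function. Finiteness
  alone is at stake, so no norm inequality is tracked.\<close>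

lemma Lp_mem_mult:
  assumes [measurable]: "f \<in> borel_measurable N" "g \<in> borel_measurable N"
    and f: "Lp_mem N p f" and g: "Lp_mem N q g" and pos: "0 < p" "0 < q" "0 < r" and r: "inverse r = inverse p + inverse q"
  shows "Lp_mem N r (\<lambda>x. f x * g x)"
proof -
  \<comment> \<open>Inversion is an involution of \<open>ennreal\<close>, including 0 and
    \<infinity>; with p = \<infinity> the relation of the exponents therefore reads r = q.\<close>
  have inv: "inverse (inverse a) = a" for a :: ennreal
  proof (cases a)
    case (real x)
    then show ?thesis by (cases "x = 0") (simp_all add: inverse_ennreal)
  qed simp
  have inj: "a = b" if "inverse a = inverse b" for a b :: ennreal
    by (metis inv that)
  consider "p = \<infinity>" | "q = \<infinity>" | "p \<noteq> \<infinity>" "q \<noteq> \<infinity>" by blast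
  then show ?thesis
  proof cases
    case 1
    then have "r = q" using inj[of r q] r by simp
    moreover obtain B where "AE x in N. norm (f x) \<le> B" using f 1 by (auto simp: Lp_mem_def)
    ultimately show ?thesis using Lp_mem_mult_bounded[OF _ g assms(2) pos(2)] by simp
  next
    case 2
    then have "r = p" using inj[of r p] r by simp
    moreover obtain B where "AE x in N. norm (g x) \<le> B" using g 2 by (auto simp: Lp_mem_def)
    ultimately show ?thesis using Lp_mem_mult_bounded[OF _ f assms(1) pos(1), of g] by (simp add: mult.commute)
  next
    case 3
    note p = ennreal_exponent_cases[OF pos(1) 3(1)] and q = ennreal_exponent_cases[OF pos(2) 3(2)]
    have s: "inverse r = ennreal (1 / enn2real p + 1 / enn2real q)"
      unfolding r p(2) q(2) using p(1) q(1) by (simp flip: ennreal_plus)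
    have "0 < 1 / enn2real p + 1 / enn2real q" using p(1) q(1) by (intro add_pos_pos) auto
    then have "inverse r \<noteq> 0" unfolding s by (simp only: ennreal_eq_0_iff not_le)
    then have r': "r \<noteq> \<infinity>" by auto
    note r2 = ennreal_exponent_cases[OF pos(3) r']
    have eq: "1 / enn2real r = 1 / enn2real p + 1 / enn2real q"
      using s p(1) q(1) r2(1) unfolding r2(2) by (subst (asm) ennreal_inj) auto
    have "(\<integral>\<^sup>+x. ennreal (norm (f x * g x) powr enn2real r) \<partial>N) \<le>
        (\<integral>\<^sup>+x. ennreal (norm (f x) powr enn2real p) + ennreal (norm (g x) powr enn2real q) \<partial>N)"
      using mult_powr_le[OF _ _ p(1) q(1) r2(1) eq]
      by (intro nn_integral_mono) (simp add: norm_mult ennreal_leI flip: ennreal_plus)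
    also have "\<dots> = (\<integral>\<^sup>+x. ennreal (norm (f x) powr enn2real p) \<partial>N) + (\<integral>\<^sup>+x. ennreal (norm (g x) powr enn2real q) \<partial>N)"
      by (rule nn_integral_add) measurable
    also have "\<dots> < \<infinity>" using f g 3 by (simp add: Lp_mem_def)
    finally show ?thesis using r' by (simp add: Lp_mem_def)
  qed
qed

text \<open>t^s \<le> 1 + t^p for 0 < s \<le> p, and the constant 1 is integrable over the ball
  outside which \<open>f\<close> vanishes.\<close>

lemma Lp_mem_lower:
  fixes f :: "'a::euclidean_space \<Rightarrow> complex"
  assumes [measurable]: "f \<in> borel_measurable borel" and R: "\<And>x. norm x > R \<Longrightarrow> f x = 0"
    and fin: "(\<integral>\<^sup>+x. ennreal (norm (f x) powr p) \<partial>lborel) < \<infinity>" and s: "0 < s" "s \<le> p"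
  shows "(\<integral>\<^sup>+x. ennreal (norm (f x) powr s) \<partial>lborel) < \<infinity>"
proof -
  have "(\<integral>\<^sup>+x. ennreal (norm (f x) powr s) \<partial>lborel) \<le>
      (\<integral>\<^sup>+x. indicator (cball 0 R) x + ennreal (norm (f x) powr p) \<partial>lborel)"
  proof (rule nn_integral_mono)
    fix x
    show "ennreal (norm (f x) powr s) \<le> indicator (cball 0 R) x + ennreal (norm (f x) powr p)"
    proof (cases "norm x \<le> R")
      case True
      have "norm (f x) powr s \<le> 1 + norm (f x) powr p"
      proof (cases "norm (f x) \<le> 1")
        case True
        then have "norm (f x) powr s \<le> 1" using s by (intro powr_le1) auto
        then show ?thesis by (simp add: add_increasing2)
      next
        case False
        then have "norm (f x) powr s \<le> norm (f x) powr p" using s by (intro powr_mono) auto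
        then show ?thesis by simp
      qed
      then have "ennreal (norm (f x) powr s) \<le> ennreal (1 + norm (f x) powr p)" by (rule ennreal_leI)
      also have "\<dots> = 1 + ennreal (norm (f x) powr p)" by simp
      finally have "ennreal (norm (f x) powr s) \<le> 1 + ennreal (norm (f x) powr p)" .
      then show ?thesis using True by simp
    qed (simp add: R)
  qed
  also have "\<dots> = emeasure lborel (cball (0::'a) R) + (\<integral>\<^sup>+x. ennreal (norm (f x) powr p) \<partial>lborel)"
    by (subst nn_integral_add) (auto intro: borel_measurable_indicator)
  also have "\<dots> < \<infinity>" using fin emeasure_lborel_cball_finite[of "0::'a" R] by simp
  finally show ?thesis .
qed

lemma integrable_if_Lp_mem:
  fixes f :: "'a::euclidean_space \<Rightarrow> complex"
  assumes [measurable]: "f \<in> borel_measurable borel" and R: "\<And>x. norm x > R \<Longrightarrow> f x = 0"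
    and f: "Lp_mem lborel p f" and p: "0 < p" "inverse p \<le> 1"
  shows "integrable lborel f"
proof (cases "p = \<infinity>")
  case True
  then obtain B where B: "AE x in lborel. norm (f x) \<le> B" using f by (auto simp: Lp_mem_def)
  have "integrable lborel (\<lambda>x. indicator (cball 0 R) x *\<^sub>R B)" by (intro borel_integrable_compact) auto
  then show ?thesis
  proof (rule Bochner_Integration.integrable_bound)
    show "AE x in lborel. norm (f x) \<le> norm (indicator (cball 0 R) x *\<^sub>R B)"
      using B
    proof eventually_elim
      case (elim x)
      then show ?case using R[of x] by (cases "norm x \<le> R") auto
    qed
  qed measurable
next
  case False
  note e = ennreal_exponent_cases[OF p(1) False]
  have "1 / enn2real p \<le> 1" using p(2) unfolding e(2) by simp
  then have p1: "1 \<le> enn2real p" using e(1) by (simp add: field_simps)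
  have "(\<integral>\<^sup>+x. ennreal (norm (f x) powr 1) \<partial>lborel) < \<infinity>"
    by (rule Lp_mem_lower[where R = R and p = "enn2real p"]) (use f False R p1 in \<open>auto simp: Lp_mem_def\<close>)
  then show ?thesis by (intro integrableI_bounded) auto
qed

text \<open>The approximated factor must be measured with a finite exponent, hence the disjunction.
  If p = \<infinity>, \<open>f\<close> is bounded and \<open>g\<close>, living on a ball, lies in
  L_1; q = \<infinity> is symmetric; for finite exponents the exponent of \<open>f\<close> is
  lowered to the one conjugate to q.\<close>

lemma Lp_translation_approximable:
  fixes f g :: "'a::euclidean_space \<Rightarrow> complex"
  assumes mf: "f \<in> borel_measurable borel" and mg: "g \<in> borel_measurable borel"
    and Rf: "\<And>x. norm x > R \<Longrightarrow> f x = 0" and Rg: "\<And>x. norm x > R \<Longrightarrow> g x = 0"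
    and f: "Lp_mem lborel p f" and g: "Lp_mem lborel q g"
    and p: "0 < p" "0 < q" "inverse p + inverse q \<le> 1"
  shows "translation_approximable f g \<or> translation_approximable g f"
proof -
  have le: "inverse p \<le> 1" "inverse q \<le> 1"
    by (rule order_trans[OF _ p(3)], simp)+
  have L1: "(\<integral>\<^sup>+x. ennreal (norm (h x) powr 1) \<partial>lborel) < \<infinity>" if "integrable lborel h" for h :: "'a \<Rightarrow> complex"
    using that by (auto simp: integrable_iff_bounded)
  consider "p = \<infinity>" | "q = \<infinity>" | "p \<noteq> \<infinity>" "q \<noteq> \<infinity>" by blast
  then show ?thesis
  proof cases
    case 1
    then obtain B where "AE x in lborel. norm (f x) \<le> B" using f by (auto simp: Lp_mem_def)
    then have "translation_approximable f g"
      using L1[OF integrable_if_Lp_mem[OF mg Rg g p(2) le(2)]]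
      by (intro pairing_translation_approximable[OF mf mg zero_less_one _ Rg] pairing_bounded)
    then show ?thesis ..
  next
    case 2
    then obtain B where "AE x in lborel. norm (g x) \<le> B" using g by (auto simp: Lp_mem_def)
    then have "translation_approximable g f"
      using L1[OF integrable_if_Lp_mem[OF mf Rf f p(1) le(1)]]
      by (intro pairing_translation_approximable[OF mg mf zero_less_one _ Rf] pairing_bounded)
    then show ?thesis ..
  next
    case 3
    note p' = ennreal_exponent_cases[OF p(1) 3(1)] and q' = ennreal_exponent_cases[OF p(2) 3(2)]
    \<comment> \<open>The exponent conjugate to q. Since 1/p is positive, q exceeds 1 and s is well
      defined; 1/p + 1/q \<le> 1 gives s \<le> p.\<close>
    define s where "s = 1 / (1 - 1 / enn2real q)"
    have "ennreal (1 / enn2real p + 1 / enn2real q) \<le> ennreal 1"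
      using p(3) p'(1) q'(1) unfolding p'(2) q'(2) by (simp flip: ennreal_plus)
    then have "1 / enn2real p + 1 / enn2real q \<le> 1" by (subst (asm) ennreal_le_iff) auto
    moreover have "0 < 1 / enn2real p" using p'(1) by simp
    ultimately have "0 < 1 - 1 / enn2real q" "1 / enn2real p \<le> 1 - 1 / enn2real q" by linarith+
    then have s: "0 < s" "s \<le> enn2real p" "1 / s + 1 / enn2real q = 1"
      using p'(1) by (auto simp: s_def field_simps)
    have fs: "(\<integral>\<^sup>+x. ennreal (norm (f x) powr s) \<partial>lborel) < \<infinity>"
      by (rule Lp_mem_lower[where R = R and p = "enn2real p"]) (use mf Rf f 3 s in \<open>auto simp: Lp_mem_def\<close>)
    have "translation_approximable f g"
      using g 3 by (intro pairing_translation_approximable[OF mf mg q'(1) _ Rg] pairing_Lp[OF mf s(1) q'(1) s(3) fs])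
        (auto simp: Lp_mem_def)
    then show ?thesis ..
  qed
qed

section \<open>Products of locally integrable functions\<close>

text \<open>Local Lebesgue spaces consist of Lebesgue measurable functions, while Fubini's theorem
  and the substitutions are carried out over \<open>lborel\<close>; hence a Borel
  representative.\<close>

lemma borel_version:
  fixes f :: "'a::euclidean_space \<Rightarrow> complex"
  assumes "f \<in> borel_measurable lebesgue"
  obtains g where "g \<in> borel_measurable borel" "AE x in lborel. f x = g x"
proof -
  have "(\<lambda>x. Re (f x)) \<in> borel_measurable lebesgue" "(\<lambda>x. Im (f x)) \<in> borel_measurable lebesgue"
    using assms by simp_all
  then obtain a b where [measurable]: "a \<in> borel_measurable lborel" "b \<in> borel_measurable lborel"
    and ab: "AE x in lborel. Re (f x) = a x" "AE x in lborel. Im (f x) = b x"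
    by (metis completion_ex_borel_measurable_real)
  show ?thesis
  proof (rule that)
    show "(\<lambda>x. Complex (a x) (b x)) \<in> borel_measurable borel"
      unfolding Complex_eq by measurable
    show "AE x in lborel. f x = Complex (a x) (b x)"
      using ab by eventually_elim (simp add: complex_eq_iff)
  qed
qed

text \<open>A Borel version of F on K, extended by 0. The cut-off is sharp, because afterwards only
  coincidence on K and integrability matter.\<close>

lemma Lp_loc_local:
  fixes F :: "real^'n \<Rightarrow> complex"
  assumes F: "F \<in> Lp_loc \<Omega> p" and p: "0 < p" and K: "compact K" "K \<subseteq> \<Omega>"
  obtains F0 where "F0 \<in> borel_measurable borel" "\<And>x. x \<notin> K \<Longrightarrow> F0 x = 0"
    "AE x in lborel. x \<in> K \<longrightarrow> F x = F0 x" "Lp_mem lborel p F0"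
proof -
  have Ks: "K \<inter> space lebesgue \<in> sets lebesgue" using K(1) by (simp add: borel_compact)
  have F_K: "F \<in> borel_measurable (lebesgue_on K)"
    using F K(2) by (auto simp: Lp_loc_def intro: measurable_restrict_mono)
  then have "(\<lambda>x. indicator K x *\<^sub>R F x) \<in> borel_measurable lebesgue"
    using borel_measurable_restrict_space_iff[OF Ks, of F] by simp
  then obtain g where [measurable]: "g \<in> borel_measurable borel" and g: "AE x in lborel. indicator K x *\<^sub>R F x = g x"
    by (rule borel_version)
  define F0 where "F0 x = indicator K x *\<^sub>R g x" for x
  have [measurable]: "K \<in> sets borel" using K(1) by (rule borel_compact)
  have F0: "F0 \<in> borel_measurable borel" unfolding F0_def by measurable
  have eq: "AE x in lborel. x \<in> K \<longrightarrow> F x = F0 x"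
    using g by eventually_elim (auto simp: F0_def)
  have mem: "Lp_mem (lebesgue_on K) p F"
    using F K Lp_norm_finite_iff[OF F_K p] by (auto simp: Lp_loc_def)
  have "Lp_mem lborel p F0"
  proof (cases "p = \<infinity>")
    case True
    then obtain B where "AE x in lebesgue_on K. norm (F x) \<le> B" using mem by (auto simp: Lp_mem_def)
    then have "AE x in lborel. x \<in> K \<longrightarrow> norm (F x) \<le> B"
      by (simp add: AE_restrict_space_iff[OF Ks] AE_completion_iff)
    with eq have "AE x in lborel. norm (F0 x) \<le> \<bar>B\<bar>"
      by eventually_elim (auto simp: F0_def indicator_def)
    then show ?thesis using True by (auto simp: Lp_mem_def)
  next
    case False
    have "(\<integral>\<^sup>+x. ennreal (norm (F x) powr enn2real p) \<partial>lebesgue_on K) =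
        (\<integral>\<^sup>+x. ennreal (norm (F x) powr enn2real p) * indicator K x \<partial>lborel)"
      by (subst nn_integral_restrict_space[OF Ks]) (rule nn_integral_completion)
    also have "\<dots> = (\<integral>\<^sup>+x. ennreal (norm (F0 x) powr enn2real p) \<partial>lborel)"
    proof (rule nn_integral_cong_AE)
      show "AE x in lborel. ennreal (norm (F x) powr enn2real p) * indicator K x = ennreal (norm (F0 x) powr enn2real p)"
        using eq by eventually_elim (auto simp: F0_def indicator_def)
    qed
    finally show ?thesis using mem False by (simp add: Lp_mem_def)
  qed
  then show ?thesis using that[of F0] F0 eq by (simp add: F0_def)
qed

text \<open>The integral sees F only where \<phi> is nonzero, that is within K, and there F0
  represents F. This also replaces Lebesgue measure on \<Omega> by \<open>lborel\<close> on the
  whole space.\<close>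

lemma regular_dist_eq:
  fixes F :: "real^'n \<Rightarrow> complex"
  assumes \<Omega>: "open \<Omega>" and F: "F \<in> borel_measurable (lebesgue_on \<Omega>)" and \<phi>: "\<phi> \<in> test_functions \<Omega>"
    and K: "K \<subseteq> \<Omega>" "\<And>x. x \<notin> K \<Longrightarrow> \<phi> x = 0"
    and F0: "F0 \<in> borel_measurable borel" "AE x in lborel. x \<in> K \<longrightarrow> F x = F0 x"
  shows "regular_dist \<Omega> F \<phi> = (LINT x|lborel. F0 x * \<phi> x)"
proof -
  have \<phi>m: "\<phi> \<in> borel_measurable borel" by (rule smooth_borel[OF test_functions_smooth[OF \<phi>]])
  have \<phi>l: "\<phi> \<in> borel_measurable lebesgue" by (rule measurable_completion) (use \<phi>m in simp)
  have F0\<phi>: "(\<lambda>x. F0 x * \<phi> x) \<in> borel_measurable lborel" using F0(1) \<phi>m by simp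
  have \<Omega>s: "\<Omega> \<inter> space lebesgue \<in> sets lebesgue" using \<Omega> by simp
  have F\<Omega>: "(\<lambda>x. indicator \<Omega> x *\<^sub>R F x) \<in> borel_measurable lebesgue"
    using borel_measurable_restrict_space_iff[OF \<Omega>s, of F] F by simp
  have "regular_dist \<Omega> F \<phi> = (LINT x|lebesgue. (indicator \<Omega> x *\<^sub>R F x) * \<phi> x)"
    using \<phi> by (simp add: regular_dist_def set_lebesgue_integral_def)
  also have "\<dots> = (LINT x|lebesgue. F0 x * \<phi> x)"
  proof (rule integral_cong_AE)
    show "(\<lambda>x. indicator \<Omega> x *\<^sub>R F x * \<phi> x) \<in> borel_measurable lebesgue"
      using F\<Omega> \<phi>l by (rule borel_measurable_times)
    show "(\<lambda>x. F0 x * \<phi> x) \<in> borel_measurable lebesgue" by (rule measurable_completion[OF F0\<phi>])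
    have "AE x in lborel. indicator \<Omega> x *\<^sub>R F x * \<phi> x = F0 x * \<phi> x"
      using F0(2)
    proof eventually_elim
      case (elim x)
      then show ?case using K by (cases "x \<in> K") (auto simp: indicator_def)
    qed
    then show "AE x in lebesgue. indicator \<Omega> x *\<^sub>R F x * \<phi> x = F0 x * \<phi> x" by (rule AE_completion)
  qed
  also have "\<dots> = (LINT x|lborel. F0 x * \<phi> x)" by (rule integral_completion[OF F0\<phi>])
  finally show ?thesis .
qed

section \<open>Locally integrable functions as distributions\<close>

lemma norm_le_test_seminorm:
  assumes "\<phi> \<in> test_functions \<Omega>" shows "norm (\<phi> x) \<le> test_seminorm 0 \<phi>"
proof -
  obtain B where B: "B \<ge> 0" "\<And>x. (1 + norm x) ^ 0 * norm (iter_deriv [] \<phi> x) \<le> B"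
    by (rule schwartzD[OF test_functions_schwartz[OF assms] lists.Nil, of 0]) (rule that)
  have "bdd_above ((\<lambda>(bs, x). norm (iter_deriv bs \<phi> x)) ` ({bs \<in> lists Basis. length bs \<le> 0} \<times> UNIV))"
    using B(2) by (intro bdd_aboveI2[where M = B]) auto
  then have "(\<lambda>(bs, x). norm (iter_deriv bs \<phi> x)) ([], x) \<le> test_seminorm 0 \<phi>"
    unfolding test_seminorm_def by (intro cSUP_upper) auto
  then show ?thesis by simp
qed

text \<open>On each compact set H is replaced by an integrable h; the estimate is of order 0, with
  the L_1 norm of h as constant. Local integrability is phrased by such representatives since they
  are what the products of cut-off functions supply.\<close>

lemma regular_dist_distribution:
  fixes H :: "real^'n \<Rightarrow> complex"
  assumes \<Omega>: "open \<Omega>" and H: "H \<in> borel_measurable (lebesgue_on \<Omega>)"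
    and loc: "\<And>K. compact K \<Longrightarrow> K \<subseteq> \<Omega> \<Longrightarrow> \<exists>h. integrable lborel h \<and> (AE x in lborel. x \<in> K \<longrightarrow> H x = h x)"
  shows "regular_dist \<Omega> H \<in> distributions \<Omega>"
proof -
  have eq: "\<exists>h. integrable lborel h \<and> (\<forall>\<phi>\<in>test_functions \<Omega>. (\<forall>x. x \<notin> K \<longrightarrow> \<phi> x = 0) \<longrightarrow>
      regular_dist \<Omega> H \<phi> = (LINT x|lborel. h x * \<phi> x) \<and> integrable lborel (\<lambda>x. h x * \<phi> x))"
    if K: "compact K" "K \<subseteq> \<Omega>" for K
  proof -
    obtain h where h: "integrable lborel h" "AE x in lborel. x \<in> K \<longrightarrow> H x = h x" using loc[OF K] by blast
    have hm: "h \<in> borel_measurable borel" using h(1) by auto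
    have "regular_dist \<Omega> H \<phi> = (LINT x|lborel. h x * \<phi> x) \<and> integrable lborel (\<lambda>x. h x * \<phi> x)"
      if \<phi>: "\<phi> \<in> test_functions \<Omega>" "\<forall>x. x \<notin> K \<longrightarrow> \<phi> x = 0" for \<phi>
    proof
      show "regular_dist \<Omega> H \<phi> = (LINT x|lborel. h x * \<phi> x)"
        by (rule regular_dist_eq[OF \<Omega> H \<phi>(1) K(2) _ hm h(2)]) (use \<phi>(2) in blast)
      show "integrable lborel (\<lambda>x. h x * \<phi> x)"
        by (rule integrable_mult_bounded[OF h(1) smooth_borel[OF test_functions_smooth[OF \<phi>(1)]] norm_le_test_seminorm[OF \<phi>(1)]])
    qed
    then show ?thesis using h(1) by blast
  qed
  have "linear_functional_on (test_functions \<Omega>) (regular_dist \<Omega> H)"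
    unfolding linear_functional_on_def
  proof (intro conjI ballI allI impI)
    fix \<phi> \<theta> assume \<phi>: "\<phi> \<in> test_functions \<Omega>" and \<theta>: "\<theta> \<in> test_functions \<Omega>"
    obtain K where K: "smooth \<phi>" "compact K" "K \<subseteq> \<Omega>" "\<And>x bs. x \<notin> K \<Longrightarrow> iter_deriv bs \<phi> x = 0" "\<And>x. x \<notin> K \<Longrightarrow> \<phi> x = 0"
      by (rule test_functionsE[OF \<phi>]) (rule that)
    obtain L where L: "smooth \<theta>" "compact L" "L \<subseteq> \<Omega>" "\<And>x bs. x \<notin> L \<Longrightarrow> iter_deriv bs \<theta> x = 0" "\<And>x. x \<notin> L \<Longrightarrow> \<theta> x = 0"
      by (rule test_functionsE[OF \<theta>]) (rule that)
    \<comment> \<open>One h for the union of the supports, so that additivity becomes that of a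
      single integral.\<close>
    have "compact (K \<union> L)" "K \<union> L \<subseteq> \<Omega>" using K L by auto
    from eq[OF this] obtain h where h: "\<And>\<phi>. \<phi> \<in> test_functions \<Omega> \<Longrightarrow> (\<forall>x. x \<notin> K \<union> L \<longrightarrow> \<phi> x = 0) \<Longrightarrow>
      regular_dist \<Omega> H \<phi> = (LINT x|lborel. h x * \<phi> x) \<and> integrable lborel (\<lambda>x. h x * \<phi> x)" by blast
    have z: "\<forall>x. x \<notin> K \<union> L \<longrightarrow> \<phi> x = 0" "\<forall>x. x \<notin> K \<union> L \<longrightarrow> \<theta> x = 0" using K(5) L(5) by auto
    have "regular_dist \<Omega> H (\<lambda>x. \<phi> x + \<theta> x) = (LINT x|lborel. h x * (\<phi> x + \<theta> x))"
      using h[OF test_functions_add[OF \<phi> \<theta>]] z by simp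
    then show "regular_dist \<Omega> H (\<lambda>x. \<phi> x + \<theta> x) = regular_dist \<Omega> H \<phi> + regular_dist \<Omega> H \<theta>"
      using h[OF \<phi> z(1)] h[OF \<theta> z(2)] by (simp add: distrib_left)
  next
    fix c and \<phi> assume \<phi>: "\<phi> \<in> test_functions \<Omega>"
    obtain K where K: "smooth \<phi>" "compact K" "K \<subseteq> \<Omega>" "\<And>x bs. x \<notin> K \<Longrightarrow> iter_deriv bs \<phi> x = 0" "\<And>x. x \<notin> K \<Longrightarrow> \<phi> x = 0"
      by (rule test_functionsE[OF \<phi>]) (rule that)
    from eq[OF K(2,3)] obtain h where h: "\<And>\<phi>. \<phi> \<in> test_functions \<Omega> \<Longrightarrow> (\<forall>x. x \<notin> K \<longrightarrow> \<phi> x = 0) \<Longrightarrow>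
      regular_dist \<Omega> H \<phi> = (LINT x|lborel. h x * \<phi> x) \<and> integrable lborel (\<lambda>x. h x * \<phi> x)" by blast
    have "regular_dist \<Omega> H (\<lambda>x. c * \<phi> x) = (LINT x|lborel. h x * (c * \<phi> x))"
      using h[OF test_functions_cmult[OF \<phi>, of c]] K(5) by simp
    also have "\<dots> = c * (LINT x|lborel. h x * \<phi> x)"
      unfolding integral_mult_right_zero[symmetric] by (simp only: mult_ac)
    finally show "regular_dist \<Omega> H (\<lambda>x. c * \<phi> x) = c * regular_dist \<Omega> H \<phi>"
      using h[OF \<phi>] K(5) by simp
  qed (simp add: regular_dist_def)
  moreover have "\<exists>C N. \<forall>\<phi>\<in>test_functions \<Omega>. closure {x. \<phi> x \<noteq> 0} \<subseteq> K \<longrightarrow> norm (regular_dist \<Omega> H \<phi>) \<le> C * test_seminorm N \<phi>"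
    if K: "compact K" "K \<subseteq> \<Omega>" for K
  proof -
    obtain h where h: "integrable lborel h" "\<And>\<phi>. \<phi> \<in> test_functions \<Omega> \<Longrightarrow> (\<forall>x. x \<notin> K \<longrightarrow> \<phi> x = 0) \<Longrightarrow>
      regular_dist \<Omega> H \<phi> = (LINT x|lborel. h x * \<phi> x) \<and> integrable lborel (\<lambda>x. h x * \<phi> x)" using eq[OF K] by blast
    have "norm (regular_dist \<Omega> H \<phi>) \<le> (LINT x|lborel. norm (h x)) * test_seminorm 0 \<phi>"
      if \<phi>: "\<phi> \<in> test_functions \<Omega>" and sub: "closure {x. \<phi> x \<noteq> 0} \<subseteq> K" for \<phi>
    proof -
      have "\<forall>x. x \<notin> K \<longrightarrow> \<phi> x = 0" using sub closure_subset[of "{x. \<phi> x \<noteq> 0}"] by blast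
      note h' = h(2)[OF \<phi> this]
      have "norm (regular_dist \<Omega> H \<phi>) \<le> (LINT x|lborel. norm (h x) * test_seminorm 0 \<phi>)"
        unfolding h'[THEN conjunct1]
        by (rule Bochner_Integration.integral_norm_bound_integral[OF h'[THEN conjunct2]])
           (use h(1) in \<open>auto simp: norm_mult intro!: mult_left_mono norm_le_test_seminorm[OF \<phi>]\<close>)
      then show ?thesis by simp
    qed
    then show ?thesis by blast
  qed
  ultimately show ?thesis unfolding distributions_def by blast
qed

text \<open>Both functions are cut off to one ball. Integrability of f0 g0 is the bound for
  translated products with both shifts 0, applied in the order that the approximable factor
  dictates.\<close>

lemma Lp_loc_product:
  fixes f g :: "real^'n \<Rightarrow> complex"
  assumes f: "f \<in> Lp_loc UNIV p" and g: "g \<in> Lp_loc UNIV q" and p: "0 < p" "0 < q" "inverse p + inverse q \<le> 1"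
  obtains f0 g0 where "integrable lborel f0" "integrable lborel g0"
    "AE x in lborel. x \<in> cball 0 R \<longrightarrow> f x = f0 x" "AE x in lborel. x \<in> cball 0 R \<longrightarrow> g x = g0 x"
    "translation_approximable f0 g0 \<or> translation_approximable g0 f0" "integrable lborel (\<lambda>x. f0 x * g0 x)"
proof -
  obtain f0 where f0: "f0 \<in> borel_measurable borel" "\<And>x. x \<notin> cball 0 R \<Longrightarrow> f0 x = 0"
    "AE x in lborel. x \<in> cball 0 R \<longrightarrow> f x = f0 x" "Lp_mem lborel p f0"
    by (rule Lp_loc_local[OF f p(1) compact_cball subset_UNIV]) (rule that)
  obtain g0 where g0: "g0 \<in> borel_measurable borel" "\<And>x. x \<notin> cball 0 R \<Longrightarrow> g0 x = 0"
    "AE x in lborel. x \<in> cball 0 R \<longrightarrow> g x = g0 x" "Lp_mem lborel q g0"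
    by (rule Lp_loc_local[OF g p(2) compact_cball subset_UNIV]) (rule that)
  have R: "norm x > R \<Longrightarrow> f0 x = 0" "norm x > R \<Longrightarrow> g0 x = 0" for x using f0(2) g0(2) by auto
  have le: "inverse p \<le> 1" "inverse q \<le> 1" by (rule order_trans[OF _ p(3)], simp)+
  have int: "integrable lborel f0" "integrable lborel g0"
    by (rule integrable_if_Lp_mem[OF f0(1) R(1) f0(4) p(1) le(1)], assumption)
       (rule integrable_if_Lp_mem[OF g0(1) R(2) g0(4) p(2) le(2)], assumption)
  have ta: "translation_approximable f0 g0 \<or> translation_approximable g0 f0"
    by (rule Lp_translation_approximable[OF f0(1) g0(1) _ _ f0(4) g0(4) p, of R]) (use R in auto)
  have "integrable lborel (\<lambda>x. f0 x * g0 x)"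
    using ta
  proof
    assume "translation_approximable f0 g0"
    then obtain C where "C \<ge> 0" "\<And>a b. integrable lborel (\<lambda>x. f0 (x - a) * g0 (x - b))"
      "\<And>a b. (LINT x|lborel. norm (f0 (x - a) * g0 (x - b))) \<le> C"
      using translation_product_bound[OF f0(1) g0(1) int(1)] by blast
    from this(2)[of 0 0] show ?thesis by simp
  next
    assume "translation_approximable g0 f0"
    then obtain C where "C \<ge> 0" "\<And>a b. integrable lborel (\<lambda>x. g0 (x - a) * f0 (x - b))"
      "\<And>a b. (LINT x|lborel. norm (g0 (x - a) * f0 (x - b))) \<le> C"
      using translation_product_bound[OF g0(1) f0(1) int(2)] by blast
    from this(2)[of 0 0] show ?thesis by (simp add: mult.commute)
  qed
  then show ?thesis using that int f0(3) g0(3) ta by blast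
qed

lemma Lp_loc_measurable: "f \<in> Lp_loc \<Omega> p \<Longrightarrow> f \<in> borel_measurable (lebesgue_on \<Omega>)"
  by (simp add: Lp_loc_def)

lemma measurable_lebesgue_on_subset:
  "f \<in> borel_measurable (lebesgue_on UNIV) \<Longrightarrow> f \<in> borel_measurable (lebesgue_on \<Omega>)"
  by (rule measurable_restrict_mono) auto

lemma Lp_loc_times_measurable:
  assumes "f \<in> Lp_loc UNIV p" "g \<in> Lp_loc UNIV q"
  shows "(\<lambda>x. f x * g x) \<in> borel_measurable (lebesgue_on \<Omega>)"
  by (rule borel_measurable_times[OF measurable_lebesgue_on_subset[OF Lp_loc_measurable[OF assms(1)]]
    measurable_lebesgue_on_subset[OF Lp_loc_measurable[OF assms(2)]]])

text \<open>On a ball containing the support of \<phi>, u and v coincide with the integrable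
  functions f0 and g0, so locality allows their exchange; the limit for f0 and g0 has the factor
  \<psi> 0 * \<psi> 0 = 1.\<close>

lemma Lp_product_tendsto:
  fixes M :: "real^'n"
  assumes \<Psi>: "LP_generator \<Psi>" and M: "weight M" and u: "u \<in> tempered" and v: "v \<in> tempered"
    and f: "f \<in> Lp_loc UNIV p" "restr UNIV u = regular_dist UNIV f"
    and g: "g \<in> Lp_loc UNIV q" "restr UNIV v = regular_dist UNIV g"
    and p: "0 < p" "0 < q" "inverse p + inverse q \<le> 1"
    and \<psi>: "\<psi> \<in> cutoffs" and \<Omega>: "open \<Omega>" and \<phi>: "\<phi> \<in> test_functions \<Omega>"
  shows "(\<lambda>k. LINT x|lborel. low_freq M \<psi> k u x * low_freq M \<psi> k v x * \<phi> x)
    \<longlonglongrightarrow> regular_dist \<Omega> (\<lambda>x. f x * g x) \<phi>"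
proof -
  obtain K where K: "smooth \<phi>" "compact K" "K \<subseteq> \<Omega>" "\<And>x bs. x \<notin> K \<Longrightarrow> iter_deriv bs \<phi> x = 0" "\<And>x. x \<notin> K \<Longrightarrow> \<phi> x = 0"
    by (rule test_functionsE[OF \<phi>]) (rule that)
  \<comment> \<open>The open ball is the set on which locality is applied, the closed ball the one
    on which f0 and g0 represent f and g.\<close>
  obtain R where R: "K \<subseteq> ball 0 R"
    using compact_imp_bounded[OF K(2)] bounded_subset_ballD by blast
  obtain f0 g0 where int: "integrable lborel f0" "integrable lborel g0"
    and eq: "AE x in lborel. x \<in> cball 0 R \<longrightarrow> f x = f0 x" "AE x in lborel. x \<in> cball 0 R \<longrightarrow> g x = g0 x"
    and ta: "translation_approximable f0 g0 \<or> translation_approximable g0 f0" and int2: "integrable lborel (\<lambda>x. f0 x * g0 x)"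
    by (rule Lp_loc_product[OF f(1) g(1) p, of R]) (rule that)
  have m: "f0 \<in> borel_measurable borel" "g0 \<in> borel_measurable borel" using int by auto
  have local: "w \<theta> = function_dist h0 \<theta>"
    if w: "h \<in> Lp_loc UNIV s" "restr UNIV w = regular_dist UNIV h"
      and h0: "h0 \<in> borel_measurable borel" "AE x in lborel. x \<in> cball 0 R \<longrightarrow> h x = h0 x"
      and \<theta>: "\<theta> \<in> test_functions (ball 0 R)" for w h h0 s \<theta>
  proof -
    obtain L where L: "smooth \<theta>" "compact L" "L \<subseteq> ball 0 R" "\<And>x bs. x \<notin> L \<Longrightarrow> iter_deriv bs \<theta> x = 0" "\<And>x. x \<notin> L \<Longrightarrow> \<theta> x = 0"
      by (rule test_functionsE[OF \<theta>]) (rule that)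
    have "w \<theta> = regular_dist UNIV h \<theta>"
      using w(2) test_functions_UNIV[OF \<theta>] by (metis restr_def)
    also have "\<dots> = (LINT x|lborel. h0 x * \<theta> x)"
    proof (rule regular_dist_eq[OF open_UNIV Lp_loc_measurable[OF w(1)] test_functions_UNIV[OF \<theta>] subset_UNIV _ h0])
      show "x \<notin> cball 0 R \<Longrightarrow> \<theta> x = 0" for x using L(3,5) by (metis ball_subset_cball subsetD)
    qed
    finally show ?thesis using test_functions_schwartz[OF \<theta>] by (simp add: function_dist_def)
  qed
  have \<phi>R: "\<phi> \<in> test_functions (ball 0 R)" by (rule test_functionsI[OF K(1,2) R K(5)])
  note sf = tempered_schwartz_functional[OF u] tempered_schwartz_functional[OF v]
    schwartz_functional_function_dist[OF int(1)] schwartz_functional_function_dist[OF int(2)]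
  note \<psi>' = cutoffs_test[OF \<psi>]
  have \<psi>0: "\<psi> 0 = 1" using \<psi> by (auto simp: cutoffs_def dest: eventually_nhds_x_imp_x)
  have "(\<lambda>k. (LINT x|lborel. low_freq M \<psi> k u x * low_freq M \<psi> k v x * \<phi> x) -
    (LINT x|lborel. low_freq M \<psi> k (function_dist f0) x * low_freq M \<psi> k (function_dist g0) x * \<phi> x)) \<longlonglongrightarrow> 0"
    by (rule low_freq_product_local[OF \<Psi> M sf(1,3,2,4) \<psi>' open_ball _ _ \<phi>R])
       (rule local[OF f m(1) eq(1)], assumption, rule local[OF g m(2) eq(2)], assumption)
  moreover have "(\<lambda>k. LINT x|lborel. low_freq M \<psi> k (function_dist f0) x * low_freq M \<psi> k (function_dist g0) x * \<phi> x)
      \<longlonglongrightarrow> (LINT x|lborel. f0 x * g0 x * \<phi> x)"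
    using ta
  proof
    assume "translation_approximable f0 g0"
    from low_freq_product_tendsto[OF \<Psi> M int this \<psi>' test_functions_UNIV[OF \<phi>]] show ?thesis by (simp add: \<psi>0)
  next
    assume "translation_approximable g0 f0"
    from low_freq_product_tendsto[OF \<Psi> M int(2,1) this \<psi>' test_functions_UNIV[OF \<phi>]]
    show ?thesis by (simp add: \<psi>0 mult.commute[of "g0 _"] mult.commute[of "low_freq M \<psi> _ (function_dist g0) _"])
  qed
  ultimately have lim: "(\<lambda>k. LINT x|lborel. low_freq M \<psi> k u x * low_freq M \<psi> k v x * \<phi> x) \<longlonglongrightarrow> (LINT x|lborel. f0 x * g0 x * \<phi> x)"
    by (rule Lim_transform[rotated])
  have "regular_dist \<Omega> (\<lambda>x. f x * g x) \<phi> = (LINT x|lborel. f0 x * g0 x * \<phi> x)"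
  proof (rule regular_dist_eq[OF \<Omega> Lp_loc_times_measurable[OF f(1) g(1)] \<phi> K(3) K(5)])
    show "(\<lambda>x. f0 x * g0 x) \<in> borel_measurable borel" using m by simp
    show "AE x in lborel. x \<in> K \<longrightarrow> f x * g x = f0 x * g0 x"
      using eq by eventually_elim (use R in auto)
  qed
  then show ?thesis using lim by simp
qed

lemma product_limit_Lp:
  fixes M :: "real^'n"
  assumes \<Psi>: "LP_generator \<Psi>" and M: "weight M" and u: "u \<in> tempered" and v: "v \<in> tempered"
    and f: "f \<in> Lp_loc UNIV p" "restr UNIV u = regular_dist UNIV f"
    and g: "g \<in> Lp_loc UNIV q" "restr UNIV v = regular_dist UNIV g"
    and p: "0 < p" "0 < q" "inverse p + inverse q \<le> 1" and \<Omega>: "open \<Omega>"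
  shows "product_limit M \<Omega> u v (regular_dist \<Omega> (\<lambda>x. f x * g x))"
  unfolding product_limit_def tendsto_dist_def
proof (intro conjI ballI u v)
  show "regular_dist \<Omega> (\<lambda>x. f x * g x) \<in> distributions \<Omega>"
  proof (rule regular_dist_distribution[OF \<Omega>])
    show "(\<lambda>x. f x * g x) \<in> borel_measurable (lebesgue_on \<Omega>)"
      by (rule Lp_loc_times_measurable[OF f(1) g(1)])
    fix K assume "compact K" "K \<subseteq> \<Omega>"
    then obtain R where R: "K \<subseteq> ball 0 R" using compact_imp_bounded bounded_subset_ballD by blast
    obtain f0 g0 where int: "integrable lborel f0" "integrable lborel g0"
      and eq: "AE x in lborel. x \<in> cball 0 R \<longrightarrow> f x = f0 x" "AE x in lborel. x \<in> cball 0 R \<longrightarrow> g x = g0 x"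
      and ta: "translation_approximable f0 g0 \<or> translation_approximable g0 f0" and int2: "integrable lborel (\<lambda>x. f0 x * g0 x)"
      by (rule Lp_loc_product[OF f(1) g(1) p, of R]) (rule that)
    have "AE x in lborel. x \<in> K \<longrightarrow> f x * g x = f0 x * g0 x"
      using eq by eventually_elim (use R in auto)
    then show "\<exists>h. integrable lborel h \<and> (AE x in lborel. x \<in> K \<longrightarrow> f x * g x = h x)" using int2 by blast
  qed
  fix \<psi> :: "real^'n \<Rightarrow> complex" and \<phi> assume \<psi>: "\<psi> \<in> cutoffs" and \<phi>: "\<phi> \<in> test_functions \<Omega>"
  show "(\<lambda>k. restr \<Omega> (regular_dist UNIV (\<lambda>x. low_freq M \<psi> k u x * low_freq M \<psi> k v x)) \<phi>)
      \<longlonglongrightarrow> regular_dist \<Omega> (\<lambda>x. f x * g x) \<phi>"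
    unfolding restr_regular_low_freq[OF \<Psi> tempered_schwartz_functional[OF u] tempered_schwartz_functional[OF v] cutoffs_test[OF \<psi>] \<phi>]
    by (rule Lp_product_tendsto[OF \<Psi> M u v f g p \<psi> \<Omega> \<phi>])
qed

text \<open>Du Bois-Reymond's lemma. The product of a distribution vanishing near \<open>a\<close> with a bounded
  function vanishes there, but for an integrable function \<open>h\<close> it is the pointwise product; testing
  with the conjugate sign of \<open>h\<close> shows that \<open>h = 0\<close> near \<open>a\<close>.\<close>

lemma regular_dist_0_imp_AE_0:
  fixes h :: "real^'n \<Rightarrow> complex"
  assumes \<Psi>: "LP_generator \<Psi>" and r: "r > 0" and h: "integrable lborel h" and hK: "\<And>x. norm x > R \<Longrightarrow> h x = 0"
    and 0: "\<And>\<phi>. \<phi> \<in> test_functions (ball a (3 * r)) \<Longrightarrow> (LINT x|lborel. h x * \<phi> x) = 0"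
  shows "AE x in lborel. x \<in> cball a r \<longrightarrow> h x = 0"
proof -
  define M :: "real^'n" where "M = (\<chi> i. 1)"
  have M: "weight M" by (simp add: weight_def M_def)
  obtain \<beta> :: "real^'n \<Rightarrow> complex" where \<beta>: "\<beta> \<in> test_functions UNIV" "\<And>x. dist a x \<le> r \<Longrightarrow> \<beta> x = 1" "\<And>x. dist a x \<ge> 2 * r \<Longrightarrow> \<beta> x = 0"
    by (rule bump_function[OF \<Psi> r, of a]) (rule that)
  \<comment> \<open>The support lies within radius 2 r, compactly inside the ball of radius 3 r on
    which h vanishes as a distribution.\<close>
  have \<beta>': "\<beta> \<in> test_functions (ball a (3 * r))"
    by (rule test_functionsI[OF test_functions_smooth[OF \<beta>(1)] compact_cball, of a "2 * r"]) (use r \<beta>(3) in auto)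
  obtain \<psi> :: "real^'n \<Rightarrow> complex" where \<psi>: "\<psi> \<in> cutoffs" by (rule cutoffs_nonempty[OF \<Psi>])
  have \<psi>0: "\<psi> 0 = 1" using \<psi> by (auto simp: cutoffs_def dest: eventually_nhds_x_imp_x)
  have [measurable]: "h \<in> borel_measurable borel" "\<beta> \<in> borel_measurable borel"
    using h \<beta>(1) by (auto intro: smooth_borel test_functions_smooth)
  \<comment> \<open>The conjugate sign of h \<beta>. Division by 0 yields 0, so s is bounded by 1
    everywhere and vanishes where h does.\<close>
  define s where "s x = cnj (h x * \<beta> x) / of_real (norm (h x * \<beta> x))" for x
  have cont: "(\<lambda>z. cnj (f z)) \<in> borel_measurable borel" "(\<lambda>z. of_real (norm (f z)) :: complex) \<in> borel_measurable borel"
    if "f \<in> borel_measurable borel" for f :: "real^'n \<Rightarrow> complex"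
    by (rule measurable_compose[OF that], rule borel_measurable_continuous_onI, intro continuous_intros)+
  have h\<beta>: "(\<lambda>x. h x * \<beta> x) \<in> borel_measurable borel" by measurable
  have [measurable]: "s \<in> borel_measurable borel"
    unfolding s_def by (rule borel_measurable_divide[OF cont(1)[OF h\<beta>] cont(2)[OF h\<beta>]])
  have s1: "norm (s x) \<le> 1" for x by (simp add: s_def norm_divide norm_mult)
  have sh: "s x * h x * \<beta> x = of_real (norm (h x * \<beta> x))" for x
  proof -
    have "s x * h x * \<beta> x = (cnj (h x * \<beta> x) * (h x * \<beta> x)) / of_real (norm (h x * \<beta> x))"
      by (simp add: s_def)
    also have "cnj (h x * \<beta> x) * (h x * \<beta> x) = of_real ((norm (h x * \<beta> x))\<^sup>2)"
      by (metis complex_norm_square mult.commute)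
    finally show ?thesis by (simp add: power2_eq_square)
  qed
  have sint: "integrable lborel s"
  proof (rule Bochner_Integration.integrable_bound)
    show "integrable lborel (\<lambda>x::real^'n. indicator (cball 0 R) x *\<^sub>R (1::real))"
      by (intro borel_integrable_compact) auto
    show "AE x in lborel. norm (s x) \<le> norm (indicator (cball 0 R) x *\<^sub>R (1::real))"
    proof (rule AE_I2)
      fix x
      show "norm (s x) \<le> norm (indicator (cball 0 R) x *\<^sub>R (1::real))"
        using s1[of x] hK[of x] by (cases "norm x \<le> R") (auto simp: s_def)
    qed
  qed measurable
  have ta: "translation_approximable s h"
  proof (rule pairing_translation_approximable[where q = 1 and R = R])
    show "pairing s 1" by (rule pairing_bounded[of _ 1]) (simp add: s1)
    show "(\<integral>\<^sup>+x. ennreal (norm (h x) powr 1) \<partial>lborel) < \<infinity>" using h by (auto simp: integrable_iff_bounded)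
  qed (use hK in auto)
  let ?I = "\<lambda>u v k. LINT x|lborel. low_freq M \<psi> k u x * low_freq M \<psi> k v x * \<beta> x"
  \<comment> \<open>Two limits for the same sequence, up to the order of the factors: here the
    integral of the pointwise product, next 0 by locality.\<close>
  have "?I (function_dist s) (function_dist h) \<longlonglongrightarrow> (LINT x|lborel. s x * h x * \<beta> x)"
    using low_freq_product_tendsto[OF \<Psi> M sint h ta cutoffs_test[OF \<psi>] \<beta>(1)] by (simp add: \<psi>0)
  moreover have "?I (function_dist h) (function_dist s) \<longlonglongrightarrow> 0"
  proof (rule low_freq_product_vanishes[OF \<Psi> M schwartz_functional_function_dist[OF h] schwartz_functional_function_dist[OF sint] cutoffs_test[OF \<psi>] _ open_ball \<beta>'])
    show "function_dist h \<phi> = 0" if "\<phi> \<in> test_functions (ball a (3 * r))" for \<phi>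
      using 0[OF that] test_functions_schwartz[OF that] by (simp add: function_dist_def)
  qed
  ultimately have "(LINT x|lborel. s x * h x * \<beta> x) = 0"
    using LIMSEQ_unique by (simp add: mult.commute[of "low_freq M \<psi> _ (function_dist h) _"])
  then have "complex_of_real (LINT x|lborel. norm (h x * \<beta> x)) = 0"
    unfolding sh integral_complex_of_real .
  then have "(LINT x|lborel. norm (h x * \<beta> x)) = 0" by simp
  moreover have "integrable lborel (\<lambda>x. norm (h x * \<beta> x))"
    by (intro integrable_norm integrable_mult_bounded[OF h _ norm_le_test_seminorm[OF \<beta>(1)]]) simp
  ultimately have "AE x in lborel. norm (h x * \<beta> x) = 0"
    by (subst (asm) integral_nonneg_eq_0_iff_AE) auto
  then show ?thesis by eventually_elim (use \<beta>(2) in auto)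
qed

text \<open>Locally F and f have integrable versions whose difference vanishes as a distribution,
  hence almost everywhere on a small ball; equality on all of \<Omega> follows since a locally
  negligible set is negligible.\<close>

lemma AE_eq_if_regular_dist_eq:
  fixes F f :: "real^'n \<Rightarrow> complex"
  assumes \<Psi>: "LP_generator \<Psi>" and \<Omega>: "open \<Omega>" and F: "F \<in> Lp_loc \<Omega> 1" and f: "f \<in> Lp_loc UNIV p"
    and p: "0 < p" "inverse p \<le> 1"
    and eq: "\<And>\<phi>. \<phi> \<in> test_functions \<Omega> \<Longrightarrow> regular_dist \<Omega> F \<phi> = regular_dist UNIV f \<phi>"
  shows "AE x in lborel. x \<in> \<Omega> \<longrightarrow> F x = f x"
proof -
  have loc: "\<exists>r>0. AE x in lborel. x \<in> cball a r \<longrightarrow> F x = f x" if "a \<in> \<Omega>" for a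
  proof -
    obtain e where e: "e > 0" "cball a e \<subseteq> \<Omega>" using \<Omega> \<open>a \<in> \<Omega>\<close> open_contains_cball by blast
    \<comment> \<open>Then the ball of radius 3 r lies in K, where F0 and f0 represent F and
      f.\<close>
    define r where "r = e / 3"
    have r: "r > 0" "3 * r = e" using e by (simp_all add: r_def)
    define K where "K = cball a e"
    have K: "compact K" "K \<subseteq> \<Omega>" using e by (simp_all add: K_def)
    obtain F0 where F0: "F0 \<in> borel_measurable borel" "\<And>x. x \<notin> K \<Longrightarrow> F0 x = 0"
      "AE x in lborel. x \<in> K \<longrightarrow> F x = F0 x" "Lp_mem lborel 1 F0"
      by (rule Lp_loc_local[OF F _ K]) (simp, rule that)
    obtain f0 where f0: "f0 \<in> borel_measurable borel" "\<And>x. x \<notin> K \<Longrightarrow> f0 x = 0"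
      "AE x in lborel. x \<in> K \<longrightarrow> f x = f0 x" "Lp_mem lborel p f0"
      by (rule Lp_loc_local[OF f p(1) K(1) subset_UNIV]) (rule that)
    define R where "R = norm a + e"
    have "norm x \<le> R" if "x \<in> K" for x
      using that norm_triangle_sub[of x a] by (simp add: K_def R_def dist_norm norm_minus_commute)
    then have R: "norm x > R \<Longrightarrow> x \<notin> K" for x by force
    have int: "integrable lborel F0" "integrable lborel f0"
      by (rule integrable_if_Lp_mem[where R = R and p = 1]; use F0 R in simp)
         (rule integrable_if_Lp_mem[where R = R and p = p]; use f0 R p in simp)
    have "AE x in lborel. x \<in> cball a r \<longrightarrow> F0 x - f0 x = 0"
    proof (rule regular_dist_0_imp_AE_0[OF \<Psi> r(1)])
      show "integrable lborel (\<lambda>x. F0 x - f0 x)" using int by simp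
      show "norm x > R \<Longrightarrow> F0 x - f0 x = 0" for x using R F0(2) f0(2) by simp
      fix \<phi> :: "real^'n \<Rightarrow> complex" assume \<phi>: "\<phi> \<in> test_functions (ball a (3 * r))"
      have \<phi>\<Omega>: "\<phi> \<in> test_functions \<Omega>"
        using \<phi> test_functions_mono[of "ball a (3 * r)" \<Omega>] e r by (meson ball_subset_cball order_trans subsetD order_refl)
      obtain L where L: "smooth \<phi>" "compact L" "L \<subseteq> ball a (3 * r)" "\<And>x bs. x \<notin> L \<Longrightarrow> iter_deriv bs \<phi> x = 0" "\<And>x. x \<notin> L \<Longrightarrow> \<phi> x = 0"
        by (rule test_functionsE[OF \<phi>]) (rule that)
      have z: "x \<notin> K \<Longrightarrow> \<phi> x = 0" for x using L(3)[unfolded r(2)] ball_subset_cball[of a e] L(5)[of x] unfolding K_def by blast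
      have "(LINT x|lborel. (F0 x - f0 x) * \<phi> x) = (LINT x|lborel. F0 x * \<phi> x) - (LINT x|lborel. f0 x * \<phi> x)"
        using integrable_mult_bounded[OF int(1) _ norm_le_test_seminorm[OF \<phi>]] integrable_mult_bounded[OF int(2) _ norm_le_test_seminorm[OF \<phi>]]
          smooth_borel[OF L(1)] by (simp add: left_diff_distrib)
      also have "(LINT x|lborel. F0 x * \<phi> x) = regular_dist \<Omega> F \<phi>"
        by (rule regular_dist_eq[symmetric, OF \<Omega> Lp_loc_measurable[OF F] \<phi>\<Omega> K(2) z F0(1,3)])
      also have "(LINT x|lborel. f0 x * \<phi> x) = regular_dist UNIV f \<phi>"
        by (rule regular_dist_eq[symmetric, OF open_UNIV Lp_loc_measurable[OF f] test_functions_UNIV[OF \<phi>] subset_UNIV z f0(1,3)])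
      finally show "(LINT x|lborel. (F0 x - f0 x) * \<phi> x) = 0" using eq[OF \<phi>\<Omega>] by simp
    qed
    with F0(3) f0(3) have "AE x in lborel. x \<in> cball a r \<longrightarrow> F x = f x"
      by eventually_elim (use r in \<open>auto simp: K_def\<close>)
    then show ?thesis using r(1) by blast
  qed
  \<comment> \<open>The passage from local to global is made for \<open>negligible\<close> sets, so
    almost everywhere statements are translated into that language and back.\<close>
  have neg: "negligible {x. \<not> P x} \<longleftrightarrow> (AE x in lborel. P x)" for P :: "real^'n \<Rightarrow> bool"
  proof
    assume "negligible {x. \<not> P x}"
    then have "AE x in lebesgue. x \<notin> {x. \<not> P x}" by (intro AE_not_in) (simp add: negligible_iff_null_sets)
    then show "AE x in lborel. P x" by (simp add: AE_completion_iff)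
  next
    assume "AE x in lborel. P x"
    then obtain N where N: "N \<in> null_sets lborel" "{x. \<not> P x} \<subseteq> N" by (auto simp: eventually_ae_filter)
    from N(1) have "negligible N" unfolding negligible_iff_null_sets by (rule null_sets_completionI)
    then show "negligible {x. \<not> P x}" using N(2) by (rule negligible_subset)
  qed
  have "negligible {x. \<not> (x \<in> \<Omega> \<longrightarrow> F x = f x)}"
    unfolding locally_negligible_alt[of "{x. \<not> (x \<in> \<Omega> \<longrightarrow> F x = f x)}"]
  proof
    fix a assume a: "a \<in> {x. \<not> (x \<in> \<Omega> \<longrightarrow> F x = f x)}" (is "a \<in> ?S")
    then obtain r where r: "r > 0" "AE x in lborel. x \<in> cball a r \<longrightarrow> F x = f x" using loc[of a] by auto
    have "negligible {x. \<not> (x \<in> cball a r \<longrightarrow> F x = f x)}" using r(2) unfolding neg .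
    then have "negligible (?S \<inter> ball a r)" by (rule negligible_subset) auto
    moreover have "openin (top_of_set ?S) (?S \<inter> ball a r)" by (simp add: openin_open_Int)
    moreover have "a \<in> ?S \<inter> ball a r" by (rule IntI[OF a]) (simp add: r(1))
    ultimately show "\<exists>U. openin (top_of_set ?S) U \<and> a \<in> U \<and> negligible U" by blast
  qed
  then show ?thesis unfolding neg .
qed

text \<open>As distributions, f and g determine functions only almost everywhere. The product
  formula is therefore asserted for all locally integrable representatives F and G on \<Omega>, and
  does not depend on their choice.\<close>

theorem theorem7p2:
  fixes M :: "real^'n" and \<Psi> :: "real \<Rightarrow> complex" and A0 A1 A2 :: space_index
  assumes "weight M"
    and "LP_generator \<Psi>"
    and "admissible A0" "admissible A1" "admissible A2"
  shows
    "(pi_bounded M \<Psi> A0 A1 A2 \<longrightarrow>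
        (\<forall>\<Omega>. open \<Omega> \<longrightarrow> pi_on_bounded M \<Psi> \<Omega> A0 A1 A2)) \<and>
     (\<forall>\<Omega> (p::ennreal) (q::ennreal) (r::ennreal) f g.
        open \<Omega> \<and> 0 < p \<and> 0 < q \<and> 0 < r \<and>
        0 \<le> inverse r \<and> inverse r = inverse p + inverse q \<and> inverse p + inverse q \<le> 1 \<and>
        f \<in> restr \<Omega> ` tempered_Lp_loc p \<and> g \<in> restr \<Omega> ` tempered_Lp_loc q \<longrightarrow>
        pi_on_defined M \<Omega> f g \<and>
        (\<forall>F\<in>Lp_loc \<Omega> 1. \<forall>G\<in>Lp_loc \<Omega> 1.
           regular_dist \<Omega> F = f \<and> regular_dist \<Omega> G = g \<longrightarrow>
           (\<lambda>x. F x * G x) \<in> Lp_loc \<Omega> r \<and>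
           pi_on M \<Omega> f g = regular_dist \<Omega> (\<lambda>x. F x * G x)))"
proof (intro conjI impI allI)
  note M = assms(1) and \<Psi> = assms(2)
  show "pi_on_bounded M \<Psi> \<Omega> A0 A1 A2" if "pi_bounded M \<Psi> A0 A1 A2" "open \<Omega>" for \<Omega>
    by (rule pi_bounded_imp_pi_on_bounded[OF \<Psi> M that(2,1)])
  fix \<Omega> :: "(real^'n) set" and p q r :: ennreal and f g
  assume "open \<Omega> \<and> 0 < p \<and> 0 < q \<and> 0 < r \<and>
        0 \<le> inverse r \<and> inverse r = inverse p + inverse q \<and> inverse p + inverse q \<le> 1 \<and>
        f \<in> restr \<Omega> ` tempered_Lp_loc p \<and> g \<in> restr \<Omega> ` tempered_Lp_loc q"
  then have \<Omega>: "open \<Omega>" and p: "0 < p" "0 < q" "inverse p + inverse q \<le> 1"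
    and r: "0 < r" "inverse r = inverse p + inverse q"
    and fg: "f \<in> restr \<Omega> ` tempered_Lp_loc p" "g \<in> restr \<Omega> ` tempered_Lp_loc q" by auto
  obtain u f' where u: "f = restr \<Omega> u" "u \<in> tempered" "f' \<in> Lp_loc UNIV p" "restr UNIV u = regular_dist UNIV f'"
    using fg(1) unfolding tempered_Lp_loc_def by blast
  obtain v g' where v: "g = restr \<Omega> v" "v \<in> tempered" "g' \<in> Lp_loc UNIV q" "restr UNIV v = regular_dist UNIV g'"
    using fg(2) unfolding tempered_Lp_loc_def by blast
  have lim: "product_limit M \<Omega> u v (regular_dist \<Omega> (\<lambda>x. f' x * g' x))"
    by (rule product_limit_Lp[OF \<Psi> M u(2) v(2) u(3,4) v(3,4) p \<Omega>])
  show "pi_on_defined M \<Omega> f g" unfolding u(1) v(1) by (rule pi_on_eqI(1)[OF \<Psi> M \<Omega> lim])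
  show "\<forall>F\<in>Lp_loc \<Omega> 1. \<forall>G\<in>Lp_loc \<Omega> 1. regular_dist \<Omega> F = f \<and> regular_dist \<Omega> G = g \<longrightarrow>
           (\<lambda>x. F x * G x) \<in> Lp_loc \<Omega> r \<and> pi_on M \<Omega> f g = regular_dist \<Omega> (\<lambda>x. F x * G x)"
  proof (intro ballI impI, elim conjE)
    fix F G assume F: "F \<in> Lp_loc \<Omega> 1" and G: "G \<in> Lp_loc \<Omega> 1" and Ff: "regular_dist \<Omega> F = f" and Gg: "regular_dist \<Omega> G = g"
    have le: "inverse p \<le> 1" "inverse q \<le> 1" by (rule order_trans[OF _ p(3)], simp)+
    have eq: "AE x in lborel. x \<in> \<Omega> \<longrightarrow> H x = h x"
      if "H \<in> Lp_loc \<Omega> 1" "h \<in> Lp_loc UNIV s" "0 < s" "inverse s \<le> 1"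
        "regular_dist \<Omega> H = restr \<Omega> w" "restr UNIV w = regular_dist UNIV h" for H h s w
    proof (rule AE_eq_if_regular_dist_eq[OF \<Psi> \<Omega> that(1-4)])
      fix \<phi> assume "\<phi> \<in> test_functions \<Omega>"
      then show "regular_dist \<Omega> H \<phi> = regular_dist UNIV h \<phi>"
        unfolding that(5) that(6)[symmetric] using test_functions_UNIV by (auto simp: restr_def)
    qed
    \<comment> \<open>F represents the restriction to \<Omega> of a functional represented by f' in
      L_p,loc of the whole space, so the two agree almost everywhere on \<Omega>. This carries the
      exponent p over to F, of which only local integrability was assumed; likewise for G.\<close>
    have FG: "AE x in lborel. x \<in> \<Omega> \<longrightarrow> F x = f' x" "AE x in lborel. x \<in> \<Omega> \<longrightarrow> G x = g' x"
      by (rule eq[OF F u(3) p(1) le(1) Ff[unfolded u(1)] u(4)])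
         (rule eq[OF G v(3) p(2) le(2) Gg[unfolded v(1)] v(4)])
    have meas: "(\<lambda>x. F x * G x) \<in> borel_measurable (lebesgue_on \<Omega>)"
      by (intro borel_measurable_times Lp_loc_measurable[OF F] Lp_loc_measurable[OF G])
    show "(\<lambda>x. F x * G x) \<in> Lp_loc \<Omega> r \<and> pi_on M \<Omega> f g = regular_dist \<Omega> (\<lambda>x. F x * G x)"
    proof
      \<comment> \<open>Hoelder's inequality on K is applied to f' and g' and then transferred to F
        and G.\<close>
      have "Lp_norm (lebesgue_on K) r (\<lambda>x. ennreal (norm (F x * G x))) < \<infinity>" if K: "compact K" "K \<subseteq> \<Omega>" for K
      proof -
        have Ks: "K \<inter> space lebesgue \<in> sets lebesgue" using K(1) by (simp add: borel_compact)
        have m: "f' \<in> borel_measurable (lebesgue_on K)" "g' \<in> borel_measurable (lebesgue_on K)"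
          by (rule measurable_lebesgue_on_subset[OF Lp_loc_measurable[OF u(3)]], rule measurable_lebesgue_on_subset[OF Lp_loc_measurable[OF v(3)]])
        have mFG: "(\<lambda>x. F x * G x) \<in> borel_measurable (lebesgue_on K)"
          using K(2) by (rule measurable_restrict_mono[OF meas])
        have "Lp_mem (lebesgue_on K) p f'" "Lp_mem (lebesgue_on K) q g'"
          using u(3) v(3) K(1) Lp_norm_finite_iff[OF m(1) p(1)] Lp_norm_finite_iff[OF m(2) p(2)]
          by (auto simp: Lp_loc_def)
        then have mem: "Lp_mem (lebesgue_on K) r (\<lambda>x. f' x * g' x)" by (rule Lp_mem_mult[OF m _ _ p(1,2) r])
        have "AE x in lborel. x \<in> K \<longrightarrow> f' x * g' x = F x * G x"
          using FG by eventually_elim (use K(2) in auto)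
        then have "AE x in lebesgue_on K. f' x * g' x = F x * G x"
          by (simp add: AE_restrict_space_iff[OF Ks] AE_completion_iff)
        then show ?thesis
          unfolding Lp_norm_finite_iff[OF mFG r(1)] using mem by (rule Lp_mem_cong_AE)
      qed
      then show "(\<lambda>x. F x * G x) \<in> Lp_loc \<Omega> r" using meas by (simp add: Lp_loc_def)
      have "pi_on M \<Omega> f g = regular_dist \<Omega> (\<lambda>x. f' x * g' x)"
        unfolding u(1) v(1) by (rule pi_on_eqI(2)[OF \<Psi> M \<Omega> lim])
      also have "\<dots> = regular_dist \<Omega> (\<lambda>x. F x * G x)"
      proof
        fix \<phi>
        show "regular_dist \<Omega> (\<lambda>x. f' x * g' x) \<phi> = regular_dist \<Omega> (\<lambda>x. F x * G x) \<phi>"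
        proof (cases "\<phi> \<in> test_functions \<Omega>")
          case True
          obtain K where K: "smooth \<phi>" "compact K" "K \<subseteq> \<Omega>" "\<And>x bs. x \<notin> K \<Longrightarrow> iter_deriv bs \<phi> x = 0" "\<And>x. x \<notin> K \<Longrightarrow> \<phi> x = 0"
            by (rule test_functionsE[OF True]) (rule that)
          obtain R where R: "K \<subseteq> ball 0 R" using compact_imp_bounded[OF K(2)] bounded_subset_ballD by blast
          \<comment> \<open>Both functionals are evaluated through one Borel version f0 g0 of the
            product near the support of \<phi>, which turns almost everywhere equality into equality
            of the values at \<phi>.\<close>
          obtain f0 g0 where int: "integrable lborel f0" "integrable lborel g0"
            and e: "AE x in lborel. x \<in> cball 0 R \<longrightarrow> f' x = f0 x" "AE x in lborel. x \<in> cball 0 R \<longrightarrow> g' x = g0 x"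
            and ta: "translation_approximable f0 g0 \<or> translation_approximable g0 f0" and int2: "integrable lborel (\<lambda>x. f0 x * g0 x)"
            by (rule Lp_loc_product[OF u(3) v(3) p, of R]) (rule that)
          have m: "(\<lambda>x. f0 x * g0 x) \<in> borel_measurable borel" using int2 by auto
          have "regular_dist \<Omega> (\<lambda>x. f' x * g' x) \<phi> = (LINT x|lborel. f0 x * g0 x * \<phi> x)"
          proof (rule regular_dist_eq[OF \<Omega> _ True K(3) K(5) m])
            show "(\<lambda>x. f' x * g' x) \<in> borel_measurable (lebesgue_on \<Omega>)"
              by (rule Lp_loc_times_measurable[OF u(3) v(3)])
            show "AE x in lborel. x \<in> K \<longrightarrow> f' x * g' x = f0 x * g0 x"
              using e by eventually_elim (use R in auto)
          qed
          moreover have "regular_dist \<Omega> (\<lambda>x. F x * G x) \<phi> = (LINT x|lborel. f0 x * g0 x * \<phi> x)"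
          proof (rule regular_dist_eq[OF \<Omega> meas True K(3) K(5) m])
            show "AE x in lborel. x \<in> K \<longrightarrow> F x * G x = f0 x * g0 x"
              using e FG
            proof eventually_elim
              case (elim x)
              show ?case
              proof
                assume "x \<in> K"
                then have "x \<in> \<Omega>" "x \<in> cball 0 R" using K(3) R by auto
                then show "F x * G x = f0 x * g0 x" using elim by metis
              qed
            qed
          qed
          ultimately show ?thesis by simp
        qed (simp add: regular_dist_def)
      qed
      finally show "pi_on M \<Omega> f g = regular_dist \<Omega> (\<lambda>x. F x * G x)" .
    qed
  qed
qed

end
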